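(* Let $\mathbb{K}$ be a (commutative) field with at least three elements, and let $\mathcal{V}$ be a $\binom{n}{2}$-dimensional affine subspace of $\mathrm{M}_n(\mathbb{K})$ included in $\mathrm{GL}_n(\mathbb{K})$. Then there are positive integers $n_1,\dots,n_p$ and a list $(P_1,\dots,P_p)\in \mathrm{GL}_{n_1}(\mathbb{K})\times\cdots\times \mathrm{GL}_{n_p}(\mathbb{K})$ of non-isotropic matrices such that $n=n_1+\cdots+n_p$ and $$\mathcal{V}\sim I_n+\bigl(P_1\mathrm{A}_{n_1}(\mathbb{K})\vee\cdots\vee P_p\mathrm{A}_{n_p}(\mathbb{K})\bigr).$$ The integer $p$ is uniquely determined by $\mathcal{V}$ and, for $1\le k\le p$, the similarity class of the non-isotropic quadratic form $X\mapsto X^TP_kX$ (on $\mathbb{K}^{n_k}$) is uniquely determined by $\mathcal{V}$. Moreover, given another list $(Q_1,\dots,Q_p)\in \mathrm{GL}_{n_1}(\mathbb{K})\times\cdots\times \mathrm{GL}_{n_p}(\mathbb{K})$, if $X\mapsto X^TQ_kX$ is similar to $X\mapsto X^TP_kX$ for each $k\in\{1,\dots,p\}$, then $$\mathcal{V}\sim I_n+\bigl(Q_1\mathrm{A}_{n_1}(\mathbb{K})\vee\cdots\vee Q_p\mathrm{A}_{n_p}(\mathbb{K})\bigr).$$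
   Context: $\mathrm{M}_n(\mathbb{K})$ is the algebra of $n\times n$ matrices over $\mathbb{K}$, $I_n$ is the identity matrix, and $\mathrm{A}_n(\mathbb{K})$ is the space of alternate matrices, i.e. those $A$ with $X^TAX=0$ for all $X\in\mathbb{K}^n$ (skew-symmetric with zero diagonal); $P\,\mathrm{A}_n(\mathbb{K}) = \{PA \mid A \in \mathrm{A}_n(\mathbb{K})\}$. A matrix $P\in \mathrm{M}_n(\mathbb{K})$ is non-isotropic if $X^TPX\neq 0$ for all $X\in\mathbb{K}^n\setminus\{0\}$. An affine subspace of $\mathrm{M}_n(\mathbb{K})$ is a translate of a linear subspace. Two affine subspaces $\mathcal{V},\mathcal{W}$ of $\mathrm{M}_n(\mathbb{K})$ are equivalent, written $\mathcal{V}\sim\mathcal{W}$, if $\mathcal{W}=R\mathcal{V}S$ for some $(R,S)\in\mathrm{GL}_n(\mathbb{K})^2$. For subsets $V\subset \mathrm{M}_n(\mathbb{K})$ and $W\subset \mathrm{M}_p(\mathbb{K})$, $V\vee W:=\left\{\begin{bmatrix}A&B\\0&C\end{bmatrix} \mid A\in V,\ B\in \mathrm{M}_{n,p}(\mathbb{K}),\ C\in W\right\}\subset \mathrm{M}_{n+p}(\mathbb{K})$, where $\mathrm{M}_{n,p}(\mathbb{K})$ is the space of $n\times p$ matrices; the operation $\vee$ is associative. Two quadratic forms $q,q'$ on vector spaces over $\mathbb{K}$ are similar if $q'$ is equivalent (isometric) to $\lambda q$ for some $\lambda\in\mathbb{K}\setminus\{0\}$; in particular, similar forms have the same dimension. 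*)

theory Defs
  imports "Jordan_Normal_Form.VS_Connect"
begin

definition GL :: "nat \<Rightarrow> 'a::field mat set" where
  "GL n = {A \<in> carrier_mat n n. invertible_mat A}"

definition alternate_mats :: "nat \<Rightarrow> 'a::field mat set" where
  "alternate_mats n = {A \<in> carrier_mat n n. \<forall>X \<in> carrier_vec n. X \<bullet> (A *\<^sub>v X) = 0}"

definition quad_form :: "'a::field mat \<Rightarrow> 'a vec \<Rightarrow> 'a" where
  "quad_form P X = X \<bullet> (P *\<^sub>v X)"

definition non_isotropic :: "nat \<Rightarrow> 'a::field mat \<Rightarrow> bool" where
  "non_isotropic n P \<longleftrightarrow>
     P \<in> carrier_mat n n \<and> (\<forall>X \<in> carrier_vec n. X \<noteq> 0\<^sub>v n \<longrightarrow> X \<bullet> (P *\<^sub>v X) \<noteq> 0)"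

definition linear_subspace_of_dim :: "nat \<Rightarrow> nat \<Rightarrow> 'a::field mat set \<Rightarrow> bool" where
  "linear_subspace_of_dim n d W \<longleftrightarrow>
     subspace class_ring W (module_mat TYPE('a) n n) \<and>
     vectorspace.dim class_ring ((module_mat TYPE('a) n n)\<lparr>carrier := W\<rparr>) = d"

definition affine_subspace_of_dim :: "nat \<Rightarrow> nat \<Rightarrow> 'a::field mat set \<Rightarrow> bool" where
  "affine_subspace_of_dim n d \<V> \<longleftrightarrow>
     (\<exists>A \<in> carrier_mat n n. \<exists>W. linear_subspace_of_dim n d W \<and> \<V> = (\<lambda>M. A + M) ` W)"

definition equivalent_sets :: "nat \<Rightarrow> 'a::field mat set \<Rightarrow> 'a mat set \<Rightarrow> bool" where
  "equivalent_sets n \<V> \<W> \<longleftrightarrow> (\<exists>R \<in> GL n. \<exists>S \<in> GL n. \<W> = (\<lambda>M. R * M * S) ` \<V>)"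

definition block_join :: "'a::field mat set \<Rightarrow> 'a mat set \<Rightarrow> 'a mat set" where
  "block_join V W = {four_block_mat A B (0\<^sub>m (dim_row C) (dim_col A)) C | A B C.
     A \<in> V \<and> B \<in> carrier_mat (dim_row A) (dim_col C) \<and> C \<in> W}"

text \<open>The 0-by-0 matrix space is the unit of \<^const>\<open>block_join\<close>; it is the value of
  \<open>block_joins\<close> on the empty list.\<close>

definition block_joins :: "'a::field mat set list \<Rightarrow> 'a mat set" where
  "block_joins Vs = foldr block_join Vs {0\<^sub>m 0 0}"

lemma block_join_unit_right:
  fixes V :: "'a::field mat set"
  shows "block_join V {0\<^sub>m 0 0} = V"
proof -
  have eq: "four_block_mat A B (0\<^sub>m 0 (dim_col A)) (0\<^sub>m 0 0) = A"
    if "B \<in> carrier_mat (dim_row A) 0" for A B :: "'a mat"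
    using that by (intro eq_matI) auto
  have ex: "0\<^sub>m (dim_row A) 0 \<in> carrier_mat (dim_row A) 0" for A :: "'a mat"
    by simp
  show ?thesis
    unfolding block_join_def
  proof (intro equalityI subsetI)
    fix M assume "M \<in> V"
    then show "M \<in> {four_block_mat A B (0\<^sub>m (dim_row C) (dim_col A)) C | A B C.
        A \<in> V \<and> B \<in> carrier_mat (dim_row A) (dim_col C) \<and> C \<in> {0\<^sub>m 0 0}}"
      using eq[OF ex, of M] ex[of M]
      by (intro CollectI exI[of _ M] exI[of _ "0\<^sub>m (dim_row M) 0"] exI[of _ "0\<^sub>m 0 0"]) simp
  qed (auto simp: eq)
qed

definition model_space :: "nat \<Rightarrow> 'a::field mat list \<Rightarrow> 'a mat set" where
  "model_space n Ps =
     (\<lambda>M. 1\<^sub>m n + M) ` block_joins (map (\<lambda>P. (\<lambda>A. P * A) ` alternate_mats (dim_row P)) Ps)"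

text \<open>A quadratic form on \<open>K\<^sup>n\<close> is given by \<open>n\<close> and a function that matters only on
  \<^term>\<open>carrier_vec n\<close>.\<close>

definition isometric_forms ::
    "nat \<Rightarrow> ('a::field vec \<Rightarrow> 'a) \<Rightarrow> nat \<Rightarrow> ('a vec \<Rightarrow> 'a) \<Rightarrow> bool" where
  "isometric_forms n q m q' \<longleftrightarrow>
     (\<exists>f. linear_map class_ring (module_vec TYPE('a) n) (module_vec TYPE('a) m) f \<and>
          bij_betw f (carrier_vec n) (carrier_vec m) \<and>
          (\<forall>X \<in> carrier_vec n. q' (f X) = q X))"

definition similar_forms ::
    "nat \<Rightarrow> ('a::field vec \<Rightarrow> 'a) \<Rightarrow> nat \<Rightarrow> ('a vec \<Rightarrow> 'a) \<Rightarrow> bool" where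
  "similar_forms n q m q' \<longleftrightarrow> (\<exists>c. c \<noteq> 0 \<and> isometric_forms n (\<lambda>X. c * q X) m q')"

definition non_isotropic_decomposition ::
    "nat \<Rightarrow> 'a::field mat set \<Rightarrow> nat list \<Rightarrow> 'a mat list \<Rightarrow> bool" where
  "non_isotropic_decomposition n \<V> ns Ps \<longleftrightarrow>
     (\<forall>m \<in> set ns. 0 < m) \<and>
     list_all2 (\<lambda>m P. P \<in> GL m \<and> non_isotropic m P) ns Ps \<and>
     n = sum_list ns \<and>
     equivalent_sets n \<V> (model_space n Ps)"

end

theory Submission
  imports Defs "HOL-Library.Function_Algebras"
begin

text \<open>
  Multiplying by the inverse of one of its elements, \<open>\<V>\<close> becomes \<open>I + W\<close>, where \<open>W\<close> is a linear space
  of operators without nonzero fixed vector, of the largest possible dimension \<open>n choose 2\<close>.  Call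
  \<open>x \<noteq> 0\<close> good if \<open>W\<close> contains no nonzero operator with image in the line of \<open>x\<close>.  Every basis
  contains a good vector, and for good \<open>x\<close> the space \<open>W x\<close> is a hyperplane avoiding \<open>x\<close> while the
  stabilizer \<open>W\<^sub>x = {M \<in> W. M x = 0}\<close> is again of maximal dimension on the quotient by \<open>x\<close>; this
  drives an induction on \<open>n\<close>.  As the field has a third element, every \<open>M \<in> W\<^sub>x\<close> has its image in \<open>W x\<close>.
  From this one sees that if \<open>W\<close> is irreducible, then so is \<open>W\<^sub>x\<close> on the quotient, and that the
  non-isotropic form \<open>B\<close> with \<open>B(y, M y) = 0\<close> given there by induction lifts to a non-isotropic form
  \<open>b\<close> with \<open>b(v, M v) = 0\<close> for all \<open>M \<in> W\<close>; its Gram matrix is the inverse of \<open>P\<close>, and \<open>W\<close> is the space of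
  all \<open>P A\<close> with \<open>A\<close> alternate.  If \<open>W\<close> is reducible, counting dimensions shows that it is the full join
  of the two induced spaces.

  For uniqueness, the nonzero vectors \<open>x\<close> of the first block are those for which \<open>W x\<close> is minimal under
  inclusion, so that an equivalence is block triangular.  For a single block, a matrix \<open>T\<close> such that
  \<open>T A\<close> is alternate for all alternate \<open>A\<close> is scalar, and this turns equivalence of the spaces into
  similarity of the forms.
\<close>

section \<open>Finite-dimensional subspaces\<close>

text \<open>The bound \<open>n choose 2\<close> comes from adding up orbits: x is never in its own
  orbit, so each passage to a stabilizer costs at most the codimension minus one. The obstacle is
  that an element of the stabilizer may act as zero on the quotient by x without having done so
  before, namely when its image lies in the line of x; goodness excludes exactly this. Bad vectors
  cannot span because a combination of their rank one operators would have a fixed vector.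
  Maximality is used by forcing equality in every step of such counts, and all transitivity
  statements come from there.

  The third element \<open>\<tau>\<close> enters three times: a monic quadratic polynomial cannot
  vanish at 0, 1 and \<tau>; an operator N is compared with \<tau> N; and a quadratic identity is
  polarized at 1 and \<tau>.

  The construction of the blocks yields only an inclusion of W in a conjugate of the block model.
  Equality follows because the model consists of operators without nonzero fixed vector, so that its
  dimension cannot exceed \<open>n choose 2\<close>.\<close>

context vector_space
begin

text \<open>The ambient spaces will be spaces of functions on the natural numbers. There
  \<open>dim\<close> is the cardinality of a basis and an infinite basis counts as 0, so dimensions
  are comparable only below a finite spanning set.\<close>

definition fin_dim :: "'b set \<Rightarrow> bool" where
  "fin_dim S \<longleftrightarrow> (\<exists>B. finite B \<and> S \<subseteq> local.span B)"

lemma fin_dim_subset: "local.fin_dim T \<Longrightarrow> S \<subseteq> T \<Longrightarrow> local.fin_dim S"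
  unfolding fin_dim_def by blast

lemma fin_dim_finite_independent:
  assumes "local.fin_dim S" "local.independent B" "B \<subseteq> S"
  shows "finite B"
  using assms independent_span_bound unfolding fin_dim_def by blast

lemma dim_subset_fin_dim:
  assumes "local.fin_dim T" "S \<subseteq> T"
  shows "local.dim S \<le> local.dim T"
proof -
  obtain B where B: "B \<subseteq> T" "local.independent B" "T \<subseteq> local.span B" "card B = local.dim T"
    by (rule basis_exists)
  then have "finite B" using assms fin_dim_finite_independent by blast
  then show ?thesis using dim_le_card[of S B] B assms by auto
qed

lemma dim_insert_fin_dim:
  assumes "local.fin_dim S" "x \<notin> local.span S"
  shows "local.dim (local.span (insert x S)) = local.dim S + 1" and "local.fin_dim (local.span (insert x S))"
proof -
  obtain B where B: "B \<subseteq> S" "local.independent B" "S \<subseteq> local.span B" "card B = local.dim S"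
    by (rule basis_exists)
  then have fin: "finite B" using assms fin_dim_finite_independent by blast
  have sp: "local.span B = local.span S"
    using B span_mono[of B S] span_minimal[of S "local.span B"] by auto
  have ind: "local.independent (insert x B)" using B assms sp independent_insertI by auto
  have sp2: "local.span (insert x B) = local.span (insert x S)"
    unfolding span_insert sp ..
  have "x \<notin> B" using assms(2) sp span_base by blast
  then show "local.dim (local.span (insert x S)) = local.dim S + 1"
    using dim_span_eq_card_independent[OF ind] sp2 fin B by simp
  show "local.fin_dim (local.span (insert x S))"
    unfolding fin_dim_def using fin sp2 by (intro exI[of _ "insert x B"]) auto
qed

lemma subspace_eq_if_dim_le:
  assumes "local.subspace S" "local.subspace T" "S \<subseteq> T" "local.fin_dim T" "local.dim T \<le> local.dim S"
  shows "S = T"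
proof (rule ccontr)
  assume "S \<noteq> T"
  then obtain x where x: "x \<in> T" "x \<notin> S" using assms by blast
  have "local.span (insert x S) \<subseteq> T" using x assms by (intro span_minimal) auto
  moreover have "local.dim (local.span (insert x S)) = local.dim S + 1"
    using dim_insert_fin_dim[of S x] fin_dim_subset[OF assms(4,3)] x iffD2[OF span_eq_iff assms(1)]
    by (simp del: dim_span)
  ultimately show False using dim_subset_fin_dim[OF assms(4), of "local.span (insert x S)"] assms(5)
    by linarith
qed

lemma mem_span_insert_iff:
  "local.subspace S \<Longrightarrow> z \<in> local.span (insert x S) \<longleftrightarrow> (\<exists>k. z - scale k x \<in> S)"
  by (simp add: span_breakdown_eq iffD2[OF span_eq_iff])

end

context vector_space_pair
begin

text \<open>Rank-nullity for \<open>f\<close> on \<open>W\<close> followed by reduction modulo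
  \<open>F\<close>, with the dimension of \<open>F\<close> added on both sides so that no quotient
  has to be formed.\<close>

lemma dim_preimage_image:
  assumes f: "Vector_Spaces.linear s1 s2 f"
    and W: "vs1.subspace W" "vs1.fin_dim W" and F: "vs2.subspace F" "vs2.fin_dim F"
  shows "vs1.dim W + vs2.dim F = vs1.dim {m \<in> W. f m \<in> F} + vs2.dim (vs2.span (f ` W \<union> F))"
    and "vs2.fin_dim (vs2.span (f ` W \<union> F))"
proof -
  obtain K where K: "K \<subseteq> {m \<in> W. f m \<in> F}" "vs1.independent K" "{m \<in> W. f m \<in> F} \<subseteq> vs1.span K"
    "card K = vs1.dim {m \<in> W. f m \<in> F}" by (rule vs1.basis_exists)
  obtain Bf where Bf: "Bf \<subseteq> F" "vs2.independent Bf" "F \<subseteq> vs2.span Bf" "card Bf = vs2.dim F"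
    by (rule vs2.basis_exists)
  obtain B where B: "Bf \<subseteq> B" "B \<subseteq> Bf \<union> f ` W" "vs2.independent B" "Bf \<union> f ` W \<subseteq> vs2.span B"
    by (rule vs2.maximal_independent_subset_extend[of Bf "Bf \<union> f ` W"]) (use Bf in auto)
  have fK: "finite K" using vs1.fin_dim_finite_independent[OF W(2) K(2)] K(1) by auto
  have fBf: "finite Bf" using vs2.fin_dim_finite_independent[OF F(2) Bf(2)] Bf(1) by auto
  obtain W0 where W0: "finite W0" "W \<subseteq> vs1.span W0" using W(2) unfolding vs1.fin_dim_def by auto
  have spF: "vs2.span Bf = F" using Bf F vs2.span_subspace by blast
  have "f ` W \<subseteq> vs2.span (f ` W0)" using linear_spans_image[OF f W0(2)] .
  also have "\<dots> \<subseteq> vs2.span (f ` W0 \<union> Bf)" by (intro vs2.span_mono) auto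
  finally have "f ` W \<union> Bf \<subseteq> vs2.span (f ` W0 \<union> Bf)" using vs2.span_superset[of "f ` W0 \<union> Bf"] by blast
  then have Bsp: "B \<subseteq> vs2.span (f ` W0 \<union> Bf)" using B(2) by blast
  have "finite (f ` W0 \<union> Bf)" using W0 fBf by simp
  then have fB: "finite B" using vs2.independent_span_bound[OF _ B(3) Bsp] by simp
  have spB: "vs2.span B = vs2.span (f ` W \<union> F)"
  proof (rule antisym)
    show "vs2.span B \<subseteq> vs2.span (f ` W \<union> F)" using B(2) Bf(1) by (intro vs2.span_mono) auto
    have "F \<subseteq> vs2.span B" using spF vs2.span_mono[OF B(1)] by auto
    then show "vs2.span (f ` W \<union> F) \<subseteq> vs2.span B" using B(4) by (intro vs2.span_minimal) auto
  qed
  show "vs2.fin_dim (vs2.span (f ` W \<union> F))"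
    unfolding vs2.fin_dim_def using fB spB by auto
  define C where "C = B - Bf"
  have C: "C \<subseteq> f ` W" "finite C" "C \<inter> Bf = {}" "B = Bf \<union> C" using B fB by (auto simp: C_def)
  then have "\<forall>c\<in>C. \<exists>m\<in>W. f m = c" by auto
  then obtain g where g: "\<And>c. c \<in> C \<Longrightarrow> g c \<in> W" "\<And>c. c \<in> C \<Longrightarrow> f (g c) = c" by metis
  have fg: "f ` g ` D = D" if "D \<subseteq> C" for D
  proof -
    have "f ` g ` D = (\<lambda>x. x) ` D" unfolding image_image by (rule image_cong) (use g that in auto)
    then show ?thesis by simp
  qed
  have ind: "vs1.independent (K \<union> g ` D) \<and> card (K \<union> g ` D) = card K + card D" if "D \<subseteq> C" for D
    using finite_subset[OF that C(2)] that
  proof (induction D rule: finite_induct)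
    case empty
    then show ?case using K by simp
  next
    case (insert c D)
    have "g c \<notin> vs1.span (K \<union> g ` D)"
    proof
      assume "g c \<in> vs1.span (K \<union> g ` D)"
      then have "f (g c) \<in> f ` vs1.span (K \<union> g ` D)" by (rule imageI)
      then have "c \<in> f ` vs1.span (K \<union> g ` D)" using g(2)[of c] insert.prems by simp
      also have "\<dots> = vs2.span (f ` K \<union> f ` g ` D)"
        unfolding linear_span_image[OF f, symmetric] image_Un ..
      also have "\<dots> \<subseteq> vs2.span (B - {c})"
      proof (intro vs2.span_minimal vs2.subspace_span Un_least)
        have "f ` K \<subseteq> vs2.span Bf" using K spF by auto
        also have "\<dots> \<subseteq> vs2.span (B - {c})" using C insert.prems by (intro vs2.span_mono) auto
        finally show "f ` K \<subseteq> vs2.span (B - {c})" .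
        have "f ` g ` D = D" using fg insert.prems by simp
        also have "\<dots> \<subseteq> B - {c}" using C insert by auto
        finally show "f ` g ` D \<subseteq> vs2.span (B - {c})" using vs2.span_superset by blast
      qed
      finally have "c \<in> vs2.span (B - {c})" .
      then show False using B(3) C insert.prems unfolding vs2.dependent_def by blast
    qed
    moreover from this have "g c \<notin> K \<union> g ` D" using vs1.span_base[of "g c" "K \<union> g ` D"] by auto
    ultimately show ?case using insert fK vs1.independent_insertI[of "g c" "K \<union> g ` D"] by simp
  qed
  have "W \<subseteq> vs1.span (K \<union> g ` C)"
  proof
    fix m assume m: "m \<in> W"
    then have "f m \<in> vs2.span (Bf \<union> C)" using B C by blast
    then obtain u v where uv: "f m = u + v" "u \<in> vs2.span Bf" "v \<in> vs2.span C"
      unfolding vs2.span_Un by auto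
    have "vs2.span C = f ` vs1.span (g ` C)" using linear_span_image[OF f, of "g ` C"] fg[of C] by simp
    then obtain k where k: "k \<in> vs1.span (g ` C)" "v = f k" using uv by auto
    have "vs1.span (g ` C) \<subseteq> W" using g W by (intro vs1.span_minimal) auto
    then have "m - k \<in> W" using k m W vs1.subspace_diff by blast
    moreover have "f (m - k) \<in> F" using uv k spF linear_diff[OF f] by auto
    ultimately have "m - k \<in> vs1.span K" using K by auto
    then have "m - k \<in> vs1.span (K \<union> g ` C)" using vs1.span_mono[of K "K \<union> g ` C"] by auto
    moreover have "k \<in> vs1.span (K \<union> g ` C)" using k vs1.span_mono[of "g ` C" "K \<union> g ` C"] by auto
    ultimately show "m \<in> vs1.span (K \<union> g ` C)" using vs1.span_add[of "m - k" _ k] by simp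
  qed
  then have "vs1.dim W = card K + card C"
    using ind[of C] K(1) g(1) by (subst vs1.basis_card_eq_dim[symmetric, of "K \<union> g ` C"]) auto
  moreover have "vs2.dim (vs2.span (f ` W \<union> F)) = card Bf + card C"
    using vs2.dim_span_eq_card_independent[OF B(3)] spB C fBf by (simp add: card_Un_disjoint Int_commute del: vs2.dim_span)
  ultimately show "vs1.dim W + vs2.dim F = vs1.dim {m \<in> W. f m \<in> F} + vs2.dim (vs2.span (f ` W \<union> F))"
    using K(4) Bf(4) by linarith
qed

end

lemma vector_space_field: "vector_space ((*) :: 'a::field \<Rightarrow> 'a \<Rightarrow> 'a)"
  by unfold_locales (simp_all add: distrib_left distrib_right)

lemma (in vector_space) separating_functional:
  assumes "local.subspace F" "x \<notin> F"
  shows "\<exists>h. Vector_Spaces.linear scale (*) h \<and> (\<forall>z\<in>F. h z = 0) \<and> h x = 1"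
proof -
  interpret p: vector_space_pair scale "(*)"
    using vector_space_field vector_space_axioms by (rule vector_space_pair.intro[rotated])
  obtain B where B: "B \<subseteq> F" "local.independent B" "F \<subseteq> local.span B" using maximal_independent_subset by blast
  then have "local.span B = F" using assms(1) by (intro span_subspace)
  then have "x \<notin> local.span B" using assms(2) by simp
  then have "local.independent (insert x B)" "x \<notin> B" using B independent_insertI[of x B] span_base[of x B] by auto
  then obtain h where h: "Vector_Spaces.linear scale (*) h" "\<forall>z\<in>insert x B. h z = (if z = x then 1 else 0)"
    using p.linear_independent_extend[of "insert x B" "\<lambda>z. if z = x then 1 else 0"] by auto
  have "h z = 0" if "z \<in> F" for z
    by (rule p.linear_eq_0_on_span[OF h(1), of B]) (use h \<open>x \<notin> B\<close> that B in auto)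
  then show ?thesis using h by auto
qed

section \<open>Spaces of operators with trivial spectrum\<close>

text \<open>Take a nonempty subset of least cardinality in which every element has a successor. By
  minimality every choice of successors maps it onto itself. An element c with two successors could
  switch to the other one, which is already the image of some other element, and the new choice
  would be onto but not injective.\<close>

lemma unique_successor_subset:
  assumes "finite C" "C \<noteq> {}" "\<forall>c\<in>C. \<exists>e\<in>C. R c e"
  obtains S where "S \<subseteq> C" "S \<noteq> {}" "\<forall>c\<in>S. \<exists>!e. e \<in> S \<and> R c e"
proof -
  define P where "P S \<longleftrightarrow> S \<subseteq> C \<and> S \<noteq> {} \<and> (\<forall>c\<in>S. \<exists>e\<in>S. R c e)" for S
  have "P C" using assms by (auto simp: P_def)
  then obtain S where S: "P S" and min: "\<And>T. P T \<Longrightarrow> card S \<le> card T"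
    using arg_min_natI[of P C card] arg_min_nat_le[of P _ card] by blast
  have fS: "finite S" using S assms(1) finite_subset unfolding P_def by blast
  have surj: "g ` S = S" if g: "\<And>c. c \<in> S \<Longrightarrow> g c \<in> S \<and> R c (g c)" for g
  proof -
    have sub: "g ` S \<subseteq> S" using g by auto
    moreover have "P (g ` S)" unfolding P_def
    proof (intro conjI ballI)
      show "g ` S \<subseteq> C" "g ` S \<noteq> {}" using sub S unfolding P_def by auto
      fix c assume "c \<in> g ` S"
      then show "\<exists>e\<in>g ` S. R c e" using sub g by blast
    qed
    ultimately show ?thesis using min fS card_seteq by blast
  qed
  have uniq: "\<exists>!e. e \<in> S \<and> R c e" if c: "c \<in> S" for c
  proof (rule ccontr)
    assume not: "\<not> (\<exists>!e. e \<in> S \<and> R c e)"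
    obtain g where g: "\<And>c. c \<in> S \<Longrightarrow> g c \<in> S \<and> R c (g c)"
      using S unfolding P_def by metis
    obtain e where e: "e \<in> S" "R c e" "e \<noteq> g c" using not g[OF c] by metis
    have "e \<in> g ` S" using surj[OF g] e by simp
    then obtain k where k: "k \<in> S" "g k = e" by blast
    then have kc: "k \<noteq> c" using e by auto
    have "(g(c := e)) ` S = S" using g e by (intro surj) auto
    then have "inj_on (g(c := e)) S" using fS by (simp add: eq_card_imp_inj_on)
    then show False using kc k c unfolding inj_on_def by auto
  qed
  show ?thesis
  proof (rule that)
    show "S \<subseteq> C" "S \<noteq> {}" using S unfolding P_def by auto
    show "\<forall>c\<in>S. \<exists>!e. e \<in> S \<and> R c e" using uniq by blast
  qed
qed

locale bilinear_action = Op: vector_space sw + V: vector_space sv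
  for sw :: "'a::field \<Rightarrow> 'w::ab_group_add \<Rightarrow> 'w" (infixr "*w" 75)
    and sv :: "'a \<Rightarrow> 'v::ab_group_add \<Rightarrow> 'v" (infixr "*s" 75) +
  fixes act :: "'w \<Rightarrow> 'v \<Rightarrow> 'v" (infixr "\<star>" 74)
  assumes act_add_left: "(m + n) \<star> v = m \<star> v + n \<star> v"
    and act_scale_left: "(c *w m) \<star> v = c *s (m \<star> v)"
    and act_add_right: "m \<star> (u + v) = m \<star> u + m \<star> v"
    and act_scale_right: "m \<star> (c *s v) = c *s (m \<star> v)"
begin

sublocale OV: vector_space_pair sw sv ..
sublocale VV: vector_space_pair sv sv ..

lemma vector_space_pair_field: "vector_space_pair sv (*)"
  using vector_space_field V.vector_space_axioms by (rule vector_space_pair.intro[rotated])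

lemma linear_act_left: "Vector_Spaces.linear sw sv (\<lambda>m. m \<star> v)"
  by (simp add: Vector_Spaces.linear_iff act_add_left act_scale_left Op.vector_space_axioms V.vector_space_axioms)

lemma linear_act_right: "Vector_Spaces.linear sv sv (\<lambda>v. m \<star> v)"
  by (simp add: Vector_Spaces.linear_iff act_add_right act_scale_right V.vector_space_axioms)

lemma act_zero_left [simp]: "0 \<star> v = 0"
  using OV.linear_0[OF linear_act_left] .
lemma act_zero_right [simp]: "m \<star> 0 = 0"
  using VV.linear_0[OF linear_act_right] .
lemma act_diff_left: "(m - n) \<star> v = m \<star> v - n \<star> v"
  using OV.linear_diff[OF linear_act_left] .
lemma act_diff_right: "m \<star> (u - v) = m \<star> u - m \<star> v"
  using VV.linear_diff[OF linear_act_right] .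
lemma act_minus_left: "(- m) \<star> v = - (m \<star> v)"
  using OV.linear_neg[OF linear_act_left] .
lemma act_sum_left: "sum m I \<star> v = (\<Sum>i\<in>I. m i \<star> v)"
  using OV.linear_sum[OF linear_act_left] .
lemma act_sum_right: "m \<star> sum v I = (\<Sum>i\<in>I. m \<star> v i)"
  using VV.linear_sum[OF linear_act_right] .

lemmas act_simps = act_add_left act_scale_left act_add_right act_scale_right
  act_diff_left act_diff_right act_minus_left

abbreviation functional :: "('v \<Rightarrow> 'a) \<Rightarrow> bool" where
  "functional h \<equiv> Vector_Spaces.linear sv (*) h"

lemma functional_simps:
  assumes "functional h"
  shows "h 0 = 0" "h (u + v) = h u + h v" "h (u - v) = h u - h v" "h (c *s v) = c * h v" "h (- v) = - h v"
  using vector_space_pair.linear_0[OF vector_space_pair_field assms]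
    vector_space_pair.linear_add[OF vector_space_pair_field assms]
    vector_space_pair.linear_diff[OF vector_space_pair_field assms]
    vector_space_pair.linear_scale[OF vector_space_pair_field assms]
    vector_space_pair.linear_neg[OF vector_space_pair_field assms] by auto

text \<open>Quotient spaces are avoided: a pair \<open>F \<subseteq> E\<close> of subspaces stands for \<open>E / F\<close>, and an element of
  \<open>W\<close> for the operator that it induces there; distinct elements may induce the same operator, whence
  the term \<open>annihilator W E F\<close> in dimension formulas.\<close>

definition trivial_spectrum :: "'w set \<Rightarrow> 'v set \<Rightarrow> 'v set \<Rightarrow> bool" where
  "trivial_spectrum W E F \<longleftrightarrow> Op.subspace W \<and> Op.fin_dim W \<and> V.subspace E \<and> V.fin_dim E \<and>
    V.subspace F \<and> F \<subseteq> E \<and> (\<forall>m\<in>W. \<forall>v\<in>E. m \<star> v \<in> E) \<and> (\<forall>m\<in>W. \<forall>v\<in>F. m \<star> v \<in> F) \<and>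
    (\<forall>m\<in>W. \<forall>v\<in>E. v - m \<star> v \<in> F \<longrightarrow> v \<in> F)"

lemma trivial_spectrumD:
  assumes "trivial_spectrum W E F"
  shows "Op.subspace W" "Op.fin_dim W" "V.subspace E" "V.fin_dim E" "V.subspace F" "F \<subseteq> E"
    "\<And>m v. m \<in> W \<Longrightarrow> v \<in> E \<Longrightarrow> m \<star> v \<in> E"
    "\<And>m v. m \<in> W \<Longrightarrow> v \<in> F \<Longrightarrow> m \<star> v \<in> F"
    "\<And>m v. m \<in> W \<Longrightarrow> v \<in> E \<Longrightarrow> v - m \<star> v \<in> F \<Longrightarrow> v \<in> F"
    "V.fin_dim F"
  using assms V.fin_dim_subset unfolding trivial_spectrum_def by blast+

definition annihilator :: "'w set \<Rightarrow> 'v set \<Rightarrow> 'v set \<Rightarrow> 'w set" where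
  "annihilator W E F = {m \<in> W. \<forall>v\<in>E. m \<star> v \<in> F}"

definition stabilizer :: "'w set \<Rightarrow> 'v \<Rightarrow> 'v set \<Rightarrow> 'w set" where
  "stabilizer W x F = {m \<in> W. m \<star> x \<in> F}"

abbreviation adjoin :: "'v \<Rightarrow> 'v set \<Rightarrow> 'v set" where
  "adjoin x F \<equiv> V.span (insert x F)"

text \<open>This is the condition under which passing to the stabilizer of x on the quotient by x
  creates no new operators that act as zero.\<close>

definition good :: "'w set \<Rightarrow> 'v set \<Rightarrow> 'v set \<Rightarrow> 'v \<Rightarrow> bool" where
  "good W E F x \<longleftrightarrow> x \<in> E \<and> x \<notin> F \<and>
    (\<forall>m\<in>W. (\<forall>v\<in>E. m \<star> v \<in> adjoin x F) \<longrightarrow> (\<forall>v\<in>E. m \<star> v \<in> F))"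

lemma subspace_act_vimage: "V.subspace F \<Longrightarrow> V.subspace {v. m \<star> v \<in> F}"
  using VV.linear_subspace_linear_preimage[OF linear_act_right] .

lemma subspace_stabilizer:
  "Op.subspace W \<Longrightarrow> V.subspace F \<Longrightarrow> Op.subspace (stabilizer W x F)"
  unfolding stabilizer_def Op.subspace_def V.subspace_def by (auto simp: act_simps)

lemma subspace_annihilator:
  "Op.subspace W \<Longrightarrow> V.subspace F \<Longrightarrow> Op.subspace (annihilator W E F)"
  unfolding annihilator_def Op.subspace_def V.subspace_def by (auto simp: act_simps)

lemma adjoin_minimal:
  "V.subspace E \<Longrightarrow> F \<subseteq> E \<Longrightarrow> x \<in> E \<Longrightarrow> adjoin x F \<subseteq> E"
  by (intro V.span_minimal) auto

lemma in_adjoin: "x \<in> adjoin x F" "z \<in> F \<Longrightarrow> z \<in> adjoin x F"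
  by (auto intro: V.span_base)

lemma adjoinI: "V.subspace F \<Longrightarrow> z - k *s x \<in> F \<Longrightarrow> z \<in> adjoin x F"
  unfolding V.mem_span_insert_iff by (rule exI)

lemma adjoinE:
  assumes "V.subspace F" "z \<in> adjoin x F"
  obtains k where "z - k *s x \<in> F"
  using assms(2) unfolding V.mem_span_insert_iff[OF assms(1)] by (rule exE)

lemma dim_adjoin:
  assumes "V.subspace F" "V.fin_dim F" "x \<notin> F"
  shows "V.dim (adjoin x F) = V.dim F + 1"
  using V.dim_insert_fin_dim(1)[of F x] assms by (simp add: iffD2[OF V.span_eq_iff] del: V.dim_span)

text \<open>If bad vectors spanned E modulo F, some of them would form a basis C modulo F, and each
  c in C would come with an operator \<open>m c\<close> of rank one onto its line. A combination of
  these operators fixes a sum of basis vectors modulo F, against the trivial spectrum.\<close>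

lemma span_bad_neq:
  assumes ts: "trivial_spectrum W E F" and "E \<noteq> F"
  shows "V.span ({x \<in> E. \<not> good W E F x} \<union> F) \<noteq> E"
proof
  note tsD = trivial_spectrumD[OF ts]
  let ?Bad = "{x \<in> E. \<not> good W E F x}"
  assume E: "V.span (?Bad \<union> F) = E"
  obtain Bf where Bf: "Bf \<subseteq> F" "V.independent Bf" "F \<subseteq> V.span Bf" by (rule V.maximal_independent_subset)
  have spF: "V.span Bf = F" using Bf tsD V.span_subspace by blast
  obtain B where B: "Bf \<subseteq> B" "B \<subseteq> Bf \<union> ?Bad" "V.independent B" "Bf \<union> ?Bad \<subseteq> V.span B"
    by (rule V.maximal_independent_subset_extend[of Bf "Bf \<union> ?Bad"]) (use Bf in auto)
  have spB: "V.span B = E"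
  proof (rule antisym)
    show "V.span B \<subseteq> E" using B Bf tsD by (intro V.span_minimal) auto
    have "F \<subseteq> V.span B" using spF V.span_mono[OF B(1)] by auto
    then have "V.span (?Bad \<union> F) \<subseteq> V.span B" using B by (intro V.span_minimal) auto
    then show "E \<subseteq> V.span B" using E by (rule subst[rotated])
  qed
  define C where "C = B - Bf"
  have BC: "B = Bf \<union> C" using B by (auto simp: C_def)
  have "B \<subseteq> E" using B Bf tsD by auto
  then have finB: "finite B" using V.fin_dim_finite_independent[OF tsD(4) B(3)] by simp
  then have finC: "finite C" by (simp add: C_def)
  have C_ne: "C \<noteq> {}" using spB spF BC \<open>E \<noteq> F\<close> by auto
  have notin: "c \<notin> V.span (B - {c})" if "c \<in> C" for c
    using B(3) that unfolding V.dependent_def C_def by auto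
  have Fsub: "F \<subseteq> V.span (B - {c})" if "c \<in> C" for c
  proof -
    have "Bf \<subseteq> B - {c}" using B(1) that by (auto simp: C_def)
    then show ?thesis using spF V.span_mono by blast
  qed
  have C: "c \<in> E" "c \<notin> F" "\<not> good W E F c" if "c \<in> C" for c
  proof -
    show "c \<in> E" "\<not> good W E F c" using that B by (auto simp: C_def)
    show "c \<notin> F" using notin[OF that] Fsub[OF that] by auto
  qed
  have "\<forall>c\<in>C. \<exists>m\<in>W. (\<forall>v\<in>E. m \<star> v \<in> adjoin c F) \<and> \<not> (\<forall>v\<in>E. m \<star> v \<in> F)"
    using C unfolding good_def by blast
  then obtain m where m: "\<And>c. c \<in> C \<Longrightarrow> m c \<in> W" "\<And>c v. c \<in> C \<Longrightarrow> v \<in> E \<Longrightarrow> m c \<star> v \<in> adjoin c F"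
    "\<And>c. c \<in> C \<Longrightarrow> \<not> (\<forall>v\<in>E. m c \<star> v \<in> F)" by metis
  have "\<forall>c e. \<exists>k. c \<in> C \<longrightarrow> e \<in> C \<longrightarrow> m c \<star> e - k *s c \<in> F"
    by (meson adjoinE[OF tsD(5)] m(2) C(1))
  then obtain k where k: "\<And>c e. c \<in> C \<Longrightarrow> e \<in> C \<Longrightarrow> m c \<star> e - k c e *s c \<in> F" by metis
  have "\<forall>c\<in>C. \<exists>e\<in>C. k c e \<noteq> 0"
  proof (rule ccontr)
    assume "\<not> ?thesis"
    then obtain c where c: "c \<in> C" "\<And>e. e \<in> C \<Longrightarrow> k c e = 0" by auto
    have "m c \<star> e \<in> F" if "e \<in> C" for e using k[OF c(1) that] c(2)[OF that] by simp
    moreover have "m c \<star> e \<in> F" if "e \<in> Bf" for e using that Bf tsD(8)[OF m(1)[OF c(1)]] by auto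
    ultimately have "B \<subseteq> {v. m c \<star> v \<in> F}" using BC by auto
    then have "E \<subseteq> {v. m c \<star> v \<in> F}" unfolding spB[symmetric]
      by (rule V.span_minimal[OF _ subspace_act_vimage[OF tsD(5)]])
    then show False using m(3)[OF c(1)] by auto
  qed
  then obtain S where S: "S \<subseteq> C" "S \<noteq> {}" "\<forall>c\<in>S. \<exists>!e. e \<in> S \<and> k c e \<noteq> 0"
    using unique_successor_subset[OF finC C_ne, of "\<lambda>c e. k c e \<noteq> 0"] by blast
  then obtain g where g: "\<And>c. c \<in> S \<Longrightarrow> g c \<in> S" "\<And>c. c \<in> S \<Longrightarrow> k c (g c) \<noteq> 0"
    "\<And>c e. c \<in> S \<Longrightarrow> e \<in> S \<Longrightarrow> k c e \<noteq> 0 \<Longrightarrow> e = g c" by metis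
  have finS: "finite S" using S finC finite_subset by blast
  \<comment> \<open>Modulo F, \<open>m c\<close> sends the sum v of S to
    \<open>k c (g c) *s c\<close>, because only one entry of row c of k is nonzero on S. Dividing by
    this entry and summing over c gives v back.\<close>
  define M where "M = (\<Sum>c\<in>S. (1 / k c (g c)) *w m c)"
  define v where "v = \<Sum>S"
  have MW: "M \<in> W" unfolding M_def using S m(1) tsD(1)
    by (intro Op.subspace_sum Op.subspace_scale) auto
  have vE: "v \<in> E" unfolding v_def using S C(1) tsD(3) by (intro V.subspace_sum) auto
  have Mv: "M \<star> v = (\<Sum>c\<in>S. \<Sum>e\<in>S. (1 / k c (g c)) *s (m c \<star> e))"
    unfolding M_def v_def by (simp add: act_sum_left act_sum_right act_scale_left V.scale_sum_right) (rule sum.swap)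
  have "(\<Sum>e\<in>S. (k c e / k c (g c)) *s c) = c" if c: "c \<in> S" for c
  proof -
    have "(\<Sum>e\<in>S. (k c e / k c (g c)) *s c) = (\<Sum>e\<in>S. if e = g c then c else 0)"
    proof (intro sum.cong refl)
      fix e assume "e \<in> S"
      then have "e = g c \<or> k c e = 0" using g(3)[OF c] by blast
      then show "(k c e / k c (g c)) *s c = (if e = g c then c else 0)" using g(2)[OF c] by auto
    qed
    then show ?thesis using finS g(1)[OF c] by simp
  qed
  then have "v = (\<Sum>c\<in>S. \<Sum>e\<in>S. (k c e / k c (g c)) *s c)" unfolding v_def by simp
  then have "v - M \<star> v = (\<Sum>c\<in>S. \<Sum>e\<in>S. (- 1 / k c (g c)) *s (m c \<star> e - k c e *s c))"
    unfolding Mv by (simp add: sum_subtractf[symmetric] V.scale_right_diff_distrib)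
  also have "\<dots> \<in> F"
    by (intro V.subspace_sum V.subspace_scale tsD(5) k) (use S(1) in auto)
  finally have "v \<in> F" using tsD(9) MW vE by blast
  obtain e where e: "e \<in> S" using S by auto
  have "v \<in> V.span (B - {e})" using \<open>v \<in> F\<close> Fsub e S by auto
  moreover have "\<Sum>(S - {e}) \<in> V.span (B - {e})" using S BC by (intro V.span_sum V.span_base) auto
  moreover have "e = v - \<Sum>(S - {e})" unfolding v_def using finS e by (simp add: sum_diff1)
  ultimately have "e \<in> V.span (B - {e})" using V.span_diff by metis
  then show False using notin e S by auto
qed

text \<open>The bad vectors and F span a proper subspace. Outside it all vectors of E are good, and
  a vector y inside it is the difference of \<open>y + y0\<close> and \<open>y0\<close>, both
  outside. Additive properties can thus be checked on good vectors.\<close>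

lemma good_induct:
  assumes "trivial_spectrum W E F" "E \<noteq> F" "y \<in> E"
    and P: "\<And>y. good W E F y \<Longrightarrow> P y" "\<And>a b. P a \<Longrightarrow> P b \<Longrightarrow> P (a - b)"
  shows "P y"
proof -
  note tsD = trivial_spectrumD[OF assms(1)]
  let ?D = "V.span ({x \<in> E. \<not> good W E F x} \<union> F)"
  have "?D \<subseteq> E" using tsD by (intro V.span_minimal) auto
  then obtain y0 where y0: "y0 \<in> E" "y0 \<notin> ?D" using span_bad_neq[OF assms(1,2)] by auto
  have g: "good W E F z" if "z \<in> E" "z \<notin> ?D" for z
  proof (rule ccontr)
    assume "\<not> good W E F z"
    then have "z \<in> ?D" using that(1) by (intro V.span_base) auto
    then show False using that(2) by contradiction
  qed
  show ?thesis
  proof (cases "y \<in> ?D")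
    case True
    then have "y + y0 \<notin> ?D" using y0 V.span_add_eq by blast
    then have "good W E F (y + y0)" using g y0 assms(3) tsD(3) V.subspace_add by blast
    then have "P (y + y0 - y0)" using P g y0 by blast
    then show ?thesis by simp
  qed (use g P assms(3) in blast)
qed

lemma exists_good:
  assumes "trivial_spectrum W E F" "E \<noteq> F"
  obtains x where "good W E F x"
proof -
  have "\<exists>x. good W E F x"
  proof (rule ccontr)
    assume no: "\<nexists>x. good W E F x"
    have "0 \<in> E" using trivial_spectrumD(3)[OF assms(1)] V.subspace_0 by blast
    then show False using good_induct[OF assms, of 0 "\<lambda>_. False"] no by blast
  qed
  then show ?thesis using that by blast
qed

section \<open>Orbits, stabilizers and the dimension bound\<close>

lemma mem_orbit_iff:
  assumes "Op.subspace W" "V.subspace F"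
  shows "z \<in> V.span ((\<lambda>m. m \<star> x) ` W \<union> F) \<longleftrightarrow> (\<exists>m\<in>W. z - m \<star> x \<in> F)"
proof -
  have "V.subspace ((\<lambda>m. m \<star> x) ` W)"
    using OV.linear_subspace_image[OF linear_act_left assms(1)] .
  then have "z \<in> V.span ((\<lambda>m. m \<star> x) ` W \<union> F) \<longleftrightarrow> (\<exists>m\<in>W. \<exists>f\<in>F. z = m \<star> x + f)"
    using assms(2) unfolding V.span_Un by (auto simp: iffD2[OF V.span_eq_iff])
  also have "\<dots> \<longleftrightarrow> (\<exists>m\<in>W. z - m \<star> x \<in> F)" by (metis add_diff_cancel_left' diff_add_cancel add.commute)
  finally show ?thesis .
qed

lemma dim_stabilizer:
  assumes "Op.subspace W" "Op.fin_dim W" "V.subspace F" "V.fin_dim F"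
  shows "Op.dim W + V.dim F = Op.dim (stabilizer W x F) + V.dim (V.span ((\<lambda>m. m \<star> x) ` W \<union> F))"
  using OV.dim_preimage_image(1)[OF linear_act_left assms, of x] unfolding stabilizer_def .

text \<open>If v - m v is k x modulo F, then subtracting k x from v yields a vector fixed modulo F,
  since m x lies in F.\<close>

lemma trivial_spectrum_stabilizer:
  assumes ts: "trivial_spectrum W E F" and x: "x \<in> E"
  shows "trivial_spectrum (stabilizer W x F) E (adjoin x F)"
proof -
  note tsD = trivial_spectrumD[OF ts]
  have sub: "stabilizer W x F \<subseteq> W" by (auto simp: stabilizer_def)
  have 1: "m \<star> v \<in> adjoin x F" if "m \<in> stabilizer W x F" and v: "v \<in> adjoin x F" for m v
  proof -
    obtain k where k: "v - k *s x \<in> F" by (rule adjoinE[OF tsD(5) v])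
    then have "m \<star> (v - k *s x) \<in> F" using that tsD(8) by (auto simp: stabilizer_def)
    moreover have "k *s (m \<star> x) \<in> F" using that tsD(5) V.subspace_scale by (auto simp: stabilizer_def)
    ultimately have "m \<star> (v - k *s x) + k *s (m \<star> x) \<in> F" using tsD(5) V.subspace_add by blast
    then show ?thesis by (simp add: act_simps V.span_base)
  qed
  have 2: "v \<in> adjoin x F" if "m \<in> stabilizer W x F" "v \<in> E" and v: "v - m \<star> v \<in> adjoin x F" for m v
  proof -
    obtain k where k: "v - m \<star> v - k *s x \<in> F" by (rule adjoinE[OF tsD(5) v])
    have mx: "m \<star> x \<in> F" "m \<in> W" using that by (auto simp: stabilizer_def)
    have "(v - k *s x) - m \<star> (v - k *s x) = (v - m \<star> v - k *s x) + k *s (m \<star> x)"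
      by (simp add: act_simps algebra_simps)
    also have "\<dots> \<in> F" using k mx tsD(5) V.subspace_add V.subspace_scale by blast
    finally have "v - k *s x \<in> F"
      by (rule tsD(9)[OF mx(2) V.subspace_diff[OF tsD(3) that(2) V.subspace_scale[OF tsD(3) x]]])
    then show ?thesis by (rule adjoinI[OF tsD(5)])
  qed
  show ?thesis
    unfolding trivial_spectrum_def
    using tsD subspace_stabilizer[OF tsD(1,5)] Op.fin_dim_subset[OF tsD(2) sub] sub 1 2
      adjoin_minimal[OF tsD(3,6) x] by blast
qed

lemma annihilator_stabilizer_good:
  assumes ts: "trivial_spectrum W E F" and x: "good W E F x"
  shows "annihilator (stabilizer W x F) E (adjoin x F) = annihilator W E F"
  using x in_adjoin unfolding annihilator_def stabilizer_def good_def by auto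

text \<open>A vector in its own orbit modulo F would be fixed modulo F by some element of W.\<close>

lemma dim_orbit_less:
  assumes ts: "trivial_spectrum W E F" and x: "x \<in> E" "x \<notin> F"
  shows "V.dim (V.span ((\<lambda>m. m \<star> x) ` W \<union> F)) < V.dim E"
    and "V.span ((\<lambda>m. m \<star> x) ` W \<union> F) \<subseteq> E"
    and "x \<notin> V.span ((\<lambda>m. m \<star> x) ` W \<union> F)"
proof -
  note tsD = trivial_spectrumD[OF ts]
  let ?S = "V.span ((\<lambda>m. m \<star> x) ` W \<union> F)"
  show xS: "x \<notin> ?S" unfolding mem_orbit_iff[OF tsD(1,5)] using tsD(9) x by blast
  show SE: "?S \<subseteq> E" using tsD x by (intro V.span_minimal) auto
  show "V.dim ?S < V.dim E"
    using V.subspace_eq_if_dim_le[OF V.subspace_span tsD(3) SE tsD(4)] xS x not_less by blast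
qed

lemma dim_codim_adjoin:
  assumes ts: "trivial_spectrum W E F" and x: "x \<in> E" "x \<notin> F"
  shows "V.dim E - V.dim F = Suc (V.dim E - V.dim (adjoin x F))"
proof -
  note tsD = trivial_spectrumD[OF ts]
  have "V.dim (adjoin x F) \<le> V.dim E"
    using adjoin_minimal[OF tsD(3,6) x(1)] V.dim_subset_fin_dim[OF tsD(4)] by blast
  then show ?thesis using dim_adjoin[OF tsD(5,10) x(2)] by linarith
qed

lemma choose_two_Suc: "Suc d choose 2 = d + (d choose 2)"
  by (simp add: numeral_2_eq_2)

text \<open>In codimension d + 1, the orbit of a good vector has dimension at most d modulo F, while
  the stabilizer obeys the bound for d with the same annihilator. The sum d + (d choose 2) is (d +
  1) choose 2.\<close>

theorem dim_trivial_spectrum_le: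
  assumes "trivial_spectrum W E F"
  shows "Op.dim W \<le> Op.dim (annihilator W E F) + ((V.dim E - V.dim F) choose 2)"
  using assms
proof (induction "V.dim E - V.dim F" arbitrary: W F)
  case 0
  note tsD = trivial_spectrumD[OF "0.prems"]
  have "F = E" using V.subspace_eq_if_dim_le[OF tsD(5,3,6,4)] 0 by simp
  then have "annihilator W E F = W" using tsD(7) unfolding annihilator_def by auto
  then show ?case by simp
next
  case (Suc d)
  note tsD = trivial_spectrumD[OF Suc.prems]
  have "E \<noteq> F" using Suc.hyps(2) by auto
  then obtain x where x: "good W E F x" using exists_good Suc.prems by blast
  then have xE: "x \<in> E" "x \<notin> F" by (auto simp: good_def)
  have d: "d = V.dim E - V.dim (adjoin x F)"
    using dim_codim_adjoin[OF Suc.prems xE] Suc.hyps(2) by linarith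
  have "Op.dim (stabilizer W x F) \<le> Op.dim (annihilator W E F) + (d choose 2)"
    using Suc.hyps(1)[OF d trivial_spectrum_stabilizer[OF Suc.prems xE(1)]]
    unfolding annihilator_stabilizer_good[OF Suc.prems x] d .
  moreover have "(V.dim E - V.dim F) choose 2 = d + (d choose 2)"
    unfolding Suc.hyps(2)[symmetric] by (rule choose_two_Suc)
  ultimately show ?case
    using dim_stabilizer[OF tsD(1,2,5,10), of x] dim_orbit_less(1)[OF Suc.prems xE] Suc.hyps(2)
    by linarith
qed

end

section \<open>Spaces of maximal dimension and invariant subspaces\<close>

context bilinear_action begin

definition max_trivial_spectrum :: "'w set \<Rightarrow> 'v set \<Rightarrow> 'v set \<Rightarrow> bool" where
  "max_trivial_spectrum W E F \<longleftrightarrow> trivial_spectrum W E F \<and>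
    Op.dim W = Op.dim (annihilator W E F) + ((V.dim E - V.dim F) choose 2)"

text \<open>Equality in the bound forces equality in both of its summands: the stabilizer is
  maximal, and the orbit of x is a hyperplane of E that misses x. The functional h is the equation
  of this hyperplane, normalized at x.\<close>

lemma max_good:
  assumes max: "max_trivial_spectrum W E F" and good: "good W E F x"
  shows "max_trivial_spectrum (stabilizer W x F) E (adjoin x F)"
    and "\<exists>h. functional h \<and> (\<forall>z\<in>F. h z = 0) \<and> h x = 1 \<and> (\<forall>m\<in>W. h (m \<star> x) = 0) \<and>
      (\<forall>z\<in>E. h z = 0 \<longrightarrow> (\<exists>m\<in>W. z - m \<star> x \<in> F))"
proof -
  have ts: "trivial_spectrum W E F" using max by (simp add: max_trivial_spectrum_def)
  note tsD = trivial_spectrumD[OF ts]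
  have x: "x \<in> E" "x \<notin> F" using good by (auto simp: good_def)
  let ?S = "V.span ((\<lambda>m. m \<star> x) ` W \<union> F)" and ?W = "stabilizer W x F" and ?F = "adjoin x F"
  define d where "d = V.dim E - V.dim ?F"
  have Sd: "V.dim E - V.dim F = Suc d" using dim_codim_adjoin[OF ts x] d_def by simp
  have tsx: "trivial_spectrum ?W E ?F" by (rule trivial_spectrum_stabilizer[OF ts x(1)])
  have 1: "Op.dim ?W \<le> Op.dim (annihilator W E F) + (d choose 2)"
    using dim_trivial_spectrum_le[OF tsx] unfolding annihilator_stabilizer_good[OF ts good] d_def .
  have 2: "Op.dim W = Op.dim (annihilator W E F) + (d + (d choose 2))"
    using max unfolding max_trivial_spectrum_def Sd choose_two_Suc by simp
  note 3 = dim_stabilizer[OF tsD(1,2,5,10), of x] dim_orbit_less(1)[OF ts x]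
  have "Op.dim ?W = Op.dim (annihilator W E F) + (d choose 2)" using 1 2 3 Sd by linarith
  then show "max_trivial_spectrum ?W E ?F"
    unfolding max_trivial_spectrum_def annihilator_stabilizer_good[OF ts good] d_def using tsx by simp
  have S: "V.dim E \<le> V.dim ?S + 1" using 1 2 3 Sd by linarith
  note orb = dim_orbit_less[OF ts x]
  obtain h where h: "functional h" "\<And>z. z \<in> ?S \<Longrightarrow> h z = 0" "h x = 1"
    using V.separating_functional[OF V.subspace_span orb(3)] by blast
  have fdS: "V.fin_dim ?S" by (rule V.fin_dim_subset[OF tsD(4) orb(2)])
  have "adjoin x ?S = E"
  proof (rule V.subspace_eq_if_dim_le[OF V.subspace_span tsD(3) _ tsD(4)])
    show "adjoin x ?S \<subseteq> E" by (rule adjoin_minimal[OF tsD(3) orb(2) x(1)])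
    show "V.dim E \<le> V.dim (adjoin x ?S)"
      unfolding dim_adjoin[OF V.subspace_span fdS orb(3)] by (rule S)
  qed
  then have dec: "z \<in> adjoin x ?S" if "z \<in> E" for z using that by simp
  have "\<exists>m\<in>W. z - m \<star> x \<in> F" if z: "z \<in> E" "h z = 0" for z
  proof -
    obtain k where k: "z - k *s x \<in> ?S" by (rule adjoinE[OF V.subspace_span dec[OF z(1)]])
    from h(2)[OF k] have "k = 0" using z(2) h(3) by (simp add: functional_simps[OF h(1)])
    then show ?thesis using k unfolding mem_orbit_iff[OF tsD(1,5)] by simp
  qed
  moreover have "h z = 0" if "z \<in> F" for z using that by (intro h(2) V.span_base) auto
  moreover have "h (m \<star> x) = 0" if "m \<in> W" for m using that by (intro h(2) V.span_base) auto
  ultimately show "\<exists>h. functional h \<and> (\<forall>z\<in>F. h z = 0) \<and> h x = 1 \<and> (\<forall>m\<in>W. h (m \<star> x) = 0) \<and>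
      (\<forall>z\<in>E. h z = 0 \<longrightarrow> (\<exists>m\<in>W. z - m \<star> x \<in> F))" using h by blast
qed

section \<open>The operators id - m on quotients, and invariant subspaces\<close>

lemma linear_id_minus_act: "Vector_Spaces.linear sv sv (\<lambda>v. v - m \<star> v)"
  by (simp add: Vector_Spaces.linear_iff act_simps V.vector_space_axioms algebra_simps V.scale_right_diff_distrib)

lemma id_minus_act_image:
  assumes ts: "trivial_spectrum W E F" and m: "m \<in> W" and G: "V.subspace G" "F \<subseteq> G" "G \<subseteq> E"
  shows "V.dim (V.span ((\<lambda>v. v - m \<star> v) ` G \<union> F)) = V.dim G"
proof -
  note tsD = trivial_spectrumD[OF ts]
  have "{v \<in> G. v - m \<star> v \<in> F} = F"
    using tsD(8)[OF m] tsD(9)[OF m] G V.subspace_diff[OF tsD(5)] by auto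
  then show ?thesis
    using VV.dim_preimage_image(1)[OF linear_id_minus_act G(1) V.fin_dim_subset[OF tsD(4) G(3)] tsD(5,10), of m]
    by (simp del: V.dim_span)
qed

lemma mem_span_id_minus_act_iff:
  assumes "V.subspace G" "V.subspace F"
  shows "z \<in> V.span ((\<lambda>v. v - m \<star> v) ` G \<union> F) \<longleftrightarrow> (\<exists>v\<in>G. z - (v - m \<star> v) \<in> F)"
proof -
  have "V.subspace ((\<lambda>v. v - m \<star> v) ` G)"
    using VV.linear_subspace_image[OF linear_id_minus_act assms(1)] .
  then have "z \<in> V.span ((\<lambda>v. v - m \<star> v) ` G \<union> F) \<longleftrightarrow> (\<exists>v\<in>G. \<exists>f\<in>F. z = (v - m \<star> v) + f)"
    using assms(2) unfolding V.span_Un by (auto simp: iffD2[OF V.span_eq_iff])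
  also have "\<dots> \<longleftrightarrow> (\<exists>v\<in>G. z - (v - m \<star> v) \<in> F)" by (metis add_diff_cancel_left' diff_add_cancel add.commute)
  finally show ?thesis .
qed

lemma id_minus_act_surj:
  assumes ts: "trivial_spectrum W E F" and m: "m \<in> W" and z: "z \<in> E"
  obtains v where "v \<in> E" "z - (v - m \<star> v) \<in> F"
proof -
  note tsD = trivial_spectrumD[OF ts]
  let ?S = "V.span ((\<lambda>v. v - m \<star> v) ` E \<union> F)"
  have "?S \<subseteq> E" using tsD(6) tsD(7)[OF m] V.subspace_diff[OF tsD(3)] tsD(3) by (intro V.span_minimal) auto
  then have "?S = E"
    using id_minus_act_image[OF ts m tsD(3,6)] by (intro V.subspace_eq_if_dim_le tsD(3,4) V.subspace_span) auto
  then have "z \<in> ?S" using z by simp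
  then show ?thesis using that unfolding mem_span_id_minus_act_iff[OF tsD(3,5)] by blast
qed

definition invariant :: "'w set \<Rightarrow> 'v set \<Rightarrow> 'v set \<Rightarrow> 'v set \<Rightarrow> bool" where
  "invariant W E F G \<longleftrightarrow> V.subspace G \<and> F \<subseteq> G \<and> G \<subseteq> E \<and> (\<forall>m\<in>W. \<forall>v\<in>G. m \<star> v \<in> G)"

text \<open>Only the quotient of E by G needs an argument. As id - m is onto on G modulo F, an
  element v - m v of G equals u - m u modulo F with u in G; then v - u lies in F, and v in
  G.\<close>

lemma trivial_spectrum_invariant:
  assumes ts: "trivial_spectrum W E F" and G: "invariant W E F G"
  shows "trivial_spectrum W G F" "trivial_spectrum W E G"
proof -
  note tsD = trivial_spectrumD[OF ts]
  note G' = G[unfolded invariant_def]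
  have "V.fin_dim G" using V.fin_dim_subset[OF tsD(4)] G' by blast
  then show WG: "trivial_spectrum W G F" unfolding trivial_spectrum_def using tsD G' by blast
  have "v \<in> G" if m: "m \<in> W" and v: "v \<in> E" and vG: "v - m \<star> v \<in> G" for m v
  proof -
    obtain u where u: "u \<in> G" "(v - m \<star> v) - (u - m \<star> u) \<in> F"
      by (rule id_minus_act_surj[OF WG m vG])
    have eq: "(v - u) - m \<star> (v - u) = (v - m \<star> v) - (u - m \<star> u)" by (simp add: act_simps)
    have "(v - u) - m \<star> (v - u) \<in> F" unfolding eq by (rule u(2))
    moreover have "v - u \<in> E" using v u G' V.subspace_diff[OF tsD(3)] by blast
    ultimately have "v - u \<in> G" using tsD(9)[OF m] G' by blast
    then have "(v - u) + u \<in> G" using u V.subspace_add G' by blast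
    then show ?thesis by simp
  qed
  then show "trivial_spectrum W E G" unfolding trivial_spectrum_def using tsD G' by blast
qed

lemma trivial_spectrum_mono:
  "trivial_spectrum W E F \<Longrightarrow> Op.subspace N \<Longrightarrow> N \<subseteq> W \<Longrightarrow> trivial_spectrum N E F"
  unfolding trivial_spectrum_def using Op.fin_dim_subset by blast

text \<open>Up to \<open>annihilator N E F\<close>, the space N embeds into the linear maps from E /
  G to H / F. The induction enlarges G by one vector at a time, at a cost of at most the dimension
  of H / F.\<close>

lemma dim_hom_le:
  assumes "Op.subspace N" "Op.fin_dim N" "V.subspace F" "V.fin_dim H" "V.subspace H" "F \<subseteq> H"
    "V.subspace E" "V.fin_dim E" "V.subspace G" "G \<subseteq> E"
    "\<And>m v. m \<in> N \<Longrightarrow> v \<in> E \<Longrightarrow> m \<star> v \<in> H" "\<And>m v. m \<in> N \<Longrightarrow> v \<in> G \<Longrightarrow> m \<star> v \<in> F"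
  shows "Op.dim N \<le> Op.dim (annihilator N E F) + (V.dim H - V.dim F) * (V.dim E - V.dim G)"
  using assms
proof (induction "V.dim E - V.dim G" arbitrary: N G)
  case 0
  then have "G = E" using V.subspace_eq_if_dim_le[of G E] by simp
  then have "annihilator N E F = N" unfolding annihilator_def using 0 by auto
  then show ?case by simp
next
  case (Suc d)
  note p = Suc.prems
  have "G \<noteq> E" using Suc.hyps(2) by auto
  then obtain v where v: "v \<in> E" "v \<notin> G" using p(10) by auto
  let ?N = "stabilizer N v F" and ?S = "V.span ((\<lambda>m. m \<star> v) ` N \<union> F)"
  have fG: "V.fin_dim G" and fF: "V.fin_dim F"
    using V.fin_dim_subset p by blast+
  have vG: "adjoin v G \<subseteq> E" by (rule adjoin_minimal[OF p(7,10) v(1)])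
  have d: "d = V.dim E - V.dim (adjoin v G)"
    unfolding dim_adjoin[OF p(9) fG v(2)] using Suc.hyps(2) by linarith
  have sub: "?N \<subseteq> N" by (auto simp: stabilizer_def)
  have "Op.dim ?N \<le> Op.dim (annihilator ?N E F) + (V.dim H - V.dim F) * (V.dim E - V.dim (adjoin v G))"
  proof (rule Suc.hyps(1)[OF d])
    show "Op.subspace ?N" by (rule subspace_stabilizer[OF p(1,3)])
    show "Op.fin_dim ?N" by (rule Op.fin_dim_subset[OF p(2) sub])
    show "m \<star> w \<in> H" if "m \<in> ?N" "w \<in> E" for m w using that sub p(11) by blast
    show "m \<star> w \<in> F" if m: "m \<in> ?N" and w: "w \<in> adjoin v G" for m w
    proof -
      have "insert v G \<subseteq> {w. m \<star> w \<in> F}" using m p(12) by (auto simp: stabilizer_def)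
      then have "adjoin v G \<subseteq> {w. m \<star> w \<in> F}" by (rule V.span_minimal[OF _ subspace_act_vimage[OF p(3)]])
      then show ?thesis using w by auto
    qed
  qed (use p vG in auto)
  moreover have ann: "annihilator ?N E F = annihilator N E F"
    using v unfolding annihilator_def stabilizer_def by auto
  moreover have "Op.dim N + V.dim F = Op.dim ?N + V.dim ?S" by (rule dim_stabilizer[OF p(1,2,3) fF])
  moreover have "V.dim ?S \<le> V.dim H"
    using p(6,11,5) v(1) by (intro V.dim_subset_fin_dim[OF p(4)] V.span_minimal) auto
  moreover have "V.dim F \<le> V.dim H" using V.dim_subset_fin_dim p by blast
  moreover have "(V.dim H - V.dim F) * (V.dim E - V.dim G) = (V.dim H - V.dim F) * d + (V.dim H - V.dim F)"
    unfolding Suc.hyps(2)[symmetric] by simp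
  ultimately show ?case unfolding d[symmetric] ann by linarith
qed

lemma choose_two_add: "(p + q) choose 2 = (p choose 2) + (q choose 2) + p * q"
  by (induction p) (auto simp: choose_two_Suc)

text \<open>The operators of N vanish on G / F and those of N' on E / G as well, so N' consists of
  maps from E / G to G / F. The three bounds \<open>p choose 2\<close>, \<open>q choose 2\<close>
  and \<open>p * q\<close> add up to \<open>(p + q) choose 2\<close>; hence all are attained. In
  particular N' induces every linear map from E / G to G / F, and so takes a vector outside G to any
  prescribed element of G modulo F.\<close>

lemma max_invariant:
  assumes max: "max_trivial_spectrum W E F" and G: "invariant W E F G"
  shows "max_trivial_spectrum W G F" "max_trivial_spectrum W E G"
    and "\<And>v g. v \<in> E \<Longrightarrow> v \<notin> G \<Longrightarrow> g \<in> G \<Longrightarrow> \<exists>m\<in>W. g - m \<star> v \<in> F"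
proof -
  have ts: "trivial_spectrum W E F" using max by (simp add: max_trivial_spectrum_def)
  note tsD = trivial_spectrumD[OF ts]
  note tsG = trivial_spectrum_invariant[OF ts G]
  have G': "V.subspace G" "F \<subseteq> G" "G \<subseteq> E" using G by (auto simp: invariant_def)
  have fG: "V.fin_dim G" using V.fin_dim_subset[OF tsD(4) G'(3)] .
  let ?N = "annihilator W G F" and ?L = "annihilator W E G"
  let ?N' = "annihilator ?N E G"
  define p q where "p = V.dim G - V.dim F" and "q = V.dim E - V.dim G"
  have le: "V.dim F \<le> V.dim G" "V.dim G \<le> V.dim E"
    using V.dim_subset_fin_dim fG tsD(4) G' by blast+
  have pq: "V.dim E - V.dim F = p + q" unfolding p_def q_def using le by linarith
  have N: "Op.subspace ?N" "?N \<subseteq> W" and L: "Op.subspace ?L" "?L \<subseteq> W"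
    and N': "Op.subspace ?N'" "?N' \<subseteq> W"
    using subspace_annihilator[OF tsD(1,5)] subspace_annihilator[OF tsD(1) G'(1)]
      subspace_annihilator[OF subspace_annihilator[OF tsD(1,5)] G'(1)] unfolding annihilator_def by blast+
  have fN': "Op.fin_dim ?N'" using Op.fin_dim_subset[OF tsD(2) N'(2)] .
  have 1: "Op.dim W \<le> Op.dim ?N + (p choose 2)" unfolding p_def by (rule dim_trivial_spectrum_le[OF tsG(1)])
  have 2: "Op.dim ?N \<le> Op.dim ?N' + (q choose 2)"
    unfolding q_def by (rule dim_trivial_spectrum_le[OF trivial_spectrum_mono[OF tsG(2) N]])
  have annN': "annihilator ?N' E F = annihilator W E F" using G' unfolding annihilator_def by blast
  have hyps: "m \<star> v \<in> G" if "m \<in> ?N'" "v \<in> E" for m v using that by (auto simp: annihilator_def)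
  have hyps2: "m \<star> v \<in> F" if "m \<in> ?N'" "v \<in> G" for m v using that by (auto simp: annihilator_def)
  have 3: "Op.dim ?N' \<le> Op.dim (annihilator W E F) + p * q"
    using dim_hom_le[OF N'(1) fN' tsD(5) fG G'(1,2) tsD(3,4) G'(1,3) hyps hyps2]
    unfolding annN' p_def q_def .
  have 4: "Op.dim W = Op.dim (annihilator W E F) + ((p choose 2) + (q choose 2) + p * q)"
    using max unfolding max_trivial_spectrum_def pq choose_two_add by simp
  have "Op.dim W = Op.dim ?N + (p choose 2)" using 1 2 3 4 by linarith
  then show "max_trivial_spectrum W G F" unfolding max_trivial_spectrum_def p_def using tsG by simp
  \<comment> \<open>Starting the same count with E / G instead of G / F gives equality for the
    quotient.\<close>
  have "annihilator ?L G F = ?N'" using G' unfolding annihilator_def by blast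
  then have "Op.dim ?L \<le> Op.dim ?N' + (p choose 2)"
    using dim_trivial_spectrum_le[OF trivial_spectrum_mono[OF tsG(1) L]] unfolding p_def by simp
  moreover have "Op.dim W \<le> Op.dim ?L + (q choose 2)" unfolding q_def by (rule dim_trivial_spectrum_le[OF tsG(2)])
  ultimately have "Op.dim W = Op.dim ?L + (q choose 2)" using 3 4 by linarith
  then show "max_trivial_spectrum W E G" unfolding max_trivial_spectrum_def q_def using tsG by simp
  have 5: "Op.dim (annihilator W E F) + p * q \<le> Op.dim ?N'" using 1 2 4 by linarith
  fix v g assume v: "v \<in> E" "v \<notin> G" and g: "g \<in> G"
  \<comment> \<open>Elements of N' that kill v modulo F factor through E / (G + v), so modulo the
    annihilator they have dimension at most p * (q - 1). The missing p dimensions must come from the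
    images of v, which therefore fill G / F.\<close>
  let ?K = "stabilizer ?N' v F" and ?S = "V.span ((\<lambda>m. m \<star> v) ` ?N' \<union> F)"
  have K: "Op.subspace ?K" "?K \<subseteq> ?N'" using subspace_stabilizer[OF N'(1) tsD(5)] by (auto simp: stabilizer_def)
  have vG: "adjoin v G \<subseteq> E" by (rule adjoin_minimal[OF tsD(3) G'(3) v(1)])
  have Kh: "m \<star> w \<in> G" if "m \<in> ?K" "w \<in> E" for m w using that hyps K(2) by blast
  have Kh2: "m \<star> w \<in> F" if m: "m \<in> ?K" and w: "w \<in> adjoin v G" for m w
  proof -
    have "insert v G \<subseteq> {w. m \<star> w \<in> F}" using m hyps2 by (auto simp: stabilizer_def)
    then have "adjoin v G \<subseteq> {w. m \<star> w \<in> F}" by (rule V.span_minimal[OF _ subspace_act_vimage[OF tsD(5)]])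
    then show ?thesis using w by auto
  qed
  have "annihilator ?K E F = annihilator W E F"
    unfolding annN'[symmetric] using v(1) by (auto simp: annihilator_def stabilizer_def)
  then have "Op.dim ?K \<le> Op.dim (annihilator W E F) + p * (V.dim E - (V.dim G + 1))"
    using dim_hom_le[OF K(1) Op.fin_dim_subset[OF fN' K(2)] tsD(5) fG G'(1,2) tsD(3,4) V.subspace_span vG Kh Kh2]
    unfolding p_def dim_adjoin[OF G'(1) fG v(2)] by simp
  moreover have "V.dim (adjoin v G) \<le> V.dim E" using V.dim_subset_fin_dim[OF tsD(4) vG] .
  then obtain r where r: "q = Suc r" unfolding q_def dim_adjoin[OF G'(1) fG v(2)]
    by (metis Suc_diff_le diff_Suc_Suc Suc_eq_plus1)
  then have "V.dim E - (V.dim G + 1) = r" unfolding q_def by linarith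
  moreover have "p * q = p * r + p" unfolding r by simp
  moreover have "Op.dim ?N' + V.dim F = Op.dim ?K + V.dim ?S" by (rule dim_stabilizer[OF N'(1) fN' tsD(5,10)])
  ultimately have "V.dim G \<le> V.dim ?S" using 5 p_def le by simp
  moreover have "?S \<subseteq> G" using hyps v(1) G' by (intro V.span_minimal) auto
  ultimately have "?S = G" by (intro V.subspace_eq_if_dim_le V.subspace_span G' fG)
  then have "g \<in> ?S" using g by simp
  then show "\<exists>m\<in>W. g - m \<star> v \<in> F" unfolding mem_orbit_iff[OF N'(1) tsD(5)] using N'(2) by blast
qed

end

section \<open>Good vectors and their polar forms\<close>

lemma cramer_2x2:
  fixes a b c d u v :: "'a::field"
  assumes D: "a * d - b * c \<noteq> 0"
  obtains s r where "s * a + r * b = u" "s * c + r * d = v"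
proof
  let ?D = "a * d - b * c"
  have "(u * d - v * b) * a + (v * a - u * c) * b = u * ?D" by (simp add: algebra_simps)
  then show "((u * d - v * b) / ?D) * a + ((v * a - u * c) / ?D) * b = u"
    using D by (simp add: add_divide_distrib[symmetric])
  have "(u * d - v * b) * c + (v * a - u * c) * d = v * ?D" by (simp add: algebra_simps)
  then show "((u * d - v * b) / ?D) * c + ((v * a - u * c) / ?D) * d = v"
    using D by (simp add: add_divide_distrib[symmetric])
qed

locale bilinear_action_3 = bilinear_action sw sv act
  for sw :: "'a::field \<Rightarrow> 'w::ab_group_add \<Rightarrow> 'w" (infixr "*w" 75)
    and sv :: "'a \<Rightarrow> 'v::ab_group_add \<Rightarrow> 'v" (infixr "*s" 75)
    and act :: "'w \<Rightarrow> 'v \<Rightarrow> 'v" (infixr "\<star>" 74) +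
  fixes \<tau> :: 'a
  assumes tau: "\<tau> \<noteq> 0" "\<tau> \<noteq> 1"
begin

text \<open>\<open>h\<close> is the equation in E of the hyperplane formed by the orbit of x and F.
  In the compatible forms constructed later, \<open>b x\<close> agrees with this \<open>h\<close> on
  E.\<close>

definition polar :: "'w set \<Rightarrow> 'v set \<Rightarrow> 'v set \<Rightarrow> 'v \<Rightarrow> ('v \<Rightarrow> 'a) \<Rightarrow> bool" where
  "polar W E F x h \<longleftrightarrow> functional h \<and> (\<forall>z\<in>F. h z = 0) \<and> h x = 1 \<and> (\<forall>m\<in>W. h (m \<star> x) = 0) \<and>
      (\<forall>z\<in>E. h z = 0 \<longrightarrow> (\<exists>m\<in>W. z - m \<star> x \<in> F))"

lemma polarD:
  assumes "polar W E F x h"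
  shows "functional h" "\<And>z. z \<in> F \<Longrightarrow> h z = 0" "h x = 1" "\<And>m. m \<in> W \<Longrightarrow> h (m \<star> x) = 0"
    "\<And>z. z \<in> E \<Longrightarrow> h z = 0 \<Longrightarrow> \<exists>m\<in>W. z - m \<star> x \<in> F"
  using assms unfolding polar_def by blast+

lemma exists_polar:
  "max_trivial_spectrum W E F \<Longrightarrow> good W E F x \<Longrightarrow> \<exists>h. polar W E F x h"
  unfolding polar_def by (rule max_good(2))

text \<open>A polynomial of degree at most one is recovered at \<tau> by interpolation from 0 and 1.
  For a monic quadratic polynomial the error of this interpolation is
  \<open>\<tau> * (\<tau> - 1)\<close>, which is not zero, so the three values cannot all
  vanish.\<close>

lemma monic_quadratic_nonroot: "\<exists>c::'a. (p + c) * (q + c) - r \<noteq> 0"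
proof (rule ccontr)
  assume "\<not> ?thesis"
  then have e: "(p + c) * (q + c) - r = 0" for c by auto
  have "\<tau> * (\<tau> - 1) = ((p + \<tau>) * (q + \<tau>) - r) - (1 - \<tau>) * ((p + 0) * (q + 0) - r)
      - \<tau> * ((p + 1) * (q + 1) - r)" by (simp add: algebra_simps)
  then have "\<tau> * (\<tau> - 1) = 0" unfolding e by simp
  then show False using tau by simp
qed

text \<open>Suppose that \<open>m0 \<star> y\<close> lies off the hyperplane h = 0. Two coordinates
  b and l vanish on it, so x and y can be moved into the hyperplane, which is the orbit of x modulo
  F, without changing their coordinates. The two operators of W obtained in this way leave enough
  freedom to fix some y + c x up to the orbit of y under the stabilizer, and an element of the
  stabilizer corrects the rest.\<close>

lemma good_stabilizer_polar_zero:
  assumes max: "max_trivial_spectrum W E F" and good: "good W E F x" and h: "polar W E F x h"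
    and y: "good (stabilizer W x F) E (adjoin x F) y" and m0: "m0 \<in> stabilizer W x F"
  shows "h (m0 \<star> y) = 0"
proof (rule ccontr)
  assume eta: "h (m0 \<star> y) \<noteq> 0"
  have ts: "trivial_spectrum W E F" using max by (simp add: max_trivial_spectrum_def)
  note tsD = trivial_spectrumD[OF ts]
  let ?Wx = "stabilizer W x F" and ?F = "adjoin x F"
  note hD = polarD[OF h] and hs = functional_simps[OF polarD(1)[OF h]]
  have xE: "x \<in> E" using good by (simp add: good_def)
  have yE: "y \<in> E" using y by (simp add: good_def)
  have m0W: "m0 \<in> W" using m0 by (simp add: stabilizer_def)
  have WxW: "m \<in> W" "m \<star> x \<in> F" if "m \<in> ?Wx" for m using that by (auto simp: stabilizer_def)
  have sWx: "Op.subspace ?Wx" by (rule subspace_stabilizer[OF tsD(1,5)])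
  note mE = tsD(7)
  note Ecl = V.subspace_add[OF tsD(3)] V.subspace_diff[OF tsD(3)] V.subspace_scale[OF tsD(3)]
  note Fcl = V.subspace_add[OF tsD(5)] V.subspace_diff[OF tsD(5)] V.subspace_scale[OF tsD(5)]
  obtain b where b: "polar ?Wx E ?F y b" using exists_polar[OF max_good(1)[OF max good] y] by blast
  note bD = polarD[OF b] and bs = functional_simps[OF polarD(1)[OF b]]
  have bF: "b z = 0" if "z \<in> F" for z using bD(2) in_adjoin(2) that by blast
  have bx: "b x = 0" using bD(2) in_adjoin(1) by blast
  \<comment> \<open>The contradiction aimed at below: b takes the value 1 at every y + c x but
    vanishes on F.\<close>
  have notfix: False if N: "N \<in> W" and f: "(y + c *s x) - N \<star> (y + c *s x) \<in> F" for N c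
  proof -
    have "y + c *s x \<in> F" using tsD(9)[OF N _ f] Ecl yE xE by blast
    then have "b (y + c *s x) = 0" by (rule bF)
    then show False using bD(3) bx by (simp add: bs)
  qed
  have orbit: "\<exists>N\<in>W. b (N \<star> x) = b z \<and> N \<star> x - z \<in> F" if z: "z \<in> E" "h z = 0" for z
  proof -
    obtain N where N: "N \<in> W" "z - N \<star> x \<in> F" using hD(5)[OF z] by blast
    then have "N \<star> x - z \<in> F" using V.subspace_neg[OF tsD(5)] by fastforce
    then show ?thesis using bF[OF N(2)] N(1) by (auto simp: bs)
  qed
  let ?Z = "V.span ((\<lambda>m. m \<star> y) ` ?Wx \<union> F)"
  \<comment> \<open>If x were M y modulo F with M in the stabilizer, a multiple of M could remove
    any error along x. Only the coordinate b of y + c x would have to be matched, and c is chosen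
    for this.\<close>
  have xZ: "x \<notin> ?Z"
  proof
    assume "x \<in> ?Z"
    then obtain M where M: "M \<in> ?Wx" "x - M \<star> y \<in> F"
      unfolding mem_orbit_iff[OF sWx tsD(5)] by blast
    have "y - h y *s x \<in> E" "h (y - h y *s x) = 0" using Ecl yE xE hD(3) by (auto simp: hs)
    from orbit[OF this] obtain N where N: "N \<in> W" "b (N \<star> x) = 1" using bD(3) bx by (auto simp: bs)
    define c where "c = 1 - b (N \<star> y)"
    define u where "u = y + c *s x - N \<star> y - c *s (N \<star> x)"
    have "b u = 0" unfolding u_def c_def using N bD(3) bx by (simp add: bs)
    moreover have "u \<in> E" unfolding u_def using Ecl yE xE mE N(1) by simp
    ultimately obtain m' where m': "m' \<in> ?Wx" "u - m' \<star> y \<in> ?F" using bD(5) by blast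
    then obtain k where k: "u - m' \<star> y - k *s x \<in> F" using adjoinE[OF tsD(5) m'(2)] by blast
    have "(y + c *s x) - (N + m' + k *w M) \<star> (y + c *s x)
        = (u - m' \<star> y - k *s x) + k *s (x - M \<star> y) - c *s (m' \<star> x) - (k * c) *s (M \<star> x)"
      unfolding u_def by (simp add: act_simps algebra_simps V.scale_right_diff_distrib V.scale_right_distrib)
    also have "\<dots> \<in> F" using k M(2) WxW(2)[OF m'(1)] WxW(2)[OF M(1)] Fcl by simp
    finally show False
      using notfix[of "N + m' + k *w M" c] N(1) WxW(1)[OF m'(1)] WxW(1)[OF M(1)] tsD(1)
        Op.subspace_add Op.subspace_scale by simp
  qed
  obtain l0 where l0: "functional l0" "\<And>z. z \<in> ?Z \<Longrightarrow> l0 z = 0" "l0 x = 1"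
    using V.separating_functional[OF V.subspace_span xZ] by blast
  note l0s = functional_simps[OF l0(1)]
  \<comment> \<open>Subtracting a multiple of b makes l vanish at y. The pair (b, l) then has the
    values (1, 0) at y and (0, 1) at x, and its common kernel in E is \<open>?Z\<close>.\<close>
  define l where "l z = l0 z - l0 y * b z" for z
  have ls: "l (u + v) = l u + l v" "l (u - v) = l u - l v" "l (c *s v) = c * l v" for u v c
    unfolding l_def by (simp_all add: l0s bs algebra_simps)
  have lF: "l z = 0" if "z \<in> F" for z
    unfolding l_def using that bF l0(2) V.span_base[of z "(\<lambda>m. m \<star> y) ` ?Wx \<union> F"] by simp
  have lm: "l (m \<star> y) = 0" if "m \<in> ?Wx" for m
    unfolding l_def using that bD(4) l0(2) V.span_base[of "m \<star> y" "(\<lambda>m. m \<star> y) ` ?Wx \<union> F"] by simp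
  have lx: "l x = 1" and ly: "l y = 0" unfolding l_def using l0(3) bx bD(3) by auto
  \<comment> \<open>The coordinates of y + c x are (1, c). If N takes it to a vector with the same
    coordinates, the difference lies in \<open>?Z\<close>, and adding an element of the stabilizer
    to N makes y + c x fixed modulo F.\<close>
  have star: "\<not> (b (N \<star> y) + c * b (N \<star> x) = 1 \<and> l (N \<star> y) + c * l (N \<star> x) = c)" if N: "N \<in> W" for N c
  proof
    assume eq: "b (N \<star> y) + c * b (N \<star> x) = 1 \<and> l (N \<star> y) + c * l (N \<star> x) = c"
    define u where "u = y + c *s x - N \<star> y - c *s (N \<star> x)"
    have "b u = 0" unfolding u_def using eq bD(3) bx by (simp add: bs diff_diff_eq)
    moreover have "u \<in> E" unfolding u_def using Ecl yE xE mE N by simp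
    ultimately obtain m' where m': "m' \<in> ?Wx" "u - m' \<star> y \<in> ?F" using bD(5) by blast
    then obtain k where k: "u - m' \<star> y - k *s x \<in> F" using adjoinE[OF tsD(5) m'(2)] by blast
    have "l u = 0" unfolding u_def using eq lx ly by (simp add: ls diff_diff_eq)
    then have "k = 0" using lF[OF k] lm[OF m'(1)] lx by (simp add: ls)
    have "(y + c *s x) - (N + m') \<star> (y + c *s x) = (u - m' \<star> y - k *s x) - c *s (m' \<star> x)"
      unfolding u_def \<open>k = 0\<close> by (simp add: act_simps algebra_simps V.scale_right_diff_distrib V.scale_right_distrib)
    also have "\<dots> \<in> F" using k WxW(2)[OF m'(1)] Fcl by simp
    finally show False
      using notfix[of "N + m'" c] N WxW(1)[OF m'(1)] Op.subspace_add[OF tsD(1)] by simp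
  qed
  \<comment> \<open>A direction seen by h but not by b and l: subtracting multiples of w from y and
    x puts them into the hyperplane h = 0 and keeps their coordinates.\<close>
  define w where "w = (1 / h (m0 \<star> y)) *s (m0 \<star> y)"
  have w: "w \<in> E" "h w = 1" "b w = 0" "l w = 0"
    unfolding w_def using Ecl mE[OF m0W yE] eta bD(4)[OF m0] lm[OF m0] by (auto simp: hs bs ls)
  have "y - h y *s w \<in> E" "h (y - h y *s w) = 0" using Ecl yE w by (auto simp: hs)
  from orbit[OF this] obtain N1 where N1: "N1 \<in> W" "b (N1 \<star> x) = 1" "N1 \<star> x - (y - h y *s w) \<in> F"
    using bD(3) w by (auto simp: bs)
  have lN1: "l (N1 \<star> x) = 0" using lF[OF N1(3)] ly w by (simp add: ls)
  have "x - w \<in> E" "h (x - w) = 0" using Ecl xE w hD(3) by (auto simp: hs)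
  from orbit[OF this] obtain N2 where N2: "N2 \<in> W" "b (N2 \<star> x) = 0" "N2 \<star> x - (x - w) \<in> F"
    using bx w by (auto simp: bs)
  have lN2: "l (N2 \<star> x) = 1" using lF[OF N2(3)] lx w by (simp add: ls)
  \<comment> \<open>For N = s N1 + r N2 the two equations excluded by \<open>star\<close> are linear
    in s and r, and their determinant is a monic quadratic polynomial in c.\<close>
  obtain c where c: "(b (N1 \<star> y) + c) * (l (N2 \<star> y) + c) - b (N2 \<star> y) * l (N1 \<star> y) \<noteq> 0" (is "?D \<noteq> 0")
    using monic_quadratic_nonroot by blast
  obtain s r where sr: "s * (b (N1 \<star> y) + c) + r * b (N2 \<star> y) = 1"
      "s * l (N1 \<star> y) + r * (l (N2 \<star> y) + c) = c"
    by (rule cramer_2x2[OF c, of 1 c])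
  have N: "s *w N1 + r *w N2 \<in> W" using N1(1) N2(1) tsD(1) Op.subspace_add Op.subspace_scale by simp
  from sr show False
    using star[OF N, of c] N1(2) N2(2) lN1 lN2 by (simp add: act_simps bs ls algebra_simps)
qed

text \<open>The y with this property form a subspace, so good vectors suffice. If x spans E modulo
  F, \<open>good_induct\<close> does not apply, but then m maps E into F.\<close>

lemma stabilizer_polar_zero:
  assumes max: "max_trivial_spectrum W E F" and good: "good W E F x" and h: "polar W E F x h"
    and m: "m \<in> stabilizer W x F" and y: "y \<in> E"
  shows "h (m \<star> y) = 0"
proof (cases "E = adjoin x F")
  case True
  have ts: "trivial_spectrum W E F" using max by (simp add: max_trivial_spectrum_def)
  note tsD = trivial_spectrumD[OF ts]
  obtain k where k: "y - k *s x \<in> F" using adjoinE[OF tsD(5)] y True by blast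
  have m': "m \<in> W" "m \<star> x \<in> F" using m by (auto simp: stabilizer_def)
  have "m \<star> (y - k *s x) + k *s (m \<star> x) \<in> F"
    using tsD(8)[OF m'(1) k] m'(2) V.subspace_add[OF tsD(5)] V.subspace_scale[OF tsD(5)] by blast
  then show ?thesis using polarD(2)[OF h] by (simp add: act_simps)
next
  case False
  have ts: "trivial_spectrum (stabilizer W x F) E (adjoin x F)"
    using max_good(1)[OF max good] by (simp add: max_trivial_spectrum_def)
  show ?thesis
    by (rule good_induct[OF ts False y])
      (auto simp: act_simps functional_simps[OF polarD(1)[OF h]] intro: good_stabilizer_polar_zero[OF max good h _ m])
qed

text \<open>The witness is the intersection G' of G with the hyperplane h = 0. For g in G', the
  image N g lies in G' up to a multiple of x - N x. If N x is outside G', comparison with \<tau> N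
  shows that the multiple is zero. Any other N is a difference of two operators of this
  kind.\<close>

lemma invariant_of_stabilizer_invariant:
  assumes max: "max_trivial_spectrum W E F" and good: "good W E F x" and h: "polar W E F x h"
    and G: "invariant (stabilizer W x F) E (adjoin x F) G" "G \<noteq> adjoin x F" "G \<noteq> E"
  shows "\<exists>G'. invariant W E F G' \<and> G' \<noteq> F \<and> G' \<noteq> E"
proof -
  have ts: "trivial_spectrum W E F" using max by (simp add: max_trivial_spectrum_def)
  note tsD = trivial_spectrumD[OF ts]
  let ?Wx = "stabilizer W x F" and ?F = "adjoin x F"
  note hD = polarD[OF h] and hs = functional_simps[OF polarD(1)[OF h]]
  have xE: "x \<in> E" using good by (simp add: good_def)
  have WxW: "m \<in> W" "m \<star> x \<in> F" if "m \<in> ?Wx" for m using that by (auto simp: stabilizer_def)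
  have sG: "V.subspace G" and FG: "?F \<subseteq> G" and GE: "G \<subseteq> E" using G by (auto simp: invariant_def)
  have xG: "x \<in> G" and FG': "F \<subseteq> G" using FG in_adjoin by auto
  define G' where "G' = {g \<in> G. h g = 0}"
  have sG': "V.subspace G'" using sG unfolding G'_def V.subspace_def by (auto simp: hs)
  have FG'': "F \<subseteq> G'" using FG' hD(2) unfolding G'_def by auto
  note Gcl = V.subspace_add[OF sG] V.subspace_diff[OF sG] V.subspace_scale[OF sG]
  note Gcl' = V.subspace_add[OF sG'] V.subspace_diff[OF sG'] V.subspace_scale[OF sG']
  note Fcl = V.subspace_add[OF tsD(5)] V.subspace_diff[OF tsD(5)] V.subspace_scale[OF tsD(5)]
  have xG': "x \<notin> G'" using hD(3) by (simp add: G'_def)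
  have G_eq: "adjoin x G' = G"
  proof
    show "adjoin x G' \<subseteq> G" using xG by (intro adjoin_minimal[OF sG]) (auto simp: G'_def)
    show "G \<subseteq> adjoin x G'"
    proof
      fix g assume "g \<in> G"
      then have "g - h g *s x \<in> G'" using Gcl xG hD(3) by (auto simp: G'_def hs)
      then show "g \<in> adjoin x G'" by (rule adjoinI[OF sG'])
    qed
  qed
  have "G' \<subseteq> E" using GE by (auto simp: G'_def)
  then have fG: "V.fin_dim G" and fG': "V.fin_dim G'"
    using V.fin_dim_subset[OF tsD(4)] GE by blast+
  \<comment> \<open>Maximality of the stabilizer gives this modulo \<open>adjoin x F\<close>. The
    error along x is read off by h, which vanishes both at g and on the image of the
    stabilizer.\<close>
  have transitive: "\<exists>m\<in>W. g - m \<star> v \<in> F" if v: "v \<in> E" "v \<notin> G" and g: "g \<in> G'" for v g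
  proof -
    have "g \<in> G" "h g = 0" using g by (auto simp: G'_def)
    then obtain m where m: "m \<in> ?Wx" "g - m \<star> v \<in> ?F"
      using max_invariant(3)[OF max_good(1)[OF max good] G(1) v] by blast
    obtain k where k: "g - m \<star> v - k *s x \<in> F" using adjoinE[OF tsD(5) m(2)] by blast
    have "k = 0" using hD(2)[OF k] \<open>h g = 0\<close> stabilizer_polar_zero[OF max good h m(1) v(1)] hD(3)
      by (simp add: hs)
    then show ?thesis using k WxW(1)[OF m(1)] by auto
  qed
  \<comment> \<open>The image of G under id - N contains G' modulo F: if g came from some v outside
    G, an operator M taking v to g would make v fixed by N + M. By dimension this image is G'
    together with the line of x - N x.\<close>
  have C: "\<exists>c. g - N \<star> g - c *s (x - N \<star> x) \<in> G'" if N: "N \<in> W" and g: "g \<in> G'" for N g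
  proof -
    let ?S = "V.span ((\<lambda>v. v - N \<star> v) ` G \<union> F)"
    have dS: "V.dim ?S = V.dim G" by (rule id_minus_act_image[OF ts N sG FG' GE])
    have fS: "V.fin_dim ?S"
      using VV.dim_preimage_image(2)[OF linear_id_minus_act sG fG tsD(5,10)] .
    have "G' \<subseteq> ?S"
    proof
      fix g assume g: "g \<in> G'"
      then have "g \<in> E" using GE by (auto simp: G'_def)
      then obtain v where v: "v \<in> E" "g - (v - N \<star> v) \<in> F" by (rule id_minus_act_surj[OF ts N])
      have "v \<in> G"
      proof (rule ccontr)
        assume "v \<notin> G"
        then obtain M where M: "M \<in> W" "g - M \<star> v \<in> F" using transitive v(1) g by blast
        have "v - (N + M) \<star> v = (g - M \<star> v) - (g - (v - N \<star> v))" by (simp add: act_simps)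
        also have "\<dots> \<in> F" using M v Fcl by blast
        finally have "v \<in> F" using tsD(9)[OF Op.subspace_add[OF tsD(1) N M(1)] v(1)] by blast
        then show False using \<open>v \<notin> G\<close> FG' by blast
      qed
      then show "g \<in> ?S" unfolding mem_span_id_minus_act_iff[OF sG tsD(5)] using v by blast
    qed
    moreover have "x - N \<star> x \<in> ?S" using xG by (intro V.span_base) auto
    ultimately have sub: "adjoin (x - N \<star> x) G' \<subseteq> ?S" by (intro adjoin_minimal) auto
    have "h (x - N \<star> x) = 1" using hD(3) hD(4)[OF N] by (simp add: hs)
    then have "x - N \<star> x \<notin> G'" by (auto simp: G'_def)
    then have "V.dim (adjoin (x - N \<star> x) G') = V.dim G"
      using dim_adjoin[OF sG' fG'] dim_adjoin[OF sG' fG' xG'] unfolding G_eq by simp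
    then have "adjoin (x - N \<star> x) G' = ?S"
      using dS by (intro V.subspace_eq_if_dim_le[OF V.subspace_span V.subspace_span sub fS]) linarith
    moreover have "g - N \<star> g \<in> ?S" using g by (intro V.span_base) (auto simp: G'_def)
    ultimately have "g - N \<star> g \<in> adjoin (x - N \<star> x) G'" by simp
    then show ?thesis using adjoinE[OF sG'] by blast
  qed
  have C': "N \<star> g - h (N \<star> g) *s (x - N \<star> x) \<in> G'" if N: "N \<in> W" and g: "g \<in> G'" for N g
  proof -
    obtain c where c: "g - N \<star> g - c *s (x - N \<star> x) \<in> G'" using C[OF N g] by blast
    have "c = - h (N \<star> g)" using c g hD(3) hD(4)[OF N] unfolding G'_def
      by (auto simp: hs algebra_simps eq_neg_iff_add_eq_0)
    moreover have "g - (g - N \<star> g - c *s (x - N \<star> x)) \<in> G'" using c g Gcl'(2) by blast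
    ultimately show ?thesis by simp
  qed
  have D: "N \<star> g \<in> G'" if N: "N \<in> W" "N \<star> x \<notin> G'" and g: "g \<in> G'" for N g
  proof -
    let ?e = "h (N \<star> g)"
    \<comment> \<open>The relation \<open>C'\<close> holds for N and for \<tau> N. Dividing the
      second by \<tau> and subtracting leaves a multiple of N x only.\<close>
    have tN: "\<tau> *w N \<in> W" using N(1) Op.subspace_scale[OF tsD(1)] by blast
    have "\<tau> *s (N \<star> g) - (\<tau> * ?e) *s (x - \<tau> *s (N \<star> x)) \<in> G'"
      using C'[OF tN g] by (simp add: act_simps hs)
    then have "(1 / \<tau>) *s (\<tau> *s (N \<star> g) - (\<tau> * ?e) *s (x - \<tau> *s (N \<star> x))) \<in> G'" by (rule Gcl'(3))
    then have "N \<star> g - ?e *s (x - \<tau> *s (N \<star> x)) \<in> G'"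
      using tau(1) by (simp add: V.scale_right_diff_distrib mult.commute)
    from Gcl'(2)[OF this C'[OF N(1) g]]
    have "(?e * (\<tau> - 1)) *s (N \<star> x) \<in> G'"
      by (simp add: V.scale_right_diff_distrib V.scale_left_diff_distrib algebra_simps)
    then have inv: "(1 / (?e * (\<tau> - 1))) *s ((?e * (\<tau> - 1)) *s (N \<star> x)) \<in> G'" by (rule Gcl'(3))
    have "?e = 0"
    proof (rule ccontr)
      assume "?e \<noteq> 0"
      then show False using inv N(2) tau(2) by simp
    qed
    then show ?thesis using C'[OF N(1) g] by simp
  qed
  \<comment> \<open>The orbit of x is the hyperplane h = 0 modulo F. It is not contained in G,
    because G contains x and differs from E; this provides an operator N1 with N1 x outside
    G'.\<close>
  obtain w where w: "w \<in> E" "w \<notin> G" using G(3) GE by blast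
  have "w - h w *s x \<in> E" "h (w - h w *s x) = 0"
    using w(1) xE hD(3) V.subspace_diff[OF tsD(3)] V.subspace_scale[OF tsD(3)] by (auto simp: hs)
  then obtain N1 where N1: "N1 \<in> W" "w - h w *s x - N1 \<star> x \<in> F" using hD(5) by blast
  have N1x: "N1 \<star> x \<notin> G'"
  proof
    assume "N1 \<star> x \<in> G'"
    then have "N1 \<star> x \<in> G" by (simp add: G'_def)
    then have "(w - h w *s x - N1 \<star> x) + (N1 \<star> x + h w *s x) \<in> G"
      by (rule Gcl(1)[OF subsetD[OF FG' N1(2)] Gcl(1)[OF _ Gcl(3)[OF xG]]])
    then show False using w(2) by simp
  qed
  have "N \<star> g \<in> G'" if N: "N \<in> W" and g: "g \<in> G'" for N g
  proof (cases "N \<star> x \<in> G'")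
    case True
    have "(N + N1) \<star> x \<notin> G'"
    proof
      assume "(N + N1) \<star> x \<in> G'"
      then have "(N + N1) \<star> x - N \<star> x \<in> G'" using True Gcl'(2) by blast
      then show False using N1x by (simp add: act_simps)
    qed
    then have "(N + N1) \<star> g - N1 \<star> g \<in> G'"
      using D[OF Op.subspace_add[OF tsD(1) N N1(1)] _ g] D[OF N1(1) N1x g] Gcl'(2) by blast
    then show ?thesis by (simp add: act_simps)
  qed (use D N g in blast)
  then have "invariant W E F G'"
    unfolding invariant_def using sG' FG'' GE by (auto simp: G'_def)
  moreover have "G' \<noteq> F" using G_eq G(2) by blast
  moreover have "G' \<noteq> E" using xE xG' by blast
  ultimately show ?thesis by blast
qed

end

section \<open>The compatible form of an irreducible space\<close>

context bilinear_action begin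

definition irreducible_action :: "'w set \<Rightarrow> 'v set \<Rightarrow> 'v set \<Rightarrow> bool" where
  "irreducible_action W E F \<longleftrightarrow> E \<noteq> F \<and> (\<forall>G. invariant W E F G \<longrightarrow> G = F \<or> G = E)"

text \<open>By the last clause, the orbit of every v outside F is modulo F the full hyperplane
  \<open>b v z = 0\<close> of E: what \<open>polar\<close> provides for one good vector is provided
  for all vectors at once, linearly in v.\<close>

definition compatible_form :: "'w set \<Rightarrow> 'v set \<Rightarrow> 'v set \<Rightarrow> ('v \<Rightarrow> 'v \<Rightarrow> 'a) \<Rightarrow> bool" where
  "compatible_form W E F b \<longleftrightarrow> (\<forall>v. functional (b v)) \<and> (\<forall>w. functional (\<lambda>v. b v w)) \<and>
    (\<forall>m\<in>W. \<forall>v\<in>E. b v (m \<star> v) = 0) \<and> (\<forall>v\<in>F. \<forall>w\<in>E. b v w = 0 \<and> b w v = 0) \<and>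
    (\<forall>v\<in>E - F. b v v \<noteq> 0 \<and> (\<forall>z\<in>E. b v z = 0 \<longrightarrow> (\<exists>m\<in>W. z - m \<star> v \<in> F)))"

text \<open>\<open>compatible_form\<close> asks for forms on the whole space, while the coefficient
  from which the form is built is linear on E only.\<close>

lemma functional_extend:
  assumes E: "V.subspace E"
    and add: "\<And>u v. u \<in> E \<Longrightarrow> v \<in> E \<Longrightarrow> c (u + v) = c u + c v"
    and scale: "\<And>k v. v \<in> E \<Longrightarrow> c (k *s v) = k * c v"
  shows "\<exists>f. functional f \<and> (\<forall>v\<in>E. f v = c v)"
proof -
  obtain B where B: "B \<subseteq> E" "V.independent B" "E \<subseteq> V.span B" by (rule V.maximal_independent_subset)
  have sp: "V.span B = E" using B E by (intro V.span_subspace)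
  obtain f where f: "functional f" "\<forall>v\<in>B. f v = c v"
    using vector_space_pair.linear_independent_extend[OF vector_space_pair_field B(2)] by blast
  note fs = functional_simps[OF f(1)]
  have "c 0 = 0" using scale[of 0 0] V.subspace_0[OF E] by simp
  then have s0: "V.subspace {v \<in> E. f v = c v}"
    using E add scale unfolding V.subspace_def by (auto simp: fs)
  have "B \<subseteq> {v \<in> E. f v = c v}" using B(1) f(2) by auto
  then have "E \<subseteq> {v \<in> E. f v = c v}" unfolding sp[symmetric] by (rule V.span_minimal) (simp add: sp s0)
  then show ?thesis using f(1) by auto
qed

end

text \<open>The induction step for the form: \<open>B\<close> belongs to the stabilizer acting on E
  / (F + x) and is to be lifted to E / F.\<close>

locale form_extension = bilinear_action_3 sw sv act \<tau>
  for sw :: "'a::field \<Rightarrow> 'w::ab_group_add \<Rightarrow> 'w" (infixr "*w" 75)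
    and sv :: "'a \<Rightarrow> 'v::ab_group_add \<Rightarrow> 'v" (infixr "*s" 75)
    and act :: "'w \<Rightarrow> 'v \<Rightarrow> 'v" (infixr "\<star>" 74) and \<tau> :: 'a +
  fixes W E F x h B
  assumes max: "max_trivial_spectrum W E F" and good: "good W E F x" and h: "polar W E F x h"
    and B: "compatible_form (stabilizer W x F) E (adjoin x F) B"
    and irr: "irreducible_action W E F" and neq: "E \<noteq> adjoin x F"
begin

lemma ts: "trivial_spectrum W E F" using max by (simp add: max_trivial_spectrum_def)
lemmas tsD = trivial_spectrumD[OF ts]
lemmas hD = polarD[OF h] and hs = functional_simps[OF polarD(1)[OF h]]

lemma xE: "x \<in> E" using good by (simp add: good_def)

lemma functional_B: "functional (B v)" "functional (\<lambda>v. B v w)"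
  using B by (auto simp: compatible_form_def)

lemmas Bs = functional_simps[OF functional_B(1)] functional_simps[OF functional_B(2)]

lemma B_F: "f \<in> adjoin x F \<Longrightarrow> v \<in> E \<Longrightarrow> B f v = 0 \<and> B v f = 0"
  and B_stab: "m \<in> stabilizer W x F \<Longrightarrow> v \<in> E \<Longrightarrow> B v (m \<star> v) = 0"
  and B_nz: "v \<in> E \<Longrightarrow> v \<notin> adjoin x F \<Longrightarrow> B v v \<noteq> 0"
  and B_orbit: "v \<in> E \<Longrightarrow> v \<notin> adjoin x F \<Longrightarrow> z \<in> E \<Longrightarrow> B v z = 0 \<Longrightarrow>
    \<exists>m\<in>stabilizer W x F. z - m \<star> v \<in> adjoin x F"
  using B unfolding compatible_form_def by blast+

lemma B_F0: "f \<in> F \<Longrightarrow> v \<in> E \<Longrightarrow> B f v = 0" "f \<in> F \<Longrightarrow> v \<in> E \<Longrightarrow> B v f = 0"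
  using B_F in_adjoin(2) by blast+

lemma B_x: "v \<in> E \<Longrightarrow> B x v = 0" "v \<in> E \<Longrightarrow> B v x = 0"
  using B_F in_adjoin(1) by blast+

lemmas Ecl = V.subspace_add[OF tsD(3)] V.subspace_diff[OF tsD(3)] V.subspace_scale[OF tsD(3)]
lemmas Fcl = V.subspace_add[OF tsD(5)] V.subspace_diff[OF tsD(5)] V.subspace_scale[OF tsD(5)]
lemmas Wcl = Op.subspace_add[OF tsD(1)] Op.subspace_diff[OF tsD(1)] Op.subspace_scale[OF tsD(1)]

lemma stab: "m \<in> stabilizer W x F \<Longrightarrow> m \<in> W" "m \<in> stabilizer W x F \<Longrightarrow> m \<star> x \<in> F"
  by (auto simp: stabilizer_def)

text \<open>Modulo F this is a complement of the line of x in E, hence a copy of E / (F + x), the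
  space on which \<open>B\<close> is non-isotropic.\<close>

definition H where "H = {y \<in> E. h y = 0}"

lemma HE: "y \<in> H \<Longrightarrow> y \<in> E" and Hh: "y \<in> H \<Longrightarrow> h y = 0" and HI: "y \<in> E \<Longrightarrow> h y = 0 \<Longrightarrow> y \<in> H"
  by (auto simp: H_def)

lemma subspace_H: "V.subspace H"
  using tsD(3) unfolding H_def V.subspace_def by (auto simp: hs)

lemmas Hcl = V.subspace_add[OF subspace_H] V.subspace_diff[OF subspace_H] V.subspace_scale[OF subspace_H]

lemma F_H: "f \<in> F \<Longrightarrow> f \<in> H" using tsD(6) hD(2) by (auto simp: H_def)

lemma H_adjoin: "y \<in> H \<Longrightarrow> y \<in> adjoin x F \<Longrightarrow> y \<in> F"
proof -
  assume y: "y \<in> H" "y \<in> adjoin x F"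
  obtain k where k: "y - k *s x \<in> F" using adjoinE[OF tsD(5) y(2)] by blast
  then have "k = 0" using hD(2)[OF k] Hh[OF y(1)] hD(3) by (simp add: hs)
  then show "y \<in> F" using k by simp
qed

lemma B_nz_H: "y \<in> H \<Longrightarrow> y \<notin> F \<Longrightarrow> B y y \<noteq> 0"
  using B_nz HE H_adjoin by blast

lemma proj_H: "v \<in> E \<Longrightarrow> v - h v *s x \<in> H"
  using Ecl xE hD(3) by (intro HI) (auto simp: hs)

text \<open>Equality would make y + c x with c = h (N y) a fixed vector. Its image u under id - N
  satisfies h u = 0 by the choice of c and B y u = 0 by the equality. Thus u equals m y modulo F for
  some m in the stabilizer, and N + m fixes y + c x modulo F.\<close>

lemma no_eigen:
  assumes y: "y \<in> H" "y \<notin> F" and N: "N \<in> W"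
  shows "B y (N \<star> y) + h (N \<star> y) * B y (N \<star> x) \<noteq> B y y"
proof
  assume eq: "B y (N \<star> y) + h (N \<star> y) * B y (N \<star> x) = B y y"
  have yE: "y \<in> E" and yF: "y \<notin> adjoin x F" using y HE H_adjoin by blast+
  define c where "c = h (N \<star> y)"
  define u where "u = y + c *s x - N \<star> y - c *s (N \<star> x)"
  have uE: "u \<in> E" unfolding u_def using Ecl yE xE tsD(7)[OF N] by simp
  have "B y u = B y y - (B y (N \<star> y) + c * B y (N \<star> x))"
    unfolding u_def using B_x(2)[OF yE] by (simp add: Bs algebra_simps)
  then have "B y u = 0" using eq by (simp add: c_def)
  then obtain m where m: "m \<in> stabilizer W x F" "u - m \<star> y \<in> adjoin x F" using B_orbit[OF yE yF uE] by blast
  obtain k where k: "u - m \<star> y - k *s x \<in> F" using adjoinE[OF tsD(5) m(2)] by blast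
  have "h u = 0" unfolding u_def using Hh[OF y(1)] hD(3) hD(4)[OF N] by (simp add: hs c_def)
  then have "k = 0" using hD(2)[OF k] stabilizer_polar_zero[OF max good h m(1) yE] hD(3) by (simp add: hs)
  have "(y + c *s x) - (N + m) \<star> (y + c *s x) = (u - m \<star> y - k *s x) - c *s (m \<star> x)"
    unfolding u_def \<open>k = 0\<close> by (simp add: act_simps algebra_simps)
  also have "\<dots> \<in> F" using k stab(2)[OF m(1)] Fcl by blast
  finally have "y + c *s x \<in> F"
    by (rule tsD(9)[OF Wcl(1)[OF N stab(1)[OF m(1)]] Ecl(1)[OF yE Ecl(3)[OF xE]]])
  then have "y - (- c) *s x \<in> F" by simp
  then show False using yF adjoinI[OF tsD(5)] by blast
qed

lemma orbit_B:
  assumes "z \<in> H"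
  shows "\<exists>N\<in>W. \<forall>y\<in>E. B y (N \<star> x) = B y z"
proof -
  obtain N where N: "N \<in> W" "z - N \<star> x \<in> F" using hD(5)[OF HE[OF assms] Hh[OF assms]] by blast
  have "B y (N \<star> x) = B y z" if "y \<in> E" for y using B_F0(2)[OF N(2) that] by (simp add: Bs)
  then show ?thesis using N(1) by blast
qed

lemma orbit_one:
  assumes y: "y \<in> H" "y \<notin> F"
  shows "\<exists>N\<in>W. B y (N \<star> x) = 1"
proof -
  obtain N where N: "N \<in> W" "\<forall>u\<in>E. B u (N \<star> x) = B u y" using orbit_B[OF y(1)] by blast
  then have "B y (((1 / B y y) *w N) \<star> x) = 1" using B_nz_H[OF y] HE[OF y(1)] by (simp add: act_simps Bs)
  then show ?thesis using N(1) Wcl(3) by blast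
qed

text \<open>One step of Gram-Schmidt: removing from z its component along y gives u with B y u = 0
  and B z u = B u u, which is nonzero since \<open>B\<close> is non-isotropic. Some operator takes x
  to u modulo F.\<close>

lemma orbit_dual:
  assumes y: "y \<in> H" "y \<notin> F" and z: "z \<in> H" and ind: "\<And>k. z - k *s y \<notin> F"
  shows "\<exists>N\<in>W. B y (N \<star> x) = 0 \<and> B z (N \<star> x) = 1"
proof -
  define u where "u = z - (B y z / B y y) *s y"
  have u: "u \<in> H" "u \<notin> F" unfolding u_def using Hcl y z ind by auto
  have yu: "B y u = 0" unfolding u_def using B_nz_H[OF y] by (simp add: Bs)
  have "B u u = B z u - (B y z / B y y) * B y u" by (subst (1) u_def) (simp add: Bs)
  then have zu: "B z u \<noteq> 0" using B_nz_H[OF u] yu by simp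
  obtain N where N: "N \<in> W" "\<forall>v\<in>E. B v (N \<star> x) = B v u" using orbit_B[OF u(1)] by blast
  have "B y (((1 / B z u) *w N) \<star> x) = 0" "B z (((1 / B z u) *w N) \<star> x) = 1"
    using N(2) HE y(1) z yu zu by (simp_all add: act_simps Bs)
  then show ?thesis using N(1) Wcl(3) by blast
qed

text \<open>Consider the functionals p = h (N y), q = B y (N y) and r = B y (N x) of N, where
  \<open>no_eigen\<close> forbids q + p r = B y y. If p = 0, scaling N would reach this value unless
  q = 0. If p takes the value 1 somewhere, adding to that operator a multiple of one with p = 0
  would reach it unless r = 0. So q and r are multiples of p, and r is not identically zero.\<close>

lemma proportional:
  assumes y: "y \<in> H"
  shows "\<exists>k a. \<forall>N\<in>W. h (N \<star> y) = k * B y (N \<star> x) \<and> B y (N \<star> y) = a * B y (N \<star> x)"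
proof (cases "y \<in> F")
  case True
  have "h (N \<star> y) = 0 \<and> B y (N \<star> y) = 0" if N: "N \<in> W" for N
    using hD(2)[OF tsD(8)[OF N True]] B_F0(1)[OF True] tsD(7)[OF N HE[OF y]] by simp
  then show ?thesis by (intro exI[of _ 0]) simp
next
  case False
  note ne = no_eigen[OF y False]
  have 1: "B y (N \<star> y) = 0" if N: "N \<in> W" and g: "h (N \<star> y) = 0" for N
  proof (rule ccontr)
    assume a: "B y (N \<star> y) \<noteq> 0"
    show False using ne[OF Wcl(3)[OF N, of "B y y / B y (N \<star> y)"]] a g by (simp add: act_simps hs Bs)
  qed
  show ?thesis
  proof (cases "\<forall>N\<in>W. h (N \<star> y) = 0")
    case True
    then show ?thesis using 1 by (intro exI[of _ 0]) simp
  next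
    case False
    then obtain N' where N': "N' \<in> W" "h (N' \<star> y) \<noteq> 0" by blast
    define N0 where "N0 = (1 / h (N' \<star> y)) *w N'"
    have N0: "N0 \<in> W" "h (N0 \<star> y) = 1" unfolding N0_def using N' Wcl(3) by (auto simp: act_simps hs)
    have 2: "B y (N \<star> y) = B y (N0 \<star> y) * h (N \<star> y)" if N: "N \<in> W" for N
    proof -
      have "B y ((N - h (N \<star> y) *w N0) \<star> y) = 0"
        using 1[OF Wcl(2)[OF N Wcl(3)[OF N0(1)]]] N0(2) by (simp add: act_simps hs)
      then show ?thesis by (simp add: act_simps Bs)
    qed
    have 3: "B y (N \<star> x) = 0" if N: "N \<in> W" and g: "h (N \<star> y) = 0" for N
    proof (rule ccontr)
      assume a: "B y (N \<star> x) \<noteq> 0"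
      let ?s = "(B y y - B y (N0 \<star> y) - B y (N0 \<star> x)) / B y (N \<star> x)"
      show False
        using ne[OF Wcl(1)[OF N0(1) Wcl(3)[OF N, of ?s]]] a g 1[OF N g] N0(2) by (simp add: act_simps hs Bs)
    qed
    have 4: "B y (N \<star> x) = B y (N0 \<star> x) * h (N \<star> y)" if N: "N \<in> W" for N
    proof -
      have "B y ((N - h (N \<star> y) *w N0) \<star> x) = 0"
        using 3[OF Wcl(2)[OF N Wcl(3)[OF N0(1)]]] N0(2) by (simp add: act_simps hs)
      then show ?thesis by (simp add: act_simps Bs)
    qed
    have nz: "B y (N0 \<star> x) \<noteq> 0" using orbit_one[OF y \<open>y \<notin> F\<close>] 4 by force
    show ?thesis
      by (intro exI[of _ "1 / B y (N0 \<star> x)"] exI[of _ "B y (N0 \<star> y) / B y (N0 \<star> x)"] ballI conjI)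
        (use 2 4 nz in simp_all)
  qed
qed

lemma exists_y0: "\<exists>y. y \<in> H \<and> y \<notin> F"
proof -
  have "adjoin x F \<subseteq> E" by (rule adjoin_minimal[OF tsD(3,6) xE])
  then obtain w where w: "w \<in> E" "w \<notin> adjoin x F" using neq by blast
  then have "w - h w *s x \<notin> F" using adjoinI[OF tsD(5)] by blast
  then show ?thesis using proj_H w(1) by blast
qed

lemma h_act_F: "N \<in> W \<Longrightarrow> f \<in> F \<Longrightarrow> h (N \<star> f) = 0"
  using hD(2) tsD(8) by blast

text \<open>For y and z independent modulo F the factors agree with the one of y + z, as tests on
  operators dual to y and z show. The common factor is not zero, since otherwise H would be
  invariant and W reducible.\<close>

lemma scalar:
  "\<exists>k. k \<noteq> 0 \<and> (\<forall>N\<in>W. \<forall>y\<in>H. h (N \<star> y) = k * B y (N \<star> x))"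
proof -
  obtain K where K: "\<And>y N. y \<in> H \<Longrightarrow> N \<in> W \<Longrightarrow> h (N \<star> y) = K y * B y (N \<star> x)"
    using proportional by metis
  obtain y where y: "y \<in> H" "y \<notin> F" using exists_y0 by blast
  have all: "h (N \<star> z) = K y * B z (N \<star> x)" if N: "N \<in> W" and z: "z \<in> H" for N z
  proof (cases "\<exists>k. z - k *s y \<in> F")
    case True
    then obtain k where k: "z - k *s y \<in> F" by blast
    have "h (N \<star> z) = k * h (N \<star> y)" using h_act_F[OF N k] by (simp add: act_simps hs)
    moreover have "B z (N \<star> x) = k * B y (N \<star> x)"
      using B_F0(1)[OF k tsD(7)[OF N xE]] by (simp add: Bs)
    ultimately show ?thesis using K[OF y(1) N] by simp
  next
    case False
    then have ind: "\<And>k. z - k *s y \<notin> F" by blast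
    have zF: "z \<notin> F" using ind[of 0] by simp
    have ind': "y - k *s z \<notin> F" for k
    proof
      assume a: "y - k *s z \<in> F"
      then have "k \<noteq> 0" using y(2) by auto
      then have "z - (1 / k) *s y = (- (1 / k)) *s (y - k *s z)" by (simp add: V.scale_right_diff_distrib)
      then show False using ind[of "1 / k"] Fcl(3)[OF a, of "- (1 / k)"] by simp
    qed
    have sum: "K (y + z) * (B y (N \<star> x) + B z (N \<star> x)) = K y * B y (N \<star> x) + K z * B z (N \<star> x)"
      if "N \<in> W" for N
      using K[OF Hcl(1)[OF y(1) z] that] K[OF y(1) that] K[OF z that] by (simp add: act_simps hs Bs)
    obtain Na where "Na \<in> W" "B y (Na \<star> x) = 0" "B z (Na \<star> x) = 1" using orbit_dual[OF y z ind] by blast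
    from sum[OF this(1)] this(2,3) have "K (y + z) = K z" by simp
    moreover obtain Nb where "Nb \<in> W" "B z (Nb \<star> x) = 0" "B y (Nb \<star> x) = 1"
      using orbit_dual[OF z zF y(1) ind'] by blast
    from sum[OF this(1)] this(2,3) have "K (y + z) = K y" by simp
    ultimately show ?thesis using K[OF z N] by simp
  qed
  have "K y \<noteq> 0"
  proof
    assume "K y = 0"
    then have "invariant W E F H" unfolding invariant_def
      using subspace_H F_H HE all tsD(7) HI by auto
    then have "H = F \<or> H = E" using irr unfolding irreducible_action_def by blast
    then show False using y xE hD(3) Hh[of x] by auto
  qed
  then show ?thesis using all by blast
qed

text \<open>On F both sides of the defining relation vanish, so the factor c can be set to 0 there.
  Additivity on independent y and z is a polarization: the relation is expanded at y + t z for t = 1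
  and t = \<tau>, each time on operators dual to y and to z, and the mixed terms are eliminated from
  the four equations.\<close>

lemma exists_coefficient:
  "\<exists>c. (\<forall>N\<in>W. \<forall>y\<in>H. B y (N \<star> y) = c y * B y (N \<star> x)) \<and> (\<forall>y\<in>F. c y = 0) \<and>
    (\<forall>y\<in>H. \<forall>z\<in>H. c (y + z) = c y + c z) \<and> (\<forall>y\<in>H. \<forall>k. c (k *s y) = k * c y)"
proof -
  have "\<forall>y. \<exists>a. y \<in> H \<longrightarrow> (\<forall>N\<in>W. B y (N \<star> y) = a * B y (N \<star> x))" using proportional by blast
  then obtain c0 where c0: "\<And>y N. y \<in> H \<Longrightarrow> N \<in> W \<Longrightarrow> B y (N \<star> y) = c0 y * B y (N \<star> x)" by metis
  define c where "c y = (if y \<in> F then 0 else c0 y)" for y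
  have c: "B y (N \<star> y) = c y * B y (N \<star> x)" if "y \<in> H" "N \<in> W" for y N
    using c0[OF that] B_F0(1)[OF _ tsD(7)[OF that(2) HE[OF that(1)]]] by (cases "y \<in> F") (auto simp: c_def)
  have c_uniq: "c y = a" if y: "y \<in> H" "y \<notin> F" and a: "\<And>N. N \<in> W \<Longrightarrow> B y (N \<star> y) = a * B y (N \<star> x)" for y a
  proof -
    obtain N where N: "N \<in> W" "B y (N \<star> x) = 1" using orbit_one[OF y] by blast
    show ?thesis using c[OF y(1) N(1)] a[OF N(1)] N(2) by simp
  qed
  have scale: "c (k *s y) = k * c y" if y: "y \<in> H" for k y
  proof (cases "k *s y \<in> F")
    case True
    show ?thesis
    proof (cases "k = 0")
      case False
      have "(1 / k) *s (k *s y) \<in> F" using Fcl(3)[OF True] .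
      then show ?thesis using True False by (simp add: c_def)
    qed (simp add: c_def V.subspace_0[OF tsD(5)])
  next
    case False
    show ?thesis
      by (rule c_uniq[OF Hcl(3)[OF y] False]) (use c[OF y] in \<open>simp add: act_simps Bs\<close>)
  qed
  have cong: "c y = c z" if y: "y \<in> H" and z: "z \<in> H" and yz: "y - z \<in> F" for y z
  proof (cases "y \<in> F")
    case True
    then have "y - (y - z) \<in> F" using yz Fcl(2) by blast
    then show ?thesis using True by (simp add: c_def)
  next
    case False
    show ?thesis
    proof (rule c_uniq[OF y False])
      fix N assume N: "N \<in> W"
      have e1: "B (y - z) v = 0" if "v \<in> E" for v using B_F0(1)[OF yz that] .
      have "B z (N \<star> (y - z)) = 0" using B_F0(2)[OF tsD(8)[OF N yz] HE[OF z]] .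
      then have e2: "B z (N \<star> y) = B z (N \<star> z)" by (simp add: act_simps Bs)
      have "B y (N \<star> y) = B z (N \<star> y)" "B y (N \<star> x) = B z (N \<star> x)"
        using e1[OF tsD(7)[OF N HE[OF y]]] e1[OF tsD(7)[OF N xE]] by (simp_all add: Bs)
      then show "B y (N \<star> y) = c z * B y (N \<star> x)" using c[OF z N] e2 by simp
    qed
  qed
  have add: "c (y + z) = c y + c z" if y: "y \<in> H" and z: "z \<in> H" for y z
  proof (cases "y \<in> F")
    case True
    then have "c (y + z) = c z" using cong[OF Hcl(1)[OF y z] z] by simp
    then show ?thesis using True by (simp add: c_def)
  next
    case yF: False
    show ?thesis
    proof (cases "\<exists>k. z - k *s y \<in> F")
      case True
      then obtain k where k: "z - k *s y \<in> F" by blast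
      have "c z = k * c y" using cong[OF z Hcl(3)[OF y] k] scale[OF y] by simp
      moreover have e: "(y + z) - (1 + k) *s y = z - k *s y" by (simp add: V.scale_left_distrib)
      have "c (y + z) = c ((1 + k) *s y)"
        by (rule cong[OF Hcl(1)[OF y z] Hcl(3)[OF y]]) (unfold e, rule k)
      then have "c (y + z) = (1 + k) * c y" using scale[OF y] by simp
      ultimately show ?thesis by (simp add: algebra_simps)
    next
      case False
      then have ind: "\<And>k. z - k *s y \<notin> F" by blast
      have zF: "z \<notin> F" using ind[of 0] by simp
      have ind': "y - k *s z \<notin> F" for k
      proof
        assume a: "y - k *s z \<in> F"
        then have "k \<noteq> 0" using yF by auto
        then have "z - (1 / k) *s y = (- (1 / k)) *s (y - k *s z)" by (simp add: V.scale_right_diff_distrib)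
        then show False using ind[of "1 / k"] Fcl(3)[OF a, of "- (1 / k)"] by simp
      qed
      define \<Phi> where "\<Phi> N = B y (N \<star> z) + B z (N \<star> y)" for N
      have exp: "c y * B y (N \<star> x) + t * \<Phi> N + t * t * (c z * B z (N \<star> x))
          = c (y + t *s z) * (B y (N \<star> x) + t * B z (N \<star> x))" if N: "N \<in> W" for N t
        using c[OF Hcl(1)[OF y Hcl(3)[OF z]] N, of t] c[OF y N] c[OF z N]
        by (simp add: act_simps Bs \<Phi>_def algebra_simps)
      obtain Na where Na: "Na \<in> W" "B y (Na \<star> x) = 0" "B z (Na \<star> x) = 1"
        using orbit_dual[OF y yF z ind] by blast
      obtain Nb where Nb: "Nb \<in> W" "B z (Nb \<star> x) = 0" "B y (Nb \<star> x) = 1"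
        using orbit_dual[OF z zF y ind'] by blast
      have a1: "\<Phi> Na + c z = c (y + z)" using exp[OF Na(1), of 1] Na by simp
      have "\<tau> * (\<Phi> Na + \<tau> * c z) = \<tau> * c (y + \<tau> *s z)"
        using exp[OF Na(1), of \<tau>] Na by (simp add: algebra_simps)
      then have a2: "\<Phi> Na + \<tau> * c z = c (y + \<tau> *s z)" using tau(1) by simp
      have b1: "c y + \<Phi> Nb = c (y + z)" using exp[OF Nb(1), of 1] Nb by simp
      have b2: "c y + \<tau> * \<Phi> Nb = c (y + \<tau> *s z)" using exp[OF Nb(1), of \<tau>] Nb by simp
      \<comment> \<open>Here p and q stand for c y and c z, r and r' for the mixed terms of the two
        dual operators, s and s' for the values of c at y + z and y + \<tau> z.\<close>
      have elim: "(1 - t) * (s - p - q) = 0" if "r + q = s" "r + t * q = s'" "p + r' = s" "p + t * r' = s'"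
        for p q r r' s s' t :: 'a
      proof -
        have "r = s - q" "r' = s - p" using that(1,3) by (auto simp: algebra_simps)
        then have "s - q + t * q = p + t * (s - p)" using that(2,4) by simp
        then show ?thesis by (simp add: algebra_simps)
      qed
      have "(1 - \<tau>) * (c (y + z) - c y - c z) = 0" by (rule elim[OF a1 a2 b1 b2])
      then have "c (y + z) - c y - c z = 0" using tau(2) by simp
      then show ?thesis by (simp add: algebra_simps)
    qed
  qed
  show ?thesis using c scale add by (intro exI[of _ c]) (auto simp: c_def)
qed

text \<open>Write v = y + (h v) x with y in H, and let \<beta> = B y (m x). Then h (m v) = k \<beta>
  and B v (m v) = (c y + h v) \<beta>, so f v h w - k B v w with f v = c y + h v vanishes at w = m
  v.\<close>

lemma exists_compatible_form: "\<exists>b. compatible_form W E F b"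
proof -
  obtain k where k: "k \<noteq> 0" "\<And>N y. N \<in> W \<Longrightarrow> y \<in> H \<Longrightarrow> h (N \<star> y) = k * B y (N \<star> x)" using scalar by blast
  obtain c where c: "\<And>N y. N \<in> W \<Longrightarrow> y \<in> H \<Longrightarrow> B y (N \<star> y) = c y * B y (N \<star> x)"
    "\<And>y. y \<in> F \<Longrightarrow> c y = 0" "\<And>y z. y \<in> H \<Longrightarrow> z \<in> H \<Longrightarrow> c (y + z) = c y + c z"
    "\<And>y k. y \<in> H \<Longrightarrow> c (k *s y) = k * c y" using exists_coefficient by metis
  define c' where "c' v = c (v - h v *s x) + h v" for v
  have c'add: "c' (u + v) = c' u + c' v" if "u \<in> E" "v \<in> E" for u v
  proof -
    have e: "(u + v) - h (u + v) *s x = (u - h u *s x) + (v - h v *s x)"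
      by (simp add: hs V.scale_left_distrib)
    show ?thesis unfolding c'_def e c(3)[OF proj_H proj_H, OF that] by (simp add: hs)
  qed
  have c'scale: "c' (t *s v) = t * c' v" if "v \<in> E" for t v
  proof -
    have e: "t *s v - h (t *s v) *s x = t *s (v - h v *s x)" by (simp add: hs V.scale_right_diff_distrib)
    show ?thesis unfolding c'_def e c(4)[OF proj_H, OF that] by (simp add: hs algebra_simps)
  qed
  obtain f where f': "functional f \<and> (\<forall>v\<in>E. f v = c' v)"
    using functional_extend[OF tsD(3), of c', OF c'add c'scale] by (rule exE)
  note f = conjunct1[OF f'] bspec[OF conjunct2[OF f']]
  note fs = functional_simps[OF f(1)]
  define b where "b v w = f v * h w - k * B v w" for v w
  have lin: "functional (b v)" "functional (\<lambda>v. b v w)" for v w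
    unfolding b_def Vector_Spaces.linear_iff
    using vector_space_field V.vector_space_axioms by (auto simp: fs hs Bs algebra_simps)
  note bs = functional_simps[OF lin(1)] functional_simps[OF lin(2)]
  have bF: "b v w = 0" "b w v = 0" if "v \<in> F" "w \<in> E" for v w
  proof -
    have "f v = 0" using f(2)[of v] that(1) tsD(6) hD(2) c(2) by (auto simp: c'_def)
    then show "b v w = 0" "b w v = 0" unfolding b_def using B_F0 that hD(2) by auto
  qed
  have balt: "b v (m \<star> v) = 0" if m: "m \<in> W" and v: "v \<in> E" for m v
  proof -
    define y where "y = v - h v *s x"
    have y: "y \<in> H" unfolding y_def by (rule proj_H[OF v])
    have v_eq: "v = y + h v *s x" by (simp add: y_def)
    have mE: "m \<star> y \<in> E" "m \<star> x \<in> E" using tsD(7)[OF m] HE[OF y] xE by auto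
    have hv: "h (m \<star> v) = k * B y (m \<star> x)"
      by (subst v_eq) (simp add: act_simps hs hD(4)[OF m] k(2)[OF m y])
    have "B v (m \<star> v) = B y (m \<star> v)"
      using B_x(1)[OF tsD(7)[OF m v]] by (subst (1) v_eq) (simp add: Bs)
    also have "\<dots> = (c y + h v) * B y (m \<star> x)"
      by (subst v_eq) (simp add: act_simps Bs c(1)[OF m y] algebra_simps)
    finally show ?thesis unfolding b_def hv f(2)[OF v] c'_def y_def[symmetric] by simp
  qed
  have orb: "\<exists>m\<in>W. z - m \<star> v \<in> F" if v: "v \<in> E" "v \<notin> F" and z: "z \<in> E" "b v z = 0" for v z
  proof -
    define y where "y = v - h v *s x"
    have y: "y \<in> H" unfolding y_def by (rule proj_H[OF v(1)])
    have v_eq: "v = y + h v *s x" by (simp add: y_def)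
    have By: "B v w = B y w" if "w \<in> E" for w
      using B_x(1)[OF that] by (subst v_eq) (simp add: Bs)
    show ?thesis
    proof (cases "y \<in> F")
      case True
      have hv: "h v \<noteq> 0" using v(2) True v_eq by auto
      have "b v z = h v * h z"
        unfolding b_def f(2)[OF v(1)] c'_def y_def[symmetric] using By[OF z(1)] c(2)[OF True] B_F0(1)[OF True z(1)] by simp
      then have "h z = 0" using z(2) hv by simp
      then obtain m where m: "m \<in> W" "z - m \<star> x \<in> F" using hD(5)[OF z(1)] by blast
      have "z - ((1 / h v) *w m) \<star> v = (z - m \<star> x) - (1 / h v) *s (m \<star> y)"
        by (subst v_eq) (simp add: act_simps hv V.scale_right_distrib)
      also have "\<dots> \<in> F" using m tsD(8)[OF m(1) True] Fcl by blast
      finally show ?thesis using Wcl(3)[OF m(1)] by blast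
    next
      case False
      \<comment> \<open>Since h (N v) = k is not zero, a multiple of N changes z within the orbit to
        some z1 with h z1 = 0. Orthogonality to v then means B y z1 = 0, and the orbit property of
        \<open>B\<close> applies.\<close>
      obtain N where N: "N \<in> W" "B y (N \<star> x) = 1" using orbit_one[OF y False] by blast
      have hN: "h (N \<star> v) = k"
        by (subst v_eq) (simp add: act_simps hs hD(4)[OF N(1)] k(2)[OF N(1) y] N(2))
      define m1 where "m1 = (h z / k) *w N"
      have m1: "m1 \<in> W" unfolding m1_def using N Wcl(3) by blast
      define z1 where "z1 = z - m1 \<star> v"
      have z1E: "z1 \<in> E" unfolding z1_def using z(1) Ecl(2) tsD(7)[OF m1 v(1)] by blast
      have hz1: "h z1 = 0" unfolding z1_def m1_def using hN k(1) by (simp add: act_simps hs)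
      have "b v z1 = 0" unfolding z1_def using z(2) balt[OF m1 v(1)] by (simp add: bs)
      then have "B y z1 = 0" using hz1 k(1) By[OF z1E] by (simp add: b_def)
      then obtain m' where m': "m' \<in> stabilizer W x F" "z1 - m' \<star> y \<in> adjoin x F"
        using B_orbit[OF HE[OF y] _ z1E] False H_adjoin[OF y] by blast
      have "h (z1 - m' \<star> y) = 0"
        using hz1 stabilizer_polar_zero[OF max good h m'(1) HE[OF y]] by (simp add: hs)
      then have zF: "z1 - m' \<star> y \<in> F"
        using H_adjoin[OF HI _] m'(2) Ecl(2)[OF z1E tsD(7)[OF stab(1)[OF m'(1)] HE[OF y]]] by blast
      have "z - (m1 + m') \<star> v = z1 - m' \<star> v" unfolding z1_def by (simp add: act_simps)
      also have "\<dots> = (z1 - m' \<star> y) - h v *s (m' \<star> x)" by (subst v_eq) (simp add: act_simps)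
      also have "\<dots> \<in> F" using zF stab(2)[OF m'(1)] Fcl by blast
      finally show ?thesis using Wcl(1)[OF m1 stab(1)[OF m'(1)]] by blast
    qed
  qed
  \<comment> \<open>Otherwise v would belong to its own orbit modulo F.\<close>
  have "b v v \<noteq> 0" if v: "v \<in> E" "v \<notin> F" for v
    using orb[OF v v(1)] tsD(9) v by blast
  then have "compatible_form W E F b"
    unfolding compatible_form_def using lin balt bF orb by blast
  then show ?thesis by blast
qed

end

context bilinear_action_3 begin

text \<open>Irreducibility passes to the stabilizer on the quotient by x, so the form is lifted
  along one good vector at a time. If x spans E modulo F, all operators map E into F and the product
  of two values of h serves as the form.\<close>

theorem irreducible_compatible_form:
  assumes "max_trivial_spectrum W E F" "irreducible_action W E F"
  shows "\<exists>b. compatible_form W E F b"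
  using assms
proof (induction "V.dim E - V.dim F" arbitrary: W F rule: less_induct)
  case less
  note max = less.prems(1) and irr = less.prems(2)
  have ts: "trivial_spectrum W E F" using max by (simp add: max_trivial_spectrum_def)
  note tsD = trivial_spectrumD[OF ts]
  have "E \<noteq> F" using irr by (simp add: irreducible_action_def)
  then obtain x where good: "good W E F x" using exists_good[OF ts] by blast
  then have x: "x \<in> E" "x \<notin> F" by (auto simp: good_def)
  obtain h where h: "polar W E F x h" using exists_polar[OF max good] by blast
  note hD = polarD[OF h] and hs = functional_simps[OF polarD(1)[OF h]]
  show ?case
  proof (cases "E = adjoin x F")
    case True
    have dec: "v - h v *s x \<in> F" if v: "v \<in> E" for v
    proof -
      obtain k where k: "v - k *s x \<in> F" using adjoinE[OF tsD(5)] v True by blast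
      then have "k = h v" using hD(2)[OF k] hD(3) by (simp add: hs)
      then show ?thesis using k by simp
    qed
    have hact: "h (m \<star> v) = 0" if m: "m \<in> W" and v: "v \<in> E" for m v
    proof -
      have "h (m \<star> (v - h v *s x)) = 0" using hD(2) tsD(8)[OF m dec[OF v]] by blast
      then show ?thesis using hD(4)[OF m] by (simp add: act_simps hs)
    qed
    define b where "b v w = h v * h w" for v w
    have "functional (b v)" "functional (\<lambda>v. b v w)" for v w
      unfolding b_def Vector_Spaces.linear_iff
      using vector_space_field V.vector_space_axioms by (auto simp: hs algebra_simps)
    moreover have hF: "z \<in> F" if "z \<in> E" "h z = 0" for z using dec[OF that(1)] that(2) by simp
    moreover have "\<exists>m\<in>W. z - m \<star> v \<in> F" if "v \<in> E" "v \<notin> F" "z \<in> E" "b v z = 0" for v z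
    proof -
      have "h v \<noteq> 0" using hF that by blast
      then have "z \<in> F" using that hF by (simp add: b_def)
      then show ?thesis using Op.subspace_0[OF tsD(1)] by (intro bexI[of _ 0]) auto
    qed
    ultimately have "compatible_form W E F b"
      unfolding compatible_form_def using hact hD(2) by (auto simp: b_def)
    then show ?thesis by blast
  next
    case False
    have max': "max_trivial_spectrum (stabilizer W x F) E (adjoin x F)" by (rule max_good(1)[OF max good])
    have irr': "irreducible_action (stabilizer W x F) E (adjoin x F)"
      unfolding irreducible_action_def
      using False invariant_of_stabilizer_invariant[OF max good h] irr[unfolded irreducible_action_def] by blast
    have "V.dim E - V.dim (adjoin x F) < V.dim E - V.dim F" using dim_codim_adjoin[OF ts x] by simp
    from less.hyps[OF this max' irr'] obtain B where B: "compatible_form (stabilizer W x F) E (adjoin x F) B" by blast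
    interpret form_extension sw sv act \<tau> W E F x h B
      by unfold_locales (fact max good h B irr False)+
    show ?thesis by (rule exists_compatible_form)
  qed
qed

end

section \<open>Representation by block triangular matrices\<close>

lemma sum_lessThan_add: "(\<Sum>i<p + q. f i) = (\<Sum>i<p. f i) + (\<Sum>i<q. f (p + i))" for f :: "nat \<Rightarrow> 'b::comm_monoid_add"
  by (induction q) (auto simp: add.assoc)

lemma GL_I:
  assumes "P \<in> carrier_mat n n" "Q \<in> carrier_mat n n" "P * Q = 1\<^sub>m n" "Q * P = 1\<^sub>m n"
  shows "P \<in> GL n"
  using assms unfolding GL_def invertible_mat_def inverts_mat_def by (auto intro!: exI[of _ Q])

lemma GL_inverse:
  assumes "P \<in> GL n"
  obtains Q where "Q \<in> GL n" "P * Q = 1\<^sub>m n" "Q * P = 1\<^sub>m n"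
proof -
  have P: "P \<in> carrier_mat n n" "invertible_mat P" using assms by (auto simp: GL_def)
  obtain Q where Q: "inverts_mat P Q" "inverts_mat Q P" using P(2) by (auto simp: invertible_mat_def)
  then have PQ: "P * Q = 1\<^sub>m n" and QP: "Q * P = 1\<^sub>m (dim_row Q)" using P by (auto simp: inverts_mat_def)
  have "dim_col (P * Q) = n" "dim_col (Q * P) = dim_row Q" unfolding PQ QP by simp_all
  then have Qc: "Q \<in> carrier_mat n n" using P by auto
  then show ?thesis using that[of Q] GL_I[OF Qc P(1)] PQ QP by auto
qed

lemma GL_iff_det:
  fixes P :: "'a::field mat"
  shows "P \<in> GL n \<longleftrightarrow> P \<in> carrier_mat n n \<and> det P \<noteq> 0"
proof
  assume P: "P \<in> GL n"
  then have Pc: "P \<in> carrier_mat n n" by (simp add: GL_def)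
  obtain Q where Q: "Q \<in> GL n" "P * Q = 1\<^sub>m n" using GL_inverse[OF P] by blast
  then have "Q \<in> carrier_mat n n" by (simp add: GL_def)
  from det_mult[OF Pc this] have "det P * det Q = 1" using Q(2) by simp
  then show "P \<in> carrier_mat n n \<and> det P \<noteq> 0" using Pc by auto
next
  assume P: "P \<in> carrier_mat n n \<and> det P \<noteq> 0"
  then have "P \<in> Units (ring_mat TYPE('a) n ())" by (intro det_non_zero_imp_unit) auto
  then show "P \<in> GL n" unfolding Units_def using GL_I[of P n] by (auto simp: ring_mat_simps)
qed

lemma non_isotropic_GL:
  assumes "non_isotropic n P"
  shows "P \<in> GL n"
proof -
  have P: "P \<in> carrier_mat n n" using assms by (simp add: non_isotropic_def)
  have "det P \<noteq> 0"
  proof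
    assume "det P = 0"
    then obtain v where v: "v \<in> carrier_vec n" "v \<noteq> 0\<^sub>v n" "P *\<^sub>v v = 0\<^sub>v n"
      using det_0_iff_vec_prod_zero_field[OF P] by blast
    then have "v \<bullet> (P *\<^sub>v v) = 0" by simp
    then show False using assms v(1,2) unfolding non_isotropic_def by blast
  qed
  then show ?thesis using P by (simp add: GL_iff_det)
qed

lemma scalar_prod_mult_mat_vec:
  assumes "A \<in> carrier_mat n n" "X \<in> carrier_vec n" "Y \<in> carrier_vec n"
  shows "X \<bullet> (A *\<^sub>v Y) = (\<Sum>i<n. \<Sum>j<n. X $ i * A $$ (i, j) * Y $ j)"
proof -
  have "X \<bullet> (A *\<^sub>v Y) = (\<Sum>i<n. X $ i * (\<Sum>j<n. A $$ (i, j) * Y $ j))"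
    using assms by (auto simp: scalar_prod_def lessThan_atLeast0 intro!: sum.cong)
  then show ?thesis by (simp add: sum_distrib_left mult.assoc)
qed

context bilinear_action begin

definition basis_mod :: "'v set \<Rightarrow> 'v list \<Rightarrow> 'v set \<Rightarrow> bool" where
  "basis_mod F vs E \<longleftrightarrow> set vs \<subseteq> E \<and>
    (\<forall>z\<in>E. \<exists>c. z - (\<Sum>i<length vs. c i *s vs ! i) \<in> F) \<and>
    (\<forall>c. (\<Sum>i<length vs. c i *s vs ! i) \<in> F \<longrightarrow> (\<forall>i<length vs. c i = 0))"

definition represents :: "'v set \<Rightarrow> 'v list \<Rightarrow> 'w \<Rightarrow> 'a mat \<Rightarrow> bool" where
  "represents F vs m A \<longleftrightarrow> A \<in> carrier_mat (length vs) (length vs) \<and>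
    (\<forall>j<length vs. m \<star> (vs ! j) - (\<Sum>i<length vs. A $$ (i, j) *s vs ! i) \<in> F)"

lemma basis_mod_nth: "basis_mod F vs E \<Longrightarrow> i < length vs \<Longrightarrow> vs ! i \<in> E"
  by (auto simp: basis_mod_def)

lemma basis_mod_sum: "basis_mod F vs E \<Longrightarrow> V.subspace E \<Longrightarrow> (\<Sum>i<length vs. c i *s vs ! i) \<in> E"
  by (intro V.subspace_sum V.subspace_scale) (auto simp: basis_mod_def)

lemma basis_mod_append:
  assumes us: "basis_mod F us G" and vs: "basis_mod G vs E"
    and G: "V.subspace G" "F \<subseteq> G" "G \<subseteq> E"
  shows "basis_mod F (us @ vs) E"
  unfolding basis_mod_def
proof (intro conjI ballI allI impI)
  let ?p = "length us" and ?q = "length vs"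
  have split: "(\<Sum>i<length (us @ vs). c i *s (us @ vs) ! i)
      = (\<Sum>i<?p. c i *s us ! i) + (\<Sum>i<?q. c (?p + i) *s vs ! i)" for c
    by (simp add: sum_lessThan_add nth_append)
  show "set (us @ vs) \<subseteq> E" using us vs G by (auto simp: basis_mod_def)
  fix z assume "z \<in> E"
  then obtain c where c: "z - (\<Sum>i<?q. c i *s vs ! i) \<in> G" using vs unfolding basis_mod_def by blast
  then obtain d where d: "z - (\<Sum>i<?q. c i *s vs ! i) - (\<Sum>i<?p. d i *s us ! i) \<in> F"
    using us unfolding basis_mod_def by blast
  let ?e = "\<lambda>i. if i < ?p then d i else c (i - ?p)"
  have eq: "z - (\<Sum>i<length (us @ vs). ?e i *s (us @ vs) ! i)
      = z - (\<Sum>i<?q. c i *s vs ! i) - (\<Sum>i<?p. d i *s us ! i)"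
    unfolding split by (simp add: algebra_simps)
  show "\<exists>c. z - (\<Sum>i<length (us @ vs). c i *s (us @ vs) ! i) \<in> F"
    by (rule exI[of _ ?e]) (unfold eq, rule d)
next
  let ?p = "length us" and ?q = "length vs"
  fix c i assume c: "(\<Sum>i<length (us @ vs). c i *s (us @ vs) ! i) \<in> F" and i: "i < length (us @ vs)"
  have split: "(\<Sum>i<length (us @ vs). c i *s (us @ vs) ! i)
      = (\<Sum>i<?p. c i *s us ! i) + (\<Sum>i<?q. c (?p + i) *s vs ! i)"
    by (simp add: sum_lessThan_add nth_append)
  have s1: "(\<Sum>i<?p. c i *s us ! i) \<in> G" by (rule basis_mod_sum[OF us G(1)])
  have "(\<Sum>i<?p. c i *s us ! i) + (\<Sum>i<?q. c (?p + i) *s vs ! i) \<in> G" using c G(2) unfolding split by blast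
  from V.subspace_diff[OF G(1) this s1] have "(\<Sum>i<?q. c (?p + i) *s vs ! i) \<in> G" by simp
  then have q: "\<forall>i<?q. c (?p + i) = 0"
    using vs unfolding basis_mod_def by (elim conjE) (erule allE[of _ "\<lambda>i. c (?p + i)"], blast)
  then have "(\<Sum>i<?p. c i *s us ! i) \<in> F" using c unfolding split by simp
  then have p: "\<forall>i<?p. c i = 0" using us unfolding basis_mod_def by blast
  show "c i = 0"
  proof (cases "i < ?p")
    case False
    then have "i - ?p < ?q" "?p + (i - ?p) = i" using i by auto
    then show ?thesis using q by metis
  qed (use p in blast)
qed

lemma basis_mod_adjoin:
  assumes "V.subspace F" "x \<notin> F"
  shows "basis_mod F [x] (adjoin x F)"
  unfolding basis_mod_def
proof (intro conjI ballI allI impI)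
  show "set [x] \<subseteq> adjoin x F" using in_adjoin by simp
  fix z assume "z \<in> adjoin x F"
  then obtain k where "z - k *s x \<in> F" by (rule adjoinE[OF assms(1)])
  then show "\<exists>c. z - (\<Sum>i<length [x]. c i *s [x] ! i) \<in> F" by (intro exI[of _ "\<lambda>_. k"]) simp
next
  fix c :: "nat \<Rightarrow> 'a" and i
  assume a: "(\<Sum>i<length [x]. c i *s [x] ! i) \<in> F" and i: "i < length [x]"
  show "c i = 0"
  proof (rule ccontr)
    assume "c i \<noteq> 0"
    then have "c 0 \<noteq> 0" "c 0 *s x \<in> F" using a i by auto
    then show False using assms(2) V.subspace_scale[OF assms(1), of "c 0 *s x" "1 / c 0"] by simp
  qed
qed

lemma exists_basis_mod:
  assumes "V.subspace F" "V.subspace E" "V.fin_dim E" "F \<subseteq> E"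
  shows "\<exists>vs. basis_mod F vs E \<and> length vs = V.dim E - V.dim F"
  using assms
proof (induction "V.dim E - V.dim F" arbitrary: F)
  case 0
  then have "F = E" using V.subspace_eq_if_dim_le[of F E] by simp
  then have "basis_mod F [] E" by (auto simp: basis_mod_def)
  then show ?case using 0 by (intro exI[of _ "[]"]) simp
next
  case (Suc d)
  note p = Suc.prems
  have "F \<noteq> E" using Suc.hyps(2) by auto
  then obtain x where x: "x \<in> E" "x \<notin> F" using p(4) by auto
  have fF: "V.fin_dim F" using V.fin_dim_subset[OF p(3,4)] .
  have xE: "adjoin x F \<subseteq> E" by (rule adjoin_minimal[OF p(2,4) x(1)])
  have d: "d = V.dim E - V.dim (adjoin x F)" using Suc.hyps(2) unfolding dim_adjoin[OF p(1) fF x(2)] by linarith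
  from Suc.hyps(1)[OF d V.subspace_span p(2,3) xE] obtain vs
    where vs: "basis_mod (adjoin x F) vs E" "length vs = d" unfolding d by blast
  have "F \<subseteq> adjoin x F" using in_adjoin(2) by blast
  then have "basis_mod F ([x] @ vs) E"
    by (rule basis_mod_append[OF basis_mod_adjoin[OF p(1) x(2)] vs(1) V.subspace_span _ xE])
  then show ?case using vs(2) Suc.hyps(2) by (intro exI[of _ "[x] @ vs"]) simp
qed

lemma exists_represents:
  assumes vs: "basis_mod F vs E" and m: "\<And>v. v \<in> E \<Longrightarrow> m \<star> v \<in> E"
  shows "\<exists>A. represents F vs m A"
proof -
  let ?n = "length vs"
  have "\<forall>j. \<exists>c. j < ?n \<longrightarrow> m \<star> (vs ! j) - (\<Sum>i<?n. c i *s vs ! i) \<in> F"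
    using vs m basis_mod_nth[OF vs] unfolding basis_mod_def by blast
  then obtain c where c: "\<And>j. j < ?n \<Longrightarrow> m \<star> (vs ! j) - (\<Sum>i<?n. c j i *s vs ! i) \<in> F" by metis
  have "represents F vs m (mat ?n ?n (\<lambda>(i, j). c j i))"
    unfolding represents_def using c by simp
  then show ?thesis by blast
qed

text \<open>For the Gram matrix B of the form and the matrix A of m, the entries of B A are the
  values of b at basis vectors and images of basis vectors, so B A is alternate, and A = P (B A) for
  the inverse P of B. Substituting X = B Y turns the form of P into that of B.\<close>

lemma compatible_form_matrix:
  assumes ts: "trivial_spectrum W E F" and b: "compatible_form W E F b" and vs: "basis_mod F vs E"
  shows "\<exists>P. P \<in> carrier_mat (length vs) (length vs) \<and> non_isotropic (length vs) P \<and>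
    (\<forall>m\<in>W. \<exists>A\<in>(\<lambda>A. P * A) ` alternate_mats (length vs). represents F vs m A)"
proof -
  note tsD = trivial_spectrumD[OF ts]
  let ?n = "length vs"
  have bl: "functional (b v)" "functional (\<lambda>v. b v w)" for v w using b by (auto simp: compatible_form_def)
  note bs = functional_simps[OF bl(1)] functional_simps[OF bl(2)]
  have bF: "b v w = 0" "b w v = 0" if "v \<in> F" "w \<in> E" for v w using b that by (auto simp: compatible_form_def)
  have balt: "b v (m \<star> v) = 0" if "m \<in> W" "v \<in> E" for m v using b that by (auto simp: compatible_form_def)
  have bnz: "b v v \<noteq> 0" if "v \<in> E" "v \<notin> F" for v using b that by (auto simp: compatible_form_def)
  have bsum1: "b (\<Sum>i\<in>I. f i) w = (\<Sum>i\<in>I. b (f i) w)" for I f w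
    using vector_space_pair.linear_sum[OF vector_space_pair_field bl(2)] .
  have bsum2: "b v (\<Sum>i\<in>I. f i) = (\<Sum>i\<in>I. b v (f i))" for I f v
    using vector_space_pair.linear_sum[OF vector_space_pair_field bl(1)] .
  define B where "B = mat ?n ?n (\<lambda>(i, j). b (vs ! i) (vs ! j))"
  define vec_sum where "vec_sum X = (\<Sum>i<?n. X $ i *s vs ! i)" for X
  have Bc: "B \<in> carrier_mat ?n ?n" by (simp add: B_def)
  have vE: "vec_sum X \<in> E" for X unfolding vec_sum_def by (rule basis_mod_sum[OF vs tsD(3)])
  have Bq: "X \<bullet> (B *\<^sub>v X) = b (vec_sum X) (vec_sum X)" if "X \<in> carrier_vec ?n" for X
    unfolding scalar_prod_mult_mat_vec[OF Bc that that] vec_sum_def bsum1 unfolding bsum2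
    by (auto simp: bs B_def sum_distrib_left mult_ac intro!: sum.cong)
  have "non_isotropic ?n B"
    unfolding non_isotropic_def
  proof (intro conjI ballI impI Bc)
    fix X :: "'a vec" assume X: "X \<in> carrier_vec ?n" "X \<noteq> 0\<^sub>v ?n"
    have "vec_sum X \<notin> F"
    proof
      assume "vec_sum X \<in> F"
      then have "\<forall>i<?n. X $ i = 0" using vs unfolding vec_sum_def basis_mod_def by blast
      then have "X = 0\<^sub>v ?n" using X(1) by (intro eq_vecI) auto
      then show False using X(2) by simp
    qed
    then show "X \<bullet> (B *\<^sub>v X) \<noteq> 0" using Bq[OF X(1)] bnz[OF vE] by simp
  qed
  then obtain P where P: "P \<in> GL ?n" "B * P = 1\<^sub>m ?n" "P * B = 1\<^sub>m ?n"
    using non_isotropic_GL GL_inverse by blast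
  then have Pc: "P \<in> carrier_mat ?n ?n" by (simp add: GL_def)
  have "non_isotropic ?n P"
    unfolding non_isotropic_def
  proof (intro conjI ballI impI Pc)
    fix X :: "'a vec" assume X: "X \<in> carrier_vec ?n" "X \<noteq> 0\<^sub>v ?n"
    let ?Y = "P *\<^sub>v X"
    have Y: "?Y \<in> carrier_vec ?n" using Pc X by simp
    have BY: "B *\<^sub>v ?Y = X" using X P Bc Pc by (simp add: assoc_mult_mat_vec[symmetric])
    have "?Y \<noteq> 0\<^sub>v ?n"
    proof
      assume "?Y = 0\<^sub>v ?n"
      then have "X = B *\<^sub>v 0\<^sub>v ?n" using BY by simp
      also have "\<dots> = 0\<^sub>v ?n" using Bc by (intro eq_vecI) auto
      finally show False using X(2) by simp
    qed
    then have "?Y \<bullet> (B *\<^sub>v ?Y) \<noteq> 0" using \<open>non_isotropic ?n B\<close> Y by (simp add: non_isotropic_def)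
    then show "X \<bullet> (P *\<^sub>v X) \<noteq> 0" unfolding BY using X(1) Y by (simp add: comm_scalar_prod[of _ ?n])
  qed
  moreover have "\<exists>A\<in>(\<lambda>A. P * A) ` alternate_mats ?n. represents F vs m A" if m: "m \<in> W" for m
  proof -
    obtain A where A: "represents F vs m A" using exists_represents[OF vs] tsD(7)[OF m] by blast
    then have Ac: "A \<in> carrier_mat ?n ?n" by (simp add: represents_def)
    have BA: "(B * A) $$ (i, j) = b (vs ! i) (m \<star> vs ! j)" if ij: "i < ?n" "j < ?n" for i j
    proof -
      have "b (vs ! i) (m \<star> vs ! j - (\<Sum>k<?n. A $$ (k, j) *s vs ! k)) = 0"
        using A ij basis_mod_nth[OF vs] by (intro bF(2)) (auto simp: represents_def)
      then have "b (vs ! i) (m \<star> vs ! j) = (\<Sum>k<?n. A $$ (k, j) * b (vs ! i) (vs ! k))"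
        by (simp add: bs bsum2)
      also have "\<dots> = (B * A) $$ (i, j)"
        using ij Ac Bc by (auto simp: B_def scalar_prod_def lessThan_atLeast0 mult_ac intro!: sum.cong)
      finally show ?thesis by simp
    qed
    have "B * A \<in> alternate_mats ?n"
      unfolding alternate_mats_def
    proof (intro CollectI conjI ballI)
      show BAc: "B * A \<in> carrier_mat ?n ?n" using Bc Ac by simp
      fix X :: "'a vec" assume X: "X \<in> carrier_vec ?n"
      have "X \<bullet> (B * A *\<^sub>v X) = b (vec_sum X) (m \<star> vec_sum X)"
        unfolding scalar_prod_mult_mat_vec[OF BAc X X] vec_sum_def bsum1 act_sum_right unfolding bsum2
        using BA by (auto simp: bs act_simps sum_distrib_left mult_ac intro!: sum.cong)
      then show "X \<bullet> (B * A *\<^sub>v X) = 0" using balt[OF m vE] by simp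
    qed
    moreover have "A = P * (B * A)" using P Pc Bc Ac by (simp add: assoc_mult_mat[symmetric])
    ultimately show ?thesis using A by (intro bexI[of _ A]) auto
  qed
  ultimately show ?thesis using Pc by blast
qed

lemma represents_append:
  assumes us: "basis_mod F us G" and G: "V.subspace G"
    and A: "represents F us m A" and C: "represents G vs m C"
  shows "\<exists>B\<in>carrier_mat (length us) (length vs).
    represents F (us @ vs) m (four_block_mat A B (0\<^sub>m (length vs) (length us)) C)"
proof -
  let ?p = "length us" and ?q = "length vs"
  have "\<forall>j. \<exists>c. j < ?q \<longrightarrow> m \<star> vs ! j - (\<Sum>i<?q. C $$ (i, j) *s vs ! i) - (\<Sum>i<?p. c i *s us ! i) \<in> F"
    using us C unfolding basis_mod_def represents_def by blast
  then obtain c where c: "\<And>j. j < ?q \<Longrightarrow>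
      m \<star> vs ! j - (\<Sum>i<?q. C $$ (i, j) *s vs ! i) - (\<Sum>i<?p. c j i *s us ! i) \<in> F" by metis
  define B where "B = mat ?p ?q (\<lambda>(i, j). c j i)"
  have Bc: "B \<in> carrier_mat ?p ?q" by (simp add: B_def)
  have Ac: "A \<in> carrier_mat ?p ?p" and Cc: "C \<in> carrier_mat ?q ?q" using A C by (auto simp: represents_def)
  let ?M = "four_block_mat A B (0\<^sub>m ?q ?p) C"
  have Mc: "?M \<in> carrier_mat (?p + ?q) (?p + ?q)" using Ac Cc by simp
  have "m \<star> (us @ vs) ! j - (\<Sum>i<?p + ?q. ?M $$ (i, j) *s (us @ vs) ! i) \<in> F" if j: "j < ?p + ?q" for j
  proof -
    have split: "(\<Sum>i<?p + ?q. ?M $$ (i, j) *s (us @ vs) ! i)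
        = (\<Sum>i<?p. ?M $$ (i, j) *s us ! i) + (\<Sum>i<?q. ?M $$ (?p + i, j) *s vs ! i)"
      by (simp add: sum_lessThan_add nth_append)
    show ?thesis
    proof (cases "j < ?p")
      case True
      then have "(\<Sum>i<?p. ?M $$ (i, j) *s us ! i) = (\<Sum>i<?p. A $$ (i, j) *s us ! i)"
        "(\<Sum>i<?q. ?M $$ (?p + i, j) *s vs ! i) = 0"
        using Ac Cc Bc by (auto intro!: sum.cong sum.neutral)
      then show ?thesis unfolding split using A True by (simp add: represents_def nth_append)
    next
      case False
      then have j': "j - ?p < ?q" using j by linarith
      have "(\<Sum>i<?p. ?M $$ (i, j) *s us ! i) = (\<Sum>i<?p. c (j - ?p) i *s us ! i)"
        "(\<Sum>i<?q. ?M $$ (?p + i, j) *s vs ! i) = (\<Sum>i<?q. C $$ (i, j - ?p) *s vs ! i)"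
        using False j j' Ac Cc Bc by (auto simp: B_def intro!: sum.cong)
      then show ?thesis unfolding split using c[OF j'] False by (simp add: nth_append algebra_simps)
    qed
  qed
  then have "represents F (us @ vs) m ?M" using Mc by (simp add: represents_def)
  then show ?thesis using Bc by blast
qed

end

definition block_model :: "'a::field mat list \<Rightarrow> 'a mat set" where
  "block_model Ps = block_joins (map (\<lambda>P. (\<lambda>A. P * A) ` alternate_mats (dim_row P)) Ps)"

lemma block_model_Nil: "block_model [] = {0\<^sub>m 0 0}"
  by (simp add: block_model_def block_joins_def)

lemma block_model_Cons:
  "block_model (P # Ps) = block_join ((\<lambda>A. P * A) ` alternate_mats (dim_row P)) (block_model Ps)"
  by (simp add: block_model_def block_joins_def)

text \<open>An invariant G of least dimension among those different from F is irreducible and yields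
  the first block; E / G is again maximal and yields the others. This places W inside the block
  model, not yet equal to it.\<close>

lemma (in bilinear_action_3) exists_block_representation:
  assumes "max_trivial_spectrum W E F"
  shows "\<exists>vs Ps. basis_mod F vs E \<and> length vs = V.dim E - V.dim F \<and> length vs = sum_list (map dim_row Ps) \<and>
    (\<forall>P\<in>set Ps. 0 < dim_row P \<and> non_isotropic (dim_row P) P) \<and>
    (\<forall>m\<in>W. \<exists>A\<in>block_model Ps. represents F vs m A)"
  using assms
proof (induction "V.dim E - V.dim F" arbitrary: F rule: less_induct)
  case less
  note max = less.prems
  have ts: "trivial_spectrum W E F" using max by (simp add: max_trivial_spectrum_def)
  note tsD = trivial_spectrumD[OF ts]
  show ?case
  proof (cases "E = F")
    case True
    have "basis_mod F [] E" using True by (auto simp: basis_mod_def)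
    then show ?thesis
      by (intro exI[of _ "[]"]) (auto simp: True block_model_Nil represents_def)
  next
    case False
    define Q where "Q G \<longleftrightarrow> invariant W E F G \<and> G \<noteq> F" for G
    have "Q E" using False tsD by (auto simp: Q_def invariant_def)
    then obtain G where G: "Q G" and min: "\<And>G'. Q G' \<Longrightarrow> V.dim G \<le> V.dim G'"
      using arg_min_natI[of Q E V.dim] arg_min_nat_le[of Q _ V.dim] by blast
    have inv: "invariant W E F G" "G \<noteq> F" using G by (auto simp: Q_def)
    have G': "V.subspace G" "F \<subseteq> G" "G \<subseteq> E" using inv by (auto simp: invariant_def)
    have fG: "V.fin_dim G" using V.fin_dim_subset[OF tsD(4) G'(3)] .
    note maxG = max_invariant[OF max inv(1)]
    have tsG: "trivial_spectrum W G F" using maxG(1) by (simp add: max_trivial_spectrum_def)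
    have "irreducible_action W G F"
      unfolding irreducible_action_def
    proof (intro conjI allI impI)
      fix G1 assume G1: "invariant W G F G1"
      then have "invariant W E F G1" using G'(3) by (auto simp: invariant_def)
      then have "G1 = F \<or> V.dim G \<le> V.dim G1" using min by (auto simp: Q_def)
      moreover have "V.subspace G1" "G1 \<subseteq> G" using G1 by (auto simp: invariant_def)
      ultimately show "G1 = F \<or> G1 = G" using V.subspace_eq_if_dim_le[OF _ G'(1) _ fG] by blast
    qed (rule inv(2))
    then obtain b where b: "compatible_form W G F b" using irreducible_compatible_form[OF maxG(1)] by blast
    obtain us where us: "basis_mod F us G" and lus: "length us = V.dim G - V.dim F" using exists_basis_mod[OF tsD(5) G'(1) fG G'(2)] by blast
    obtain P where P: "P \<in> carrier_mat (length us) (length us)" "non_isotropic (length us) P"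
      "\<And>m. m \<in> W \<Longrightarrow> \<exists>A\<in>(\<lambda>A. P * A) ` alternate_mats (length us). represents F us m A"
      using compatible_form_matrix[OF tsG b us] by blast
    have "us \<noteq> []"
    proof
      assume "us = []"
      then have "G \<subseteq> F" using us by (auto simp: basis_mod_def)
      then show False using inv(2) G'(2) by blast
    qed
    have dFG: "V.dim F < V.dim G"
      using V.subspace_eq_if_dim_le[OF tsD(5) G'(1,2) fG] inv(2) not_less by blast
    have dGE: "V.dim G \<le> V.dim E" using V.dim_subset_fin_dim[OF tsD(4) G'(3)] .
    then have "V.dim E - V.dim G < V.dim E - V.dim F" using dFG by linarith
    from less.hyps[OF this maxG(2)] obtain vs Ps where vs: "basis_mod G vs E" "length vs = sum_list (map dim_row Ps)" and lvs: "length vs = V.dim E - V.dim G"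
      and vs':
      "\<forall>P\<in>set Ps. 0 < dim_row P \<and> non_isotropic (dim_row P) P"
      "\<And>m. m \<in> W \<Longrightarrow> \<exists>A\<in>block_model Ps. represents G vs m A" by blast
    have "\<exists>A\<in>block_model (P # Ps). represents F (us @ vs) m A" if m: "m \<in> W" for m
    proof -
      obtain A where A: "A \<in> (\<lambda>A. P * A) ` alternate_mats (length us)" "represents F us m A" using P(3)[OF m] by blast
      obtain C where C: "C \<in> block_model Ps" "represents G vs m C" using vs'(2)[OF m] by blast
      have dims: "dim_row A = length us" "dim_col A = length us" "dim_row C = length vs" "dim_col C = length vs"
        using A(2) C(2) by (auto simp: represents_def)
      obtain B where B: "B \<in> carrier_mat (length us) (length vs)"
        "represents F (us @ vs) m (four_block_mat A B (0\<^sub>m (length vs) (length us)) C)"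
        using represents_append[OF us G'(1) A(2) C(2)] by blast
      have "four_block_mat A B (0\<^sub>m (length vs) (length us)) C \<in> block_model (P # Ps)"
        unfolding block_model_Cons block_join_def
        using A(1) B(1) C(1) P(1) dims by (intro CollectI exI[of _ A] exI[of _ B] exI[of _ C]) auto
      then show ?thesis using B(2) by blast
    qed
    moreover have "basis_mod F (us @ vs) E" by (rule basis_mod_append[OF us vs(1) G'])
    moreover have "length (us @ vs) = V.dim E - V.dim F" using lus lvs dFG dGE by simp
    ultimately show ?thesis using vs(2) vs'(1) P(1,2) \<open>us \<noteq> []\<close>
      by (intro exI[of _ "us @ vs"] exI[of _ "P # Ps"]) auto
  qed
qed

section \<open>Matrices as functions\<close>

definition vec_scale :: "'a::field \<Rightarrow> (nat \<Rightarrow> 'a) \<Rightarrow> nat \<Rightarrow> 'a" where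
  "vec_scale c v = (\<lambda>i. c * v i)"

definition mat_scale :: "'a::field \<Rightarrow> (nat \<Rightarrow> nat \<Rightarrow> 'a) \<Rightarrow> nat \<Rightarrow> nat \<Rightarrow> 'a" where
  "mat_scale c m = (\<lambda>i j. c * m i j)"

definition mat_act :: "nat \<Rightarrow> (nat \<Rightarrow> nat \<Rightarrow> 'a::field) \<Rightarrow> (nat \<Rightarrow> 'a) \<Rightarrow> nat \<Rightarrow> 'a" where
  "mat_act n m v = (\<lambda>i. \<Sum>j<n. m i j * v j)"

lemma bilinear_action_mat_act: "bilinear_action mat_scale vec_scale (mat_act n)"
  by unfold_locales
    (auto simp: vec_scale_def mat_scale_def mat_act_def fun_eq_iff algebra_simps sum.distrib sum_distrib_left)

definition supported_vecs :: "nat \<Rightarrow> (nat \<Rightarrow> 'a::field) set" where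
  "supported_vecs n = {v. \<forall>i\<ge>n. v i = 0}"

text \<open>Extension by zero embeds the matrices of each size into one type that is itself a vector
  space, as \<open>bilinear_action\<close> requires.\<close>

definition fun_of_mat :: "'a::field mat \<Rightarrow> nat \<Rightarrow> nat \<Rightarrow> 'a" where
  "fun_of_mat A = (\<lambda>i j. if i < dim_row A \<and> j < dim_col A then A $$ (i, j) else 0)"

lemma sum_fun_apply: "(\<Sum>i\<in>I. f i) x = (\<Sum>i\<in>I. f i x)" for f :: "'i \<Rightarrow> 'b \<Rightarrow> 'c::comm_monoid_add"
  by (induction I rule: infinite_finite_induct) auto

lemma supported_vecs_dim:
  assumes "bilinear_action sw (vec_scale :: 'a::field \<Rightarrow> _) act"
  shows "module.subspace vec_scale (supported_vecs n :: (nat \<Rightarrow> 'a) set)"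
    "vector_space.fin_dim vec_scale (supported_vecs n :: (nat \<Rightarrow> 'a) set)"
    "vector_space.dim vec_scale (supported_vecs n :: (nat \<Rightarrow> 'a) set) = n"
proof -
  interpret bilinear_action sw "vec_scale :: 'a \<Rightarrow> _" act by fact
  have sub: "V.subspace (supported_vecs n :: (nat \<Rightarrow> 'a) set)" for n
    unfolding V.subspace_def by (auto simp: supported_vecs_def vec_scale_def)
  then show "V.subspace (supported_vecs n :: (nat \<Rightarrow> 'a) set)" .
  have "V.fin_dim (supported_vecs n :: (nat \<Rightarrow> 'a) set) \<and> V.dim (supported_vecs n :: (nat \<Rightarrow> 'a) set) = n"
  proof (induction n)
    case 0
    have "supported_vecs 0 = {0 :: nat \<Rightarrow> 'a}" by (auto simp: supported_vecs_def fun_eq_iff)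
    then show ?case using V.dim_eq_card_independent[of "{}"] V.dim_span[of "{}"]
      unfolding V.fin_dim_def by (auto intro!: exI[of _ "{}"] simp: V.independent_empty)
  next
    case (Suc n)
    define e :: "nat \<Rightarrow> 'a" where "e = (\<lambda>i. if i = n then 1 else 0)"
    have e: "e \<notin> supported_vecs n" by (auto simp: e_def supported_vecs_def)
    have eq: "adjoin e (supported_vecs n) = supported_vecs (Suc n)"
    proof
      show "adjoin e (supported_vecs n) \<subseteq> supported_vecs (Suc n)"
        by (rule adjoin_minimal[OF sub]) (auto simp: e_def supported_vecs_def)
      show "supported_vecs (Suc n) \<subseteq> adjoin e (supported_vecs n)"
      proof
        fix v :: "nat \<Rightarrow> 'a" assume v: "v \<in> supported_vecs (Suc n)"
        have "v - vec_scale (v n) e \<in> supported_vecs n"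
          unfolding supported_vecs_def
        proof (intro CollectI allI impI)
          fix i assume "n \<le> i"
          then show "(v - vec_scale (v n) e) i = 0"
            using v by (cases "i = n") (auto simp: supported_vecs_def vec_scale_def e_def)
        qed
        then show "v \<in> adjoin e (supported_vecs n)" by (rule adjoinI[OF sub])
      qed
    qed
    have ns: "e \<notin> V.span (supported_vecs n)" using e sub[of n] by (simp add: iffD2[OF V.span_eq_iff])
    show ?case
      using V.dim_insert_fin_dim[OF conjunct1[OF Suc.IH] ns] Suc.IH unfolding eq by simp
  qed
  then show "V.fin_dim (supported_vecs n :: (nat \<Rightarrow> 'a) set)" "V.dim (supported_vecs n :: (nat \<Rightarrow> 'a) set) = n"
    by blast+
qed

lemma fun_of_mat_inj:
  assumes "A \<in> carrier_mat n n" "B \<in> carrier_mat n n" "fun_of_mat A = fun_of_mat B"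
  shows "A = B"
proof (rule eq_matI)
  fix i j assume "i < dim_row B" "j < dim_col B"
  then show "A $$ (i, j) = B $$ (i, j)"
    using fun_cong[OF fun_cong[OF assms(3)], of i j] assms(1,2) by (auto simp: fun_of_mat_def)
qed (use assms in auto)

lemma fun_of_mat_ops:
  assumes "A \<in> carrier_mat n n"
  shows "B \<in> carrier_mat n n \<Longrightarrow> fun_of_mat (A + B) = fun_of_mat A + fun_of_mat B"
    "fun_of_mat (c \<cdot>\<^sub>m A) = mat_scale c (fun_of_mat A)"
    "fun_of_mat (0\<^sub>m n n) = 0"
  using assms by (auto simp: fun_of_mat_def mat_scale_def fun_eq_iff)

lemma fun_of_mat_act:
  assumes "A \<in> carrier_mat n n"
  shows "mat_act n (fun_of_mat A) v \<in> supported_vecs n"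
    "vec n (mat_act n (fun_of_mat A) v) = A *\<^sub>v vec n v"
  using assms
  by (auto simp: mat_act_def fun_of_mat_def supported_vecs_def scalar_prod_def lessThan_atLeast0 intro!: sum.cong)

lemma subspace_fun_of_mat:
  assumes "W \<subseteq> carrier_mat n n" "0\<^sub>m n n \<in> W" "\<And>A B. A \<in> W \<Longrightarrow> B \<in> W \<Longrightarrow> A + B \<in> W"
    "\<And>c A. A \<in> W \<Longrightarrow> c \<cdot>\<^sub>m A \<in> W"
  shows "module.subspace mat_scale (fun_of_mat ` W)" "vector_space.fin_dim mat_scale (fun_of_mat ` W)"
proof -
  interpret bilinear_action mat_scale vec_scale "mat_act n" by (rule bilinear_action_mat_act)
  show "Op.subspace (fun_of_mat ` W)"
    unfolding Op.subspace_def
  proof (intro conjI ballI allI)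
    show "0 \<in> fun_of_mat ` W" using assms(2) fun_of_mat_ops(3)[of "0\<^sub>m n n" n] by force
    fix x assume x: "x \<in> fun_of_mat ` W"
    show "x + y \<in> fun_of_mat ` W" if "y \<in> fun_of_mat ` W" for y
    proof -
      obtain A B where "A \<in> W" "B \<in> W" "x = fun_of_mat A" "y = fun_of_mat B" using x \<open>y \<in> fun_of_mat ` W\<close> by blast
      moreover from this have "A \<in> carrier_mat n n" "B \<in> carrier_mat n n" using assms(1) by blast+
      ultimately show ?thesis using assms(3) by (intro image_eqI[of _ _ "A + B"]) (auto simp: fun_of_mat_ops(1))
    qed
    show "mat_scale c x \<in> fun_of_mat ` W" for c
    proof -
      obtain A where "A \<in> W" "x = fun_of_mat A" using x by blast
      moreover from this have "A \<in> carrier_mat n n" using assms(1) by blast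
      ultimately show ?thesis using assms(4) by (intro image_eqI[of _ _ "c \<cdot>\<^sub>m A"]) (auto simp: fun_of_mat_ops(2))
    qed
  qed
  define unit :: "nat \<times> nat \<Rightarrow> nat \<Rightarrow> nat \<Rightarrow> 'a" where "unit p = (\<lambda>i j. if i = fst p \<and> j = snd p then 1 else 0)" for p
  let ?U = "unit ` ({..<n} \<times> {..<n})"
  have "fun_of_mat A \<in> Op.span ?U" if "A \<in> W" for A
  proof -
    have A: "A \<in> carrier_mat n n" using that assms(1) by blast
    have "fun_of_mat A = (\<Sum>p\<in>{..<n} \<times> {..<n}. mat_scale (fun_of_mat A (fst p) (snd p)) (unit p))"
    proof (intro ext)
      fix i j
      have "(\<Sum>p\<in>{..<n} \<times> {..<n}. mat_scale (fun_of_mat A (fst p) (snd p)) (unit p)) i j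
          = (\<Sum>p\<in>{..<n} \<times> {..<n}. if p = (i, j) then fun_of_mat A i j else 0)"
        unfolding sum_fun_apply by (rule sum.cong) (auto simp: mat_scale_def unit_def)
      also have "\<dots> = (if i < n \<and> j < n then fun_of_mat A i j else 0)" by (simp add: sum.delta)
      also have "\<dots> = fun_of_mat A i j" using A by (auto simp: fun_of_mat_def)
      finally show "fun_of_mat A i j =
        (\<Sum>p\<in>{..<n} \<times> {..<n}. mat_scale (fun_of_mat A (fst p) (snd p)) (unit p)) i j" by simp
    qed
    also have "\<dots> \<in> Op.span ?U" by (intro Op.span_sum Op.span_scale Op.span_base) auto
    finally show ?thesis .
  qed
  then show "Op.fin_dim (fun_of_mat ` W)"
    unfolding Op.fin_dim_def by (intro exI[of _ ?U]) auto
qed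

lemma linear_subspace_of_dimD:
  assumes "linear_subspace_of_dim n d (W :: 'a::field mat set)"
  shows "W \<subseteq> carrier_mat n n" "0\<^sub>m n n \<in> W" "\<And>A B. A \<in> W \<Longrightarrow> B \<in> W \<Longrightarrow> A + B \<in> W"
    "\<And>c A. A \<in> W \<Longrightarrow> c \<cdot>\<^sub>m A \<in> W"
proof -
  have "submodule class_ring W (module_mat TYPE('a) n n)"
    using assms by (auto simp: linear_subspace_of_dim_def subspace_def)
  then show "W \<subseteq> carrier_mat n n" "0\<^sub>m n n \<in> W" "\<And>A B. A \<in> W \<Longrightarrow> B \<in> W \<Longrightarrow> A + B \<in> W"
    "\<And>c A. A \<in> W \<Longrightarrow> c \<cdot>\<^sub>m A \<in> W"
    unfolding submodule_def by (auto simp: module_mat_simps)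
qed

text \<open>Two notions of dimension meet: the least cardinality of a finite spanning set on the
  left-hand structure of matrices, the cardinality of a basis for functions. A basis pulled back
  along the injective \<open>fun_of_mat\<close> spans W, and every finite spanning set of W is
  mapped to a spanning set.\<close>

lemma dim_fun_of_mat:
  assumes "linear_subspace_of_dim n d (W :: 'a::field mat set)"
  shows "vector_space.dim mat_scale (fun_of_mat ` W) = d"
proof -
  note Wc = linear_subspace_of_dimD[OF assms]
  interpret bilinear_action mat_scale vec_scale "mat_act n :: (nat \<Rightarrow> nat \<Rightarrow> 'a) \<Rightarrow> _" by (rule bilinear_action_mat_act)
  note sf = subspace_fun_of_mat[OF Wc]
  let ?M = "module_mat TYPE('a) n n"
  let ?W = "?M\<lparr>carrier := W\<rparr>"
  have "vectorspace class_ring ?W"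
    by (rule vectorspace.subspace_is_vs[OF matrix_vs]) (use assms in \<open>simp add: linear_subspace_of_dim_def\<close>)
  then interpret M: vectorspace "class_ring :: 'a ring" ?W .
  have lincomb: "fun_of_mat (M.lincomb a A) = (\<Sum>v\<in>A. mat_scale (a v) (fun_of_mat v)) \<and> M.lincomb a A \<in> W"
    if "finite A" "A \<subseteq> W" for a A
    using that
  proof (induction A rule: finite_induct)
    case empty
    show ?case unfolding M.lincomb_def
      using Wc(2) by (auto simp: module_mat_simps fun_of_mat_def fun_eq_iff)
  next
    case (insert v A)
    have "M.lincomb a (insert v A) = a v \<cdot>\<^sub>m v + M.lincomb a A"
      unfolding M.lincomb_def using insert Wc(4)
      by (subst M.finsum_insert) (auto simp: module_mat_simps)
    moreover have "v \<in> carrier_mat n n" "M.lincomb a A \<in> carrier_mat n n" "M.lincomb a A \<in> W" "v \<in> W"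
      using insert Wc(1) by auto
    ultimately show ?case
      using insert Wc(3,4) fun_of_mat_ops(1)[of "a v \<cdot>\<^sub>m v" n "M.lincomb a A"] fun_of_mat_ops(2)[of v n "a v"] by simp
  qed
  have span: "M.span A = {M.lincomb a A | a. True}" if "finite A" "A \<subseteq> W" for A
    using M.finite_span[of A] that by (auto simp: class_ring_simps)
  have "M.dim = Op.dim (fun_of_mat ` W)"
    unfolding M.dim_def
  proof (rule Least_equality)
    obtain B where B: "B \<subseteq> fun_of_mat ` W" "Op.independent B" "fun_of_mat ` W \<subseteq> Op.span B"
      "card B = Op.dim (fun_of_mat ` W)" by (rule Op.basis_exists)
    have finB: "finite B" using Op.fin_dim_finite_independent[OF sf(2) B(2,1)] .
    define A where "A = {M \<in> W. fun_of_mat M \<in> B}"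
    have inj: "inj_on fun_of_mat A" using fun_of_mat_inj Wc(1) by (auto simp: A_def inj_on_def)
    have im: "fun_of_mat ` A = B" using B(1) by (auto simp: A_def)
    have finA: "finite A" using finB im inj finite_imageD by metis
    have "card A = Op.dim (fun_of_mat ` W)" using card_image[OF inj] im B(4) by simp
    moreover have AW: "A \<subseteq> W" by (auto simp: A_def)
    moreover have "M.span A = W"
    proof
      show "M.span A \<subseteq> W" unfolding span[OF finA AW] using lincomb[OF finA AW] by auto
      show "W \<subseteq> M.span A"
      proof
        fix M assume M: "M \<in> W"
        then have "fun_of_mat M \<in> Op.span B" using B(3) by auto
        then obtain u where u: "fun_of_mat M = (\<Sum>b\<in>B. mat_scale (u b) b)" unfolding Op.span_finite[OF finB] by auto
        have "fun_of_mat M = (\<Sum>v\<in>A. mat_scale (u (fun_of_mat v)) (fun_of_mat v))"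
          unfolding u im[symmetric] by (rule sum.reindex_cong[OF inj]) auto
        then have "fun_of_mat M = fun_of_mat (M.lincomb (\<lambda>v. u (fun_of_mat v)) A)" using lincomb[OF finA AW] by simp
        then have "M = M.lincomb (\<lambda>v. u (fun_of_mat v)) A"
          using fun_of_mat_inj[of M n] M Wc(1) lincomb[OF finA AW] by blast
        then show "M \<in> M.span A" unfolding span[OF finA AW] by auto
      qed
    qed
    ultimately show "\<exists>A. finite A \<and> card A = Op.dim (fun_of_mat ` W) \<and> A \<subseteq> carrier ?W \<and> M.span A = carrier ?W"
      using finA by (intro exI[of _ A]) simp
  next
    fix k assume "\<exists>A. finite A \<and> card A = k \<and> A \<subseteq> carrier ?W \<and> M.span A = carrier ?W"
    then obtain A where A: "finite A" "card A = k" "A \<subseteq> W" "M.span A = W" by auto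
    have "fun_of_mat ` W \<subseteq> Op.span (fun_of_mat ` A)"
    proof
      fix m assume "m \<in> fun_of_mat ` W"
      then obtain x where x: "m = fun_of_mat x" "x \<in> M.span A" using A(4) by blast
      then obtain a where "m = fun_of_mat (M.lincomb a A)" unfolding span[OF A(1,3)] by blast
      then have "m = (\<Sum>v\<in>A. mat_scale (a v) (fun_of_mat v))" using lincomb[OF A(1,3)] by simp
      also have "\<dots> \<in> Op.span (fun_of_mat ` A)" by (intro Op.span_sum Op.span_scale Op.span_base) auto
      finally show "m \<in> Op.span (fun_of_mat ` A)" .
    qed
    then have "Op.dim (fun_of_mat ` W) \<le> card (fun_of_mat ` A)" using A(1) by (intro Op.dim_le_card) auto
    also have "\<dots> \<le> k" using card_image_le[OF A(1)] A(2) by blast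
    finally show "Op.dim (fun_of_mat ` W) \<le> k" .
  qed
  then show ?thesis using assms by (simp add: linear_subspace_of_dim_def)
qed

section \<open>Classification up to similarity\<close>

lemma smult_mat_mult_vec:
  fixes A :: "'a::field mat"
  assumes "A \<in> carrier_mat n m" "v \<in> carrier_vec m"
  shows "(c \<cdot>\<^sub>m A) *\<^sub>v v = c \<cdot>\<^sub>v (A *\<^sub>v v)"
  using assms by (intro eq_vecI) (auto simp: scalar_prod_def sum_distrib_left mult.assoc)

section \<open>Linear spaces of alternate and of block triangular matrices\<close>

lemma alternate_mats_closed:
  fixes A :: "'a::field mat"
  shows "0\<^sub>m n n \<in> (alternate_mats n :: 'a mat set)"
  "A \<in> alternate_mats n \<Longrightarrow> B \<in> alternate_mats n \<Longrightarrow> A + B \<in> alternate_mats n"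
  "A \<in> alternate_mats n \<Longrightarrow> c \<cdot>\<^sub>m A \<in> alternate_mats n"
proof -
  have "0\<^sub>m n n *\<^sub>v X = 0\<^sub>v n" if "X \<in> carrier_vec n" for X :: "'a vec"
    using that by (intro eq_vecI) auto
  then show "0\<^sub>m n n \<in> (alternate_mats n :: 'a mat set)" by (simp add: alternate_mats_def)
qed (auto simp: alternate_mats_def add_mult_distrib_mat_vec[of _ n n] scalar_prod_add_distrib[of _ n]
    smult_mat_mult_vec[of _ n n])

lemma alternate_matsD: "A \<in> alternate_mats n \<Longrightarrow> A \<in> carrier_mat n n"
  by (simp add: alternate_mats_def)

lemma block_joinE:
  assumes "M \<in> block_join V W"
  obtains A B C where "M = four_block_mat A B (0\<^sub>m (dim_row C) (dim_col A)) C"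
    "A \<in> V" "B \<in> carrier_mat (dim_row A) (dim_col C)" "C \<in> W"
  using assms unfolding block_join_def by blast

lemma block_joinI:
  assumes "A \<in> V" "C \<in> W" "A \<in> carrier_mat p p" "C \<in> carrier_mat q q" "B \<in> carrier_mat p q"
  shows "four_block_mat A B (0\<^sub>m q p) C \<in> block_join V W"
  unfolding block_join_def
  using assms by (intro CollectI exI[of _ A] exI[of _ B] exI[of _ C]) auto

definition matrix_subspace :: "nat \<Rightarrow> 'a::field mat set \<Rightarrow> bool" where
  "matrix_subspace n W \<longleftrightarrow> W \<subseteq> carrier_mat n n \<and> 0\<^sub>m n n \<in> W \<and>
    (\<forall>A\<in>W. \<forall>B\<in>W. A + B \<in> W) \<and> (\<forall>c. \<forall>A\<in>W. c \<cdot>\<^sub>m A \<in> W)"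

lemma matrix_subspaceD:
  assumes "matrix_subspace n W"
  shows "W \<subseteq> carrier_mat n n" "0\<^sub>m n n \<in> W" "\<And>A B. A \<in> W \<Longrightarrow> B \<in> W \<Longrightarrow> A + B \<in> W"
    "\<And>c A. A \<in> W \<Longrightarrow> c \<cdot>\<^sub>m A \<in> W"
  using assms unfolding matrix_subspace_def by blast+

lemma matrix_subspace_block_join:
  assumes V: "matrix_subspace p V" and W: "matrix_subspace q W"
  shows "matrix_subspace (p + q) (block_join V W)"
  unfolding matrix_subspace_def
proof (intro conjI ballI allI subsetI)
  note VD = matrix_subspaceD[OF V] and WD = matrix_subspaceD[OF W]
  have el: "\<exists>A B C. M = four_block_mat A B (0\<^sub>m q p) C \<and> A \<in> V \<and> B \<in> carrier_mat p q \<and> C \<in> W \<and>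
      A \<in> carrier_mat p p \<and> C \<in> carrier_mat q q" if M: "M \<in> block_join V W" for M
  proof -
    obtain A B C where *: "M = four_block_mat A B (0\<^sub>m (dim_row C) (dim_col A)) C"
      "A \<in> V" "B \<in> carrier_mat (dim_row A) (dim_col C)" "C \<in> W" by (rule block_joinE[OF M])
    moreover have "A \<in> carrier_mat p p" "C \<in> carrier_mat q q" using * VD(1) WD(1) by auto
    ultimately show ?thesis by (intro exI[of _ A] exI[of _ B] exI[of _ C]) auto
  qed
  show "0\<^sub>m (p + q) (p + q) \<in> block_join V W"
  proof -
    have "four_block_mat (0\<^sub>m p p) (0\<^sub>m p q) (0\<^sub>m q p) (0\<^sub>m q q) \<in> block_join V W"
      using VD(2) WD(2) by (intro block_joinI) auto
    moreover have "four_block_mat (0\<^sub>m p p) (0\<^sub>m p q) (0\<^sub>m q p) (0\<^sub>m q q) = (0\<^sub>m (p + q) (p + q) :: 'a mat)"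
      by (intro eq_matI) auto
    ultimately show ?thesis by simp
  qed
  fix M assume M: "M \<in> block_join V W"
  obtain A B C where M': "M = four_block_mat A B (0\<^sub>m q p) C" "A \<in> V" "B \<in> carrier_mat p q" "C \<in> W"
      "A \<in> carrier_mat p p" "C \<in> carrier_mat q q" using el[OF M] by blast
  show "M \<in> carrier_mat (p + q) (p + q)" using M' by simp
  show "c \<cdot>\<^sub>m M \<in> block_join V W" for c
  proof -
    have "c \<cdot>\<^sub>m M = four_block_mat (c \<cdot>\<^sub>m A) (c \<cdot>\<^sub>m B) (0\<^sub>m q p) (c \<cdot>\<^sub>m C)"
      unfolding M'(1) using M' by (subst smult_four_block_mat[of _ p p _ q _ q]) auto
    also have "\<dots> \<in> block_join V W" using M' VD(4) WD(4) by (intro block_joinI) auto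
    finally show ?thesis .
  qed
  fix N assume N: "N \<in> block_join V W"
  obtain A1 B1 C1 where N': "N = four_block_mat A1 B1 (0\<^sub>m q p) C1" "A1 \<in> V" "B1 \<in> carrier_mat p q" "C1 \<in> W"
      "A1 \<in> carrier_mat p p" "C1 \<in> carrier_mat q q" using el[OF N] by blast
  have "M + N = four_block_mat (A + A1) (B + B1) (0\<^sub>m q p) (C + C1)"
    unfolding M'(1) N'(1) using M' N' by (subst add_four_block_mat[of _ p p _ q _ q]) auto
  also have "\<dots> \<in> block_join V W" using M' N' VD(3) WD(3) by (intro block_joinI) auto
  finally show "M + N \<in> block_join V W" .
qed

lemma matrix_subspace_mult_alternate:
  assumes "P \<in> carrier_mat n n"
  shows "matrix_subspace n ((\<lambda>A. P * A) ` alternate_mats n)"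
  unfolding matrix_subspace_def
proof (intro conjI ballI allI subsetI)
  note ac = alternate_matsD
  show "0\<^sub>m n n \<in> (\<lambda>A. P * A) ` alternate_mats n"
    using alternate_mats_closed(1) assms by (intro image_eqI[of _ _ "0\<^sub>m n n"]) auto
  fix M assume "M \<in> (\<lambda>A. P * A) ` alternate_mats n"
  then obtain A where A: "M = P * A" "A \<in> alternate_mats n" by blast
  show "M \<in> carrier_mat n n" using A ac[OF A(2)] assms by simp
  show "c \<cdot>\<^sub>m M \<in> (\<lambda>A. P * A) ` alternate_mats n" for c
    using A ac[OF A(2)] assms alternate_mats_closed(3)[OF A(2)]
    by (intro image_eqI[of _ _ "c \<cdot>\<^sub>m A"]) (auto simp: mult_smult_distrib[of _ n n])
  fix N assume "N \<in> (\<lambda>A. P * A) ` alternate_mats n"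
  then obtain B where B: "N = P * B" "B \<in> alternate_mats n" by blast
  show "M + N \<in> (\<lambda>A. P * A) ` alternate_mats n"
    using A B ac[OF A(2)] ac[OF B(2)] assms alternate_mats_closed(2)[OF A(2) B(2)]
    by (intro image_eqI[of _ _ "A + B"]) (auto simp: mult_add_distrib_mat[of _ n n])
qed

lemma matrix_subspace_block_model:
  assumes "\<forall>P\<in>set Ps. P \<in> carrier_mat (dim_row P) (dim_row P)"
  shows "matrix_subspace (sum_list (map dim_row Ps)) (block_model Ps)"
  using assms
proof (induction Ps)
  case Nil
  have "0\<^sub>m 0 0 + 0\<^sub>m 0 0 = (0\<^sub>m 0 0 :: 'a mat)" "c \<cdot>\<^sub>m 0\<^sub>m 0 0 = (0\<^sub>m 0 0 :: 'a mat)" for c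
    by (auto intro!: eq_matI)
  then show ?case by (auto simp: block_model_Nil matrix_subspace_def)
next
  case (Cons P Ps)
  then show ?case
    using matrix_subspace_block_join[OF matrix_subspace_mult_alternate] by (auto simp: block_model_Cons)
qed

lemma model_space_eq: "model_space n Ps = (\<lambda>M. 1\<^sub>m n + M) ` block_model Ps"
  by (simp add: model_space_def block_model_def)

lemma one_plus_block:
  fixes A :: "'a::field mat"
  assumes "A \<in> carrier_mat p p" "B \<in> carrier_mat p q" "C \<in> carrier_mat q q"
  shows "1\<^sub>m (p + q) + four_block_mat A B (0\<^sub>m q p) C = four_block_mat (1\<^sub>m p + A) B (0\<^sub>m q p) (1\<^sub>m q + C)"
  using assms by (intro eq_matI) auto

text \<open>If v + P u = 0 with u = A v, then u is orthogonal to v because A is alternate, so the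
  form of P vanishes at u. Non-isotropy gives u = 0 and then v = 0.\<close>

lemma one_plus_mult_alternate_GL:
  assumes P: "non_isotropic n P" and A: "A \<in> alternate_mats n"
  shows "1\<^sub>m n + P * A \<in> GL n"
proof -
  have Pc: "P \<in> carrier_mat n n" using P by (simp add: non_isotropic_def)
  note Ac = alternate_matsD[OF A]
  have c: "1\<^sub>m n + P * A \<in> carrier_mat n n" using Pc Ac by simp
  have "det (1\<^sub>m n + P * A) \<noteq> 0"
  proof
    assume "det (1\<^sub>m n + P * A) = 0"
    then obtain v where v: "v \<in> carrier_vec n" "v \<noteq> 0\<^sub>v n" "(1\<^sub>m n + P * A) *\<^sub>v v = 0\<^sub>v n"
      using det_0_iff_vec_prod_zero_field[OF c] by blast
    define u where "u = A *\<^sub>v v"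
    have u: "u \<in> carrier_vec n" using Ac v by (simp add: u_def)
    have sum0: "v + P *\<^sub>v u = 0\<^sub>v n"
      using v Pc Ac by (simp add: u_def add_mult_distrib_mat_vec[of _ n n] assoc_mult_mat_vec[of _ n n _ n])
    have "u \<bullet> (v + P *\<^sub>v u) = u \<bullet> v + u \<bullet> (P *\<^sub>v u)"
      using u v Pc by (intro scalar_prod_add_distrib) auto
    moreover have "u \<bullet> v = v \<bullet> u" using u v by (intro comm_scalar_prod) auto
    moreover have "v \<bullet> u = 0" using A v by (simp add: u_def alternate_mats_def)
    ultimately have "u \<bullet> (P *\<^sub>v u) = 0" using sum0 u by simp
    then have "u = 0\<^sub>v n" using P u unfolding non_isotropic_def by blast
    then have "P *\<^sub>v u = 0\<^sub>v n" using Pc by (intro eq_vecI) auto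
    then have "v = 0\<^sub>v n" using sum0 v by simp
    then show False using v(2) by simp
  qed
  then show ?thesis using c by (simp add: GL_iff_det)
qed

lemma model_space_GL:
  assumes "\<forall>P\<in>set Ps. non_isotropic (dim_row P) P"
  shows "model_space (sum_list (map dim_row Ps)) Ps \<subseteq> GL (sum_list (map dim_row Ps))"
  using assms
proof (induction Ps)
  case Nil
  show ?case by (auto simp: model_space_eq block_model_Nil GL_iff_det)
next
  case (Cons P Ps)
  let ?p = "dim_row P" and ?q = "sum_list (map dim_row Ps)"
  have Pc: "P \<in> carrier_mat ?p ?p" using Cons.prems by (simp add: non_isotropic_def)
  have ms: "matrix_subspace ?q (block_model Ps)"
    using Cons.prems by (intro matrix_subspace_block_model) (auto simp: non_isotropic_def)
  show ?case
  proof
    fix N assume "N \<in> model_space (sum_list (map dim_row (P # Ps))) (P # Ps)"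
    then obtain M where M: "M \<in> block_model (P # Ps)" "N = 1\<^sub>m (?p + ?q) + M" by (auto simp: model_space_eq)
    obtain A B C where *: "M = four_block_mat A B (0\<^sub>m (dim_row C) (dim_col A)) C"
      "A \<in> (\<lambda>A. P * A) ` alternate_mats ?p" "B \<in> carrier_mat (dim_row A) (dim_col C)" "C \<in> block_model Ps"
      by (rule block_joinE[OF M(1)[unfolded block_model_Cons]])
    have Cc: "C \<in> carrier_mat ?q ?q" using matrix_subspaceD(1)[OF ms] *(4) by auto
    have Ac: "A \<in> carrier_mat ?p ?p" using *(2) matrix_subspaceD(1)[OF matrix_subspace_mult_alternate[OF Pc]] by blast
    have Bc: "B \<in> carrier_mat ?p ?q" using *(3) Ac Cc by auto
    have N: "N = four_block_mat (1\<^sub>m ?p + A) B (0\<^sub>m ?q ?p) (1\<^sub>m ?q + C)"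
      using M(2) *(1) Ac Cc one_plus_block[OF Ac Bc Cc] by auto
    have A1: "det (1\<^sub>m ?p + A) \<noteq> 0"
      using *(2) Cons.prems one_plus_mult_alternate_GL[of ?p P] by (auto simp: GL_iff_det)
    have C1: "det (1\<^sub>m ?q + C) \<noteq> 0" using Cons *(4) by (auto simp: model_space_eq GL_iff_det)
    have "det N = det (1\<^sub>m ?p + A) * det (1\<^sub>m ?q + C)"
      unfolding N using Ac Bc Cc by (intro det_four_block_mat_lower_left_zero[of _ ?p _ ?q]) auto
    moreover have "N \<in> carrier_mat (?p + ?q) (?p + ?q)" unfolding N using Ac Cc by simp
    ultimately show "N \<in> GL (sum_list (map dim_row (P # Ps)))" using A1 C1 by (simp add: GL_iff_det)
  qed
qed

section \<open>Transfer of matrix spaces to spaces of operators\<close>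

lemma supported_vecs_eqI:
  assumes "u \<in> supported_vecs n" "v \<in> supported_vecs n" "vec n u = vec n v"
  shows "u = v"
proof
  fix i show "u i = v i"
    using assms(1,2) arg_cong[OF assms(3), of "\<lambda>w. w $ i"] by (cases "i < n") (auto simp: supported_vecs_def)
qed

text \<open>A matrix is determined by its action on all vectors, so the annihilator is zero and
  disappears from the dimension formulas.\<close>

lemma trivial_spectrum_fun_of_mat:
  assumes W: "matrix_subspace n W"
    and nofix: "\<forall>M\<in>W. \<forall>v\<in>carrier_vec n. M *\<^sub>v v = v \<longrightarrow> v = 0\<^sub>v n"
  shows "bilinear_action.trivial_spectrum mat_scale vec_scale (mat_act n) (fun_of_mat ` W) (supported_vecs n) {0}"
    "bilinear_action.annihilator (mat_act n) (fun_of_mat ` W) (supported_vecs n) {0} = {0}"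
proof -
  interpret bilinear_action mat_scale vec_scale "mat_act n" by (rule bilinear_action_mat_act)
  note WD = matrix_subspaceD[OF W]
  note sf = subspace_fun_of_mat[OF WD]
  note sv = supported_vecs_dim[OF bilinear_action_axioms, of n]
  have zero_supp: "0 \<in> supported_vecs n" by (simp add: supported_vecs_def)
  have "v = 0" if M: "M \<in> W" and v: "v \<in> supported_vecs n" and e: "v - mat_act n (fun_of_mat M) v = 0" for M v
  proof -
    have Mc: "M \<in> carrier_mat n n" using M WD(1) by blast
    have "mat_act n (fun_of_mat M) v = v" using e by simp
    then have "M *\<^sub>v vec n v = vec n v" using fun_of_mat_act(2)[OF Mc, of v] by simp
    then have "vec n v = 0\<^sub>v n" using nofix M by simp
    also have "0\<^sub>v n = vec n (0 :: nat \<Rightarrow> 'a)" by (intro eq_vecI) auto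
    finally show "v = 0" using supported_vecs_eqI[OF v zero_supp] by blast
  qed
  moreover have "mat_act n (fun_of_mat M) v \<in> supported_vecs n" if "M \<in> W" for M v
    using fun_of_mat_act(1) WD(1) that by blast
  ultimately show "trivial_spectrum (fun_of_mat ` W) (supported_vecs n) {0}"
    unfolding trivial_spectrum_def using sf sv zero_supp by auto
  have ann0: "fun_of_mat M = 0" if M: "M \<in> W" and a: "\<forall>v\<in>supported_vecs n. mat_act n (fun_of_mat M) v = 0" for M
  proof (intro ext)
    fix i j
    show "fun_of_mat M i j = 0 i j"
    proof (cases "j < n")
      case True
      let ?e = "\<lambda>k. if k = j then 1 else 0 :: 'a"
      have "?e \<in> supported_vecs n" using True by (auto simp: supported_vecs_def)
      then have "mat_act n (fun_of_mat M) ?e i = 0" using a by simp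
      moreover have "mat_act n (fun_of_mat M) ?e i = fun_of_mat M i j"
        using True by (simp add: mat_act_def if_distrib cong: if_cong)
      ultimately show ?thesis by simp
    next
      case False
      then show ?thesis using M WD(1) by (auto simp: fun_of_mat_def)
    qed
  qed
  moreover have "0 \<in> fun_of_mat ` W" using sf(1) Op.subspace_0 by blast
  ultimately show "annihilator (fun_of_mat ` W) (supported_vecs n) {0} = {0}"
    unfolding annihilator_def by auto
qed

text \<open>W is contained in a conjugate of the block model. The conjugate has trivial spectrum
  too, since the model space consists of invertible matrices; its dimension is therefore at most
  \<open>n choose 2\<close>, the dimension of W, and both coincide.\<close>

lemma trivial_spectrum_classification:
  fixes W :: "'a::field mat set"
  assumes tau: "\<tau> \<noteq> (0::'a)" "\<tau> \<noteq> 1" and mW: "matrix_subspace n W"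
    and dimW: "vector_space.dim mat_scale (fun_of_mat ` W) = n choose 2"
    and nofix: "\<forall>M\<in>W. \<forall>v\<in>carrier_vec n. M *\<^sub>v v = v \<longrightarrow> v = 0\<^sub>v n"
  shows "\<exists>Ps G H. (\<forall>P\<in>set Ps. 0 < dim_row P \<and> non_isotropic (dim_row P) P) \<and> n = sum_list (map dim_row Ps) \<and>
    G \<in> GL n \<and> H \<in> GL n \<and> G * H = 1\<^sub>m n \<and> H * G = 1\<^sub>m n \<and> W = (\<lambda>A. G * A * H) ` block_model Ps"
proof -
  interpret bilinear_action_3 mat_scale vec_scale "mat_act n" \<tau>
    using bilinear_action_mat_act tau by (auto simp: bilinear_action_3_def bilinear_action_3_axioms_def)
  note WD = matrix_subspaceD[OF mW]
  note ts = trivial_spectrum_fun_of_mat[OF mW nofix]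
  let ?W = "fun_of_mat ` W" and ?E = "supported_vecs n :: (nat \<Rightarrow> 'a) set"
  note sv = supported_vecs_dim[OF bilinear_action_axioms, of n]
  have dim0: "V.dim {0} = 0" "Op.dim {0} = 0"
    using V.dim_span[of "{}"] V.dim_eq_card_independent[of "{}"] Op.dim_span[of "{}"] Op.dim_eq_card_independent[of "{}"]
    by (simp_all add: V.independent_empty Op.independent_empty)
  have "max_trivial_spectrum ?W ?E {0}"
    unfolding max_trivial_spectrum_def ts(2) using ts(1) dimW dim0 sv(3) by simp
  from exists_block_representation[OF this] obtain vs Ps where
    vs: "basis_mod {0} vs ?E" "length vs = V.dim ?E - V.dim {0}" "length vs = sum_list (map dim_row Ps)"
    and Ps: "\<forall>P\<in>set Ps. 0 < dim_row P \<and> non_isotropic (dim_row P) P"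
    and rep: "\<And>m. m \<in> ?W \<Longrightarrow> \<exists>A\<in>block_model Ps. represents {0} vs m A" by blast
  have len: "length vs = n" using vs(2) dim0 sv(3) by simp
  then have n: "n = sum_list (map dim_row Ps)" using vs(3) by simp
  have msB: "matrix_subspace n (block_model Ps)"
    unfolding n using Ps by (intro matrix_subspace_block_model) (auto simp: non_isotropic_def)
  note BD = matrix_subspaceD[OF msB]
  \<comment> \<open>The columns of G are the adapted basis, so that M G = G A says that A represents
    M.\<close>
  define G where "G = mat n n (\<lambda>(i, j). (vs ! j) i)"
  have Gc: "G \<in> carrier_mat n n" by (simp add: G_def)
  have "det G \<noteq> 0"
  proof
    assume "det G = 0"
    then obtain x where x: "x \<in> carrier_vec n" "x \<noteq> 0\<^sub>v n" "G *\<^sub>v x = 0\<^sub>v n"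
      using det_0_iff_vec_prod_zero_field[OF Gc] by blast
    have "(\<Sum>j<n. vec_scale (x $ j) (vs ! j)) = 0"
    proof
      fix i
      show "(\<Sum>j<n. vec_scale (x $ j) (vs ! j)) i = 0 i"
      proof (cases "i < n")
        case True
        then have "(G *\<^sub>v x) $ i = (\<Sum>j<n. vec_scale (x $ j) (vs ! j) i)"
          using x(1) by (auto simp: G_def scalar_prod_def lessThan_atLeast0 vec_scale_def mult.commute intro!: sum.cong)
        then show ?thesis using x(3) True by (simp add: sum_fun_apply)
      next
        case False
        then have "(vs ! j) i = 0" if "j < n" for j
          using basis_mod_nth[OF vs(1)] len that by (auto simp: supported_vecs_def)
        then show ?thesis by (simp add: sum_fun_apply vec_scale_def)
      qed
    qed
    then have "\<forall>j<n. x $ j = 0" using vs(1) unfolding basis_mod_def len by blast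
    then have "x = 0\<^sub>v n" using x(1) by (intro eq_vecI) auto
    then show False using x(2) by simp
  qed
  then have GG: "G \<in> GL n" using Gc by (simp add: GL_iff_det)
  obtain H where H: "H \<in> GL n" "G * H = 1\<^sub>m n" "H * G = 1\<^sub>m n" by (rule GL_inverse[OF GG])
  have Hc: "H \<in> carrier_mat n n" using H(1) by (simp add: GL_def)
  let ?U = "(\<lambda>A. G * A * H) ` block_model Ps"
  have sub: "W \<subseteq> ?U"
  proof
    fix M assume M: "M \<in> W"
    then have Mc: "M \<in> carrier_mat n n" using WD(1) by blast
    obtain A where A: "A \<in> block_model Ps" "represents {0} vs (fun_of_mat M) A" using rep M by blast
    have Ac: "A \<in> carrier_mat n n" using A(2) len by (simp add: represents_def)
    have "M * G = G * A"
    proof (rule eq_matI)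
      fix i j assume "i < dim_row (G * A)" "j < dim_col (G * A)"
      then have ij: "i < n" "j < n" using Gc Ac by auto
      have "mat_act n (fun_of_mat M) (vs ! j) = (\<Sum>i<n. vec_scale (A $$ (i, j)) (vs ! i))"
        using A(2) ij(2) len by (simp add: represents_def)
      then have "(\<Sum>k<n. fun_of_mat M i k * (vs ! j) k) = (\<Sum>k<n. A $$ (k, j) * (vs ! k) i)"
        by (simp add: mat_act_def sum_fun_apply vec_scale_def fun_eq_iff)
      moreover have "(M * G) $$ (i, j) = (\<Sum>k<n. fun_of_mat M i k * (vs ! j) k)"
        using ij Mc by (auto simp: G_def fun_of_mat_def scalar_prod_def lessThan_atLeast0 intro!: sum.cong)
      moreover have "(G * A) $$ (i, j) = (\<Sum>k<n. A $$ (k, j) * (vs ! k) i)"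
        using ij Ac by (auto simp: G_def scalar_prod_def lessThan_atLeast0 mult.commute intro!: sum.cong)
      ultimately show "(M * G) $$ (i, j) = (G * A) $$ (i, j)" by simp
    qed (use Mc Gc Ac in auto)
    then have "M * G * H = G * A * H" by simp
    moreover have "M * G * H = M" using Mc Gc Hc H(2) by (simp add: assoc_mult_mat[of _ n n _ n _ n])
    ultimately show "M \<in> ?U" using A(1) by auto
  qed
  have msU: "matrix_subspace n ?U"
    unfolding matrix_subspace_def
  proof (intro conjI ballI allI subsetI)
    have "G * 0\<^sub>m n n * H = 0\<^sub>m n n" using Gc Hc by simp
    then show "0\<^sub>m n n \<in> ?U" using BD(2) by (metis image_eqI)
    fix M assume "M \<in> ?U"
    then obtain A where A: "M = G * A * H" "A \<in> block_model Ps" by blast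
    have Ac: "A \<in> carrier_mat n n" using A(2) BD(1) by blast
    show "M \<in> carrier_mat n n" using A Ac Gc Hc by simp
    show "c \<cdot>\<^sub>m M \<in> ?U" for c
      using A Ac Gc Hc BD(4)[OF A(2), of c] by (intro image_eqI[of _ _ "c \<cdot>\<^sub>m A"])
        (auto simp: mult_smult_distrib[of _ n n] mult_smult_assoc_mat[of _ n n])
    fix N assume "N \<in> ?U"
    then obtain B where B: "N = G * B * H" "B \<in> block_model Ps" by blast
    have Bc: "B \<in> carrier_mat n n" using B(2) BD(1) by blast
    show "M + N \<in> ?U"
      using A B Ac Bc Gc Hc BD(3)[OF A(2) B(2)] by (intro image_eqI[of _ _ "A + B"])
        (auto simp: mult_add_distrib_mat[of _ n n] add_mult_distrib_mat[of _ n n])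
  qed
  have nofixU: "\<forall>M\<in>?U. \<forall>v\<in>carrier_vec n. M *\<^sub>v v = v \<longrightarrow> v = 0\<^sub>v n"
  proof (intro ballI impI)
    fix M v assume MU: "M \<in> ?U" and v: "v \<in> carrier_vec n" and Mv: "M *\<^sub>v v = v"
    obtain A where A: "M = G * A * H" "A \<in> block_model Ps" using MU by blast
    have Ac: "A \<in> carrier_mat n n" using A(2) BD(1) by blast
    define x where "x = H *\<^sub>v v"
    have x: "x \<in> carrier_vec n" using Hc v by (simp add: x_def)
    have Gx: "G *\<^sub>v x = v" unfolding x_def using Gc Hc v H(2) by (simp add: assoc_mult_mat_vec[symmetric, of _ n n _ n])
    have "H *\<^sub>v (M *\<^sub>v v) = A *\<^sub>v x"
    proof -
      have "M *\<^sub>v v = G *\<^sub>v (A *\<^sub>v x)" unfolding A(1) x_def using Gc Ac Hc v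
        by (simp add: assoc_mult_mat_vec[of _ n n _ n])
      then have "H *\<^sub>v (M *\<^sub>v v) = (H * G) *\<^sub>v (A *\<^sub>v x)" using Hc Gc Ac x by (simp add: assoc_mult_mat_vec[of _ n n _ n])
      then show ?thesis using H(3) Ac x by simp
    qed
    then have Ax: "A *\<^sub>v x = x" using Mv by (simp add: x_def)
    \<comment> \<open>I - A belongs to the model space, because the block model contains the
      negative of A.\<close>
    let ?D = "1\<^sub>m n + (- 1) \<cdot>\<^sub>m A"
    have Dc: "?D \<in> carrier_mat n n" using Ac by simp
    have "?D \<in> model_space n Ps" using BD(4)[OF A(2)] by (auto simp: model_space_eq)
    then have "?D \<in> GL n" using model_space_GL[of Ps] Ps unfolding n by blast
    then have "det ?D \<noteq> 0" by (simp add: GL_iff_det)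
    moreover have "x + - 1 \<cdot>\<^sub>v x = 0\<^sub>v n" using x by (intro eq_vecI) auto
    then have "?D *\<^sub>v x = 0\<^sub>v n"
      using Ac x Ax by (simp add: add_mult_distrib_mat_vec[of _ n n] smult_mat_mult_vec[of _ n n])
    ultimately have "x = 0\<^sub>v n" using det_0_iff_vec_prod_zero_field[OF Dc] x by blast
    then have "v = G *\<^sub>v 0\<^sub>v n" using Gx by simp
    also have "\<dots> = 0\<^sub>v n" using Gc by (intro eq_vecI) auto
    finally show "v = 0\<^sub>v n" .
  qed
  note tsU = trivial_spectrum_fun_of_mat[OF msU nofixU]
  note sfU = subspace_fun_of_mat[OF matrix_subspaceD[OF msU]]
  have "Op.dim (fun_of_mat ` ?U) \<le> n choose 2"
    using dim_trivial_spectrum_le[OF tsU(1)] unfolding tsU(2) dim0 sv(3) by simp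
  then have WU: "?W = fun_of_mat ` ?U"
    using sub dimW subspace_fun_of_mat(1)[OF WD] sfU by (intro Op.subspace_eq_if_dim_le) auto
  have "?U \<subseteq> W"
  proof
    fix M assume M: "M \<in> ?U"
    then have "fun_of_mat M \<in> ?W" unfolding WU by (rule imageI)
    then obtain N where N: "N \<in> W" "fun_of_mat M = fun_of_mat N" by blast
    have "M = N" using fun_of_mat_inj[OF _ _ N(2)] M N(1) matrix_subspaceD(1)[OF msU] WD(1) by blast
    then show "M \<in> W" using N(1) by simp
  qed
  then have "W = ?U" using sub by blast
  then show ?thesis using Ps n GG H by blast
qed

section \<open>A single block\<close>

lemma GL_carrier: "A \<in> GL n \<Longrightarrow> A \<in> carrier_mat n n"
  by (simp add: GL_def)

lemma GL_mult: "A \<in> GL n \<Longrightarrow> B \<in> GL n \<Longrightarrow> A * B \<in> GL n"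
  by (auto simp: GL_iff_det det_mult)

lemma GL_smult: "A \<in> GL n \<Longrightarrow> c \<noteq> 0 \<Longrightarrow> c \<cdot>\<^sub>m A \<in> GL n"
  by (auto simp: GL_iff_det)

lemma GL_transpose: "A \<in> GL n \<Longrightarrow> transpose_mat A \<in> GL n"
  by (auto simp: GL_iff_det det_transpose)

lemma cancel_mult_left:
  fixes U :: "'a::field mat"
  assumes "U * V = 1\<^sub>m n" "U \<in> carrier_mat n n" "V \<in> carrier_mat n n" "X \<in> carrier_mat n k"
  shows "U * (V * X) = X"
  using assoc_mult_mat[OF assms(2-4)] assms by simp

lemma cancel_mult_vec:
  fixes U :: "'a::field mat"
  assumes "U * V = 1\<^sub>m n" "U \<in> carrier_mat n n" "V \<in> carrier_mat n n" "x \<in> carrier_vec n"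
  shows "U *\<^sub>v (V *\<^sub>v x) = x"
  using assoc_mult_mat_vec[OF assms(2-4)] assms by simp

lemma mult_add_distrib_both:
  fixes R :: "'a::field mat"
  assumes "R \<in> carrier_mat n n" "A \<in> carrier_mat n n" "B \<in> carrier_mat n n" "S \<in> carrier_mat n n"
  shows "R * (A + B) * S = R * A * S + R * B * S"
  using assms by (simp add: mult_add_distrib_mat[of _ n n] add_mult_distrib_mat[of _ n n])

lemma equivalent_sets_trans:
  assumes "V \<subseteq> carrier_mat n n" "equivalent_sets n V W" "equivalent_sets n W U"
  shows "equivalent_sets n V U"
proof -
  obtain R S where RS: "R \<in> GL n" "S \<in> GL n" "W = (\<lambda>M. R * M * S) ` V" using assms(2) by (auto simp: equivalent_sets_def)
  obtain R' S' where RS': "R' \<in> GL n" "S' \<in> GL n" "U = (\<lambda>M. R' * M * S') ` W" using assms(3) by (auto simp: equivalent_sets_def)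
  have "R' * (R * M * S) * S' = (R' * R) * M * (S * S')" if "M \<in> V" for M
    using that assms(1) GL_carrier[OF RS(1)] GL_carrier[OF RS(2)] GL_carrier[OF RS'(1)] GL_carrier[OF RS'(2)]
    by (auto simp: subset_iff assoc_mult_mat[of _ n n _ n _ n])
  then have "U = (\<lambda>M. (R' * R) * M * (S * S')) ` V" unfolding RS'(3) RS(3) image_image by (intro image_cong) auto
  then show ?thesis unfolding equivalent_sets_def
    by (rule bexI[OF bexI[OF _ GL_mult[OF RS(2) RS'(2)]] GL_mult[OF RS'(1) RS(1)]])
qed

lemma equivalent_sets_sym:
  assumes "V \<subseteq> carrier_mat n n" "equivalent_sets n V W"
  shows "equivalent_sets n W V"
proof -
  obtain R S where RS: "R \<in> GL n" "S \<in> GL n" "W = (\<lambda>M. R * M * S) ` V" using assms(2) by (auto simp: equivalent_sets_def)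
  obtain R' where R': "R' \<in> GL n" "R * R' = 1\<^sub>m n" "R' * R = 1\<^sub>m n" by (rule GL_inverse[OF RS(1)])
  obtain S' where S': "S' \<in> GL n" "S * S' = 1\<^sub>m n" "S' * S = 1\<^sub>m n" by (rule GL_inverse[OF RS(2)])
  note c = GL_carrier[OF RS(1)] GL_carrier[OF RS(2)] GL_carrier[OF R'(1)] GL_carrier[OF S'(1)]
  have "R' * (R * M * S) * S' = M" if "M \<in> V" for M
  proof -
    have M: "M \<in> carrier_mat n n" using that assms(1) by blast
    have "R' * (R * M * S) * S' = R' * (R * (M * (S * S')))"
      using c M by (simp add: assoc_mult_mat[of _ n n _ n _ n])
    also have "\<dots> = M" using cancel_mult_left[OF R'(3) c(3,1) M] S'(2) M by simp
    finally show ?thesis .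
  qed
  then have "V = (\<lambda>M. R' * M * S') ` W" unfolding RS(3) image_image by simp
  then show ?thesis unfolding equivalent_sets_def using R' S' by blast
qed

section \<open>Congruence and quadratic forms\<close>

lemma quad_transpose_mult:
  fixes A :: "'a::field mat"
  assumes "A \<in> carrier_mat n n" "S \<in> carrier_mat n n" "X \<in> carrier_vec n"
  shows "X \<bullet> ((transpose_mat S * A * S) *\<^sub>v X) = (S *\<^sub>v X) \<bullet> (A *\<^sub>v (S *\<^sub>v X))"
proof -
  have "(transpose_mat S * A * S) *\<^sub>v X = transpose_mat S *\<^sub>v (A *\<^sub>v (S *\<^sub>v X))"
    using assms by (simp add: assoc_mult_mat_vec[of _ n n _ n])
  moreover have "X \<bullet> (transpose_mat S *\<^sub>v (A *\<^sub>v (S *\<^sub>v X))) = (transpose_mat S *\<^sub>v (A *\<^sub>v (S *\<^sub>v X))) \<bullet> X"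
    using assms by (intro comm_scalar_prod[of _ n]) auto
  moreover have "\<dots> = (A *\<^sub>v (S *\<^sub>v X)) \<bullet> (S *\<^sub>v X)"
    using assms by (intro transpose_vec_mult_scalar[of _ n n]) auto
  moreover have "\<dots> = (S *\<^sub>v X) \<bullet> (A *\<^sub>v (S *\<^sub>v X))" using assms by (intro comm_scalar_prod[of _ n]) auto
  ultimately show ?thesis by metis
qed

lemma quad_smult:
  fixes K :: "'a::field mat"
  assumes "K \<in> carrier_mat n n" "Y \<in> carrier_vec n"
  shows "Y \<bullet> ((a \<cdot>\<^sub>m K) *\<^sub>v Y) = a * (Y \<bullet> (K *\<^sub>v Y))"
  using assms by (simp add: smult_mat_mult_vec[of _ n n])

lemma quad_smult_diff:
  fixes K :: "'a::field mat"
  assumes "K \<in> carrier_mat n n" "Q \<in> carrier_mat n n" "Y \<in> carrier_vec n"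
  shows "Y \<bullet> ((a \<cdot>\<^sub>m K - Q) *\<^sub>v Y) = a * (Y \<bullet> (K *\<^sub>v Y)) - Y \<bullet> (Q *\<^sub>v Y)"
  using assms
  by (simp add: minus_mult_distrib_mat_vec[of _ n n] smult_mat_mult_vec[of _ n n] scalar_prod_minus_distrib[of _ n])

lemma alternate_congruence:
  assumes A: "A \<in> alternate_mats n" and S: "S \<in> carrier_mat n n"
  shows "transpose_mat S * A * S \<in> alternate_mats n"
  unfolding alternate_mats_def
proof (intro CollectI conjI ballI)
  note Ac = alternate_matsD[OF A]
  show "transpose_mat S * A * S \<in> carrier_mat n n" using Ac S by simp
  fix X :: "'a vec" assume X: "X \<in> carrier_vec n"
  show "X \<bullet> (transpose_mat S * A * S *\<^sub>v X) = 0"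
    unfolding quad_transpose_mult[OF Ac S X] using A S X by (simp add: alternate_mats_def)
qed

lemma alternate_diff:
  fixes A :: "'a::field mat"
  assumes "A \<in> alternate_mats n" "B \<in> alternate_mats n"
  shows "A - B \<in> alternate_mats n"
proof -
  have "A - B = A + (- 1) \<cdot>\<^sub>m B" using assms[THEN alternate_matsD] by (intro eq_matI) auto
  then show ?thesis using alternate_mats_closed assms by metis
qed

text \<open>The forms of P and of its inverse are isometric through P itself, so similarity can be
  tested on the inverses, where equivalence of model spaces becomes congruence.\<close>

lemma quad_inverse:
  fixes P :: "'a::field mat"
  assumes "P \<in> carrier_mat n n" "P1 \<in> carrier_mat n n" "P1 * P = 1\<^sub>m n" "X \<in> carrier_vec n"
  shows "(P *\<^sub>v X) \<bullet> (P1 *\<^sub>v (P *\<^sub>v X)) = X \<bullet> (P *\<^sub>v X)"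
proof -
  have "P1 *\<^sub>v (P *\<^sub>v X) = X" using assms by (simp add: assoc_mult_mat_vec[symmetric, of _ n n _ n])
  then show ?thesis using comm_scalar_prod[of "P *\<^sub>v X" n X] assms by simp
qed

lemma scalar_prod_unit: 
  fixes A :: "'a::field mat"
  assumes "A \<in> carrier_mat n n" "i < n" "j < n"
  shows "unit_vec n i \<bullet> (A *\<^sub>v unit_vec n j) = A $$ (i, j)"
  using assms by (simp add: scalar_prod_left_unit[of _ n])

lemma alternate_entries:
  fixes A :: "'a::field mat"
  assumes A: "A \<in> alternate_mats n" and ij: "i < n" "j < n"
  shows "A $$ (i, i) = 0" "A $$ (i, j) + A $$ (j, i) = 0"
proof -
  have Ac: "A \<in> carrier_mat n n" using alternate_matsD[OF A] .
  have diag: "A $$ (k, k) = 0" if "k < n" for k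
    using A scalar_prod_unit[OF Ac that that] by (simp add: alternate_mats_def)
  then show "A $$ (i, i) = 0" using ij by simp
  let ?e = "unit_vec n i" and ?f = "unit_vec n j"
  have "(?e + ?f) \<bullet> (A *\<^sub>v (?e + ?f)) = 0" using A by (simp add: alternate_mats_def)
  moreover have "(?e + ?f) \<bullet> (A *\<^sub>v (?e + ?f)) = ?e \<bullet> (A *\<^sub>v ?e) + ?e \<bullet> (A *\<^sub>v ?f) + (?f \<bullet> (A *\<^sub>v ?e) + ?f \<bullet> (A *\<^sub>v ?f))"
    using Ac by (simp add: mult_add_distrib_mat_vec[of _ n n] add_scalar_prod_distrib[of _ n] scalar_prod_add_distrib[of _ n])
  ultimately show "A $$ (i, j) + A $$ (j, i) = 0"
    using diag ij by (simp add: scalar_prod_unit[OF Ac])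
qed

definition elem_alternate :: "nat \<Rightarrow> nat \<Rightarrow> nat \<Rightarrow> 'a::field mat" where
  "elem_alternate n i j = mat n n (\<lambda>(a, b). (if a = i \<and> b = j then 1 else 0) - (if a = j \<and> b = i then 1 else 0))"

text \<open>The value is a 2 by 2 minor of the pair X, Y. All these minors vanish exactly when X and
  Y are linearly dependent, which is how they enter the study of minimal orbits.\<close>

lemma elem_alternate_mult:
  assumes "i < n" "j < n" "X \<in> carrier_vec n" "Y \<in> carrier_vec n"
  shows "X \<bullet> (elem_alternate n i j *\<^sub>v Y) = X $ i * Y $ j - X $ j * Y $ i"
proof -
  have c: "elem_alternate n i j \<in> carrier_mat n n" by (simp add: elem_alternate_def)
  have "X \<bullet> (elem_alternate n i j *\<^sub>v Y) =
      (\<Sum>a<n. \<Sum>b<n. (if b = j then if a = i then X $ a * Y $ b else 0 else 0) - (if b = i then if a = j then X $ a * Y $ b else 0 else 0))"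
    unfolding scalar_prod_mult_mat_vec[OF c assms(3,4)]
    by (intro sum.cong refl) (auto simp: elem_alternate_def)
  also have "\<dots> = X $ i * Y $ j - X $ j * Y $ i"
    using assms(1,2) by (simp add: sum_subtractf)
  finally show ?thesis .
qed

lemma elem_alternate: "i < n \<Longrightarrow> j < n \<Longrightarrow> elem_alternate n i j \<in> alternate_mats n"
  unfolding alternate_mats_def by (auto simp: elem_alternate_mult) (auto simp: elem_alternate_def)

text \<open>Test on the differences of two transposed matrix units: the zero diagonal of the product
  kills the off-diagonal entries of T, and its skew-symmetry equates the diagonal entries.\<close>

lemma alternate_multiplier_scalar:
  fixes T :: "'a::field mat"
  assumes T: "T \<in> carrier_mat n n" and alt: "\<And>A. A \<in> alternate_mats n \<Longrightarrow> T * A \<in> alternate_mats n"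
  shows "\<exists>c. T = c \<cdot>\<^sub>m 1\<^sub>m n"
proof -
  have entry: "(T * elem_alternate n i j) $$ (a, b) = (if b = j then T $$ (a, i) else 0) - (if b = i then T $$ (a, j) else 0)"
    if "i < n" "j < n" "a < n" "b < n" for i j a b
  proof -
    let ?E = "elem_alternate n i j :: 'a mat"
    have E: "?E \<in> carrier_mat n n" by (simp add: elem_alternate_def)
    have col: "col ?E b = ?E *\<^sub>v unit_vec n b"
      using E that by (intro eq_vecI) (auto simp: scalar_prod_right_unit[of _ n])
    have "(T * ?E) $$ (a, b) = row T a \<bullet> (?E *\<^sub>v unit_vec n b)"
      unfolding col[symmetric] using T E that by simp
    also have "\<dots> = row T a $ i * unit_vec n b $ j - row T a $ j * unit_vec n b $ i"
      using T that by (intro elem_alternate_mult) auto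
    also have "\<dots> = (if b = j then T $$ (a, i) else 0) - (if b = i then T $$ (a, j) else 0)"
      using T that by auto
    finally show ?thesis .
  qed
  have off: "T $$ (j, i) = 0" if "i < n" "j < n" "i \<noteq> j" for i j
    using alternate_entries(1)[OF alt[OF elem_alternate[OF that(1,2)]] that(2,2)] entry[OF that(1,2,2,2)] that by simp
  have diag: "T $$ (i, i) = T $$ (j, j)" if "i < n" "j < n" for i j
  proof (cases "i = j")
    case False
    then show ?thesis
      using alternate_entries(2)[OF alt[OF elem_alternate[OF that]] that] entry[OF that that] entry[OF that that(2,1)] that by simp
  qed simp
  have "T = T $$ (0, 0) \<cdot>\<^sub>m 1\<^sub>m n"
  proof (rule eq_matI)
    fix i j assume "i < dim_row (T $$ (0, 0) \<cdot>\<^sub>m 1\<^sub>m n)" "j < dim_col (T $$ (0, 0) \<cdot>\<^sub>m 1\<^sub>m n)"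
    then have ij: "i < n" "j < n" by auto
    show "T $$ (i, j) = (T $$ (0, 0) \<cdot>\<^sub>m 1\<^sub>m n) $$ (i, j)"
    proof (cases "i = j")
      case True
      then show ?thesis using diag[of i 0] ij by simp
    next
      case False
      then show ?thesis using off[OF ij(2,1)] ij by simp
    qed
  qed (use T in auto)
  then show ?thesis by blast
qed

text \<open>With \<open>R = (1 / c) Q S^T P1\<close>, the product R P A S is Q times a congruence of
  A, up to a factor. Then R S = I + Q A0, where A0 compares the congruence of P1 by S with Q1. It is
  alternate if the form of P1 at S Y is c times that of Q1 at Y, and S = P G Q1 achieves this
  because P and Q1 are isometries between the forms and those of the inverses.\<close>

lemma one_block_equivalent:
  fixes P Q :: "'a::field mat"
  assumes P: "P \<in> GL n" and Q: "Q \<in> GL n" and G: "G \<in> GL n" and c: "c \<noteq> 0"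
    and form: "\<And>X. X \<in> carrier_vec n \<Longrightarrow> quad_form P (G *\<^sub>v X) = c * quad_form Q X"
  shows "equivalent_sets n (model_space n [P]) (model_space n [Q])"
proof -
  obtain P1 where P1: "P1 \<in> GL n" "P * P1 = 1\<^sub>m n" "P1 * P = 1\<^sub>m n" by (rule GL_inverse[OF P])
  obtain Q1 where Q1: "Q1 \<in> GL n" "Q * Q1 = 1\<^sub>m n" "Q1 * Q = 1\<^sub>m n" by (rule GL_inverse[OF Q])
  note Pc = GL_carrier[OF P] and Qc = GL_carrier[OF Q] and Gc = GL_carrier[OF G]
    and P1c = GL_carrier[OF P1(1)] and Q1c = GL_carrier[OF Q1(1)]
  define S where "S = P * G * Q1"
  have S: "S \<in> GL n" unfolding S_def using P G Q1 GL_mult by blast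
  note Sc = GL_carrier[OF S]
  obtain Si where Si: "Si \<in> GL n" "S * Si = 1\<^sub>m n" "Si * S = 1\<^sub>m n" by (rule GL_inverse[OF S])
  note Sic = GL_carrier[OF Si(1)]
  define St where "St = transpose_mat S"
  have Stc: "St \<in> carrier_mat n n" using Sc by (simp add: St_def)
  define A0 where "A0 = (1 / c) \<cdot>\<^sub>m (St * P1 * S) - Q1"
  have A0c: "A0 \<in> carrier_mat n n" unfolding A0_def by (rule minus_carrier_mat[OF Q1c])
  have A0: "A0 \<in> alternate_mats n"
    unfolding alternate_mats_def
  proof (intro CollectI conjI ballI A0c)
    fix Y :: "'a vec" assume Y: "Y \<in> carrier_vec n"
    define X where "X = Q1 *\<^sub>v Y"
    have X: "X \<in> carrier_vec n" using Q1c Y by (simp add: X_def)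
    have Y_eq: "Y = Q *\<^sub>v X" unfolding X_def using Qc Q1c Y Q1(2) by (simp add: assoc_mult_mat_vec[symmetric, of _ n n _ n])
    have SY: "S *\<^sub>v Y = P *\<^sub>v (G *\<^sub>v X)" unfolding S_def X_def using Pc Gc Q1c Y by (simp add: assoc_mult_mat_vec[of _ n n _ n])
    have GX: "G *\<^sub>v X \<in> carrier_vec n" using Gc X by simp
    have "Y \<bullet> (A0 *\<^sub>v Y) = (1 / c) * (Y \<bullet> ((St * P1 * S) *\<^sub>v Y)) - Y \<bullet> (Q1 *\<^sub>v Y)"
      unfolding A0_def by (rule quad_smult_diff[OF _ Q1c Y]) (use Stc Sc P1c in simp)
    also have "Y \<bullet> ((St * P1 * S) *\<^sub>v Y) = quad_form P (G *\<^sub>v X)"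
      unfolding St_def quad_transpose_mult[OF P1c Sc Y] SY quad_inverse[OF Pc P1c P1(3) GX] quad_form_def ..
    also have "Y \<bullet> (Q1 *\<^sub>v Y) = quad_form Q X"
      unfolding Y_eq quad_inverse[OF Qc Q1c Q1(3) X] quad_form_def ..
    also have "(1 / c) * quad_form P (G *\<^sub>v X) - quad_form Q X = 0" using form[OF X] c by simp
    finally show "Y \<bullet> (A0 *\<^sub>v Y) = 0" .
  qed
  define R where "R = (1 / c) \<cdot>\<^sub>m (Q * St * P1)"
  have R: "R \<in> GL n" unfolding R_def unfolding St_def using Q S P1 c by (intro GL_smult GL_mult GL_transpose) auto
  note Rc = GL_carrier[OF R]
  have RPAS: "R * (P * A) * S = Q * ((1 / c) \<cdot>\<^sub>m (St * A * S))" if A: "A \<in> carrier_mat n n" for A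
  proof -
    have "R * (P * A) * S = (1 / c) \<cdot>\<^sub>m (Q * (St * (P1 * (P * A) * S)))"
      unfolding R_def using Qc Stc P1c Pc A Sc
      by (simp add: mult_smult_assoc_mat[of _ n n _ n] assoc_mult_mat[of _ n n _ n _ n] mult_carrier_mat[of _ n n _ n])
    also have "P1 * (P * A) = A" by (rule cancel_mult_left[OF P1(3) P1c Pc A])
    finally show ?thesis using Qc Stc A Sc by (simp add: mult_smult_distrib[of _ n n _ n] assoc_mult_mat[of _ n n _ n _ n] mult_carrier_mat[of _ n n _ n])
  qed
  have RS: "R * S = 1\<^sub>m n + Q * A0"
  proof -
    have "A0 + Q1 = (1 / c) \<cdot>\<^sub>m (St * P1 * S)" unfolding A0_def using Stc P1c Sc Q1c by (intro eq_matI) auto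
    moreover have "R * S = Q * ((1 / c) \<cdot>\<^sub>m (St * P1 * S))"
      unfolding R_def using Qc Stc P1c Sc
      by (simp add: mult_smult_assoc_mat[of _ n n _ n] mult_smult_distrib[of _ n n _ n] assoc_mult_mat[of _ n n _ n _ n] mult_carrier_mat[of _ n n _ n])
    ultimately have "R * S = Q * (A0 + Q1)" by simp
    also have "\<dots> = Q * A0 + 1\<^sub>m n" using Qc A0c Q1c Q1(2) by (simp add: mult_add_distrib_mat[of _ n n])
    also have "\<dots> = 1\<^sub>m n + Q * A0" using Qc A0c by (intro comm_add_mat) auto
    finally show ?thesis .
  qed
  have img: "R * (1\<^sub>m n + P * A) * S = 1\<^sub>m n + Q * (A0 + (1 / c) \<cdot>\<^sub>m (St * A * S))" if A: "A \<in> carrier_mat n n" for A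
  proof -
    have "R * (1\<^sub>m n + P * A) * S = R * S + R * (P * A) * S"
      using mult_add_distrib_both[OF Rc _ _ Sc, of "1\<^sub>m n" "P * A"] Pc A Rc by simp
    also have "\<dots> = 1\<^sub>m n + (Q * A0 + Q * ((1 / c) \<cdot>\<^sub>m (St * A * S)))"
      unfolding RS RPAS[OF A] using Qc A0c Stc A Sc by (intro assoc_add_mat[of _ n n]) auto
    also have "Q * A0 + Q * ((1 / c) \<cdot>\<^sub>m (St * A * S)) = Q * (A0 + (1 / c) \<cdot>\<^sub>m (St * A * S))"
      using Qc A0c Stc A Sc by (intro mult_add_distrib_mat[symmetric, of _ n n]) auto
    finally show ?thesis .
  qed
  have one: "model_space n [P'] = (\<lambda>A. 1\<^sub>m n + P' * A) ` alternate_mats n" if "P' \<in> carrier_mat n n" for P' :: "'a mat"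
    using that by (simp add: model_space_eq block_model_Cons block_model_Nil block_join_unit_right image_image)
  have "model_space n [Q] = (\<lambda>M. R * M * S) ` model_space n [P]"
    unfolding one[OF Pc] one[OF Qc] image_image
  proof
    show "(\<lambda>x. R * (1\<^sub>m n + P * x) * S) ` alternate_mats n \<subseteq> (\<lambda>A. 1\<^sub>m n + Q * A) ` alternate_mats n"
    proof
      fix M assume "M \<in> (\<lambda>x. R * (1\<^sub>m n + P * x) * S) ` alternate_mats n"
      then obtain A where A: "A \<in> alternate_mats n" "M = R * (1\<^sub>m n + P * A) * S" by blast
      have "M = 1\<^sub>m n + Q * (A0 + (1 / c) \<cdot>\<^sub>m (St * A * S))" using img[OF alternate_matsD[OF A(1)]] A(2) by simp
      moreover have "A0 + (1 / c) \<cdot>\<^sub>m (St * A * S) \<in> alternate_mats n"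
        by (intro alternate_mats_closed A0 alternate_congruence[OF A(1) Sc, folded St_def])
      ultimately show "M \<in> (\<lambda>A. 1\<^sub>m n + Q * A) ` alternate_mats n" by blast
    qed
    show "(\<lambda>A. 1\<^sub>m n + Q * A) ` alternate_mats n \<subseteq> (\<lambda>x. R * (1\<^sub>m n + P * x) * S) ` alternate_mats n"
    proof
      fix M assume "M \<in> (\<lambda>A. 1\<^sub>m n + Q * A) ` alternate_mats n"
      then obtain B where B: "B \<in> alternate_mats n" "M = 1\<^sub>m n + Q * B" by blast
      have Bc: "B \<in> carrier_mat n n" by (rule alternate_matsD[OF B(1)])
      define D where "D = B - A0"
      have D: "D \<in> alternate_mats n" unfolding D_def by (intro alternate_diff B A0)
      have Dc: "D \<in> carrier_mat n n" by (rule alternate_matsD[OF D])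
      define Sit where "Sit = transpose_mat Si"
      have Sitc: "Sit \<in> carrier_mat n n" using Sic by (simp add: Sit_def)
      define A where "A = c \<cdot>\<^sub>m (Sit * D * Si)"
      have A: "A \<in> alternate_mats n" unfolding A_def by (intro alternate_mats_closed alternate_congruence[OF D Sic, folded Sit_def])
      have "St * Sit = 1\<^sub>m n" using transpose_mult[OF Sic Sc] Si(3) by (simp add: St_def Sit_def)
      then have e1: "St * (Sit * (D * (Si * S))) = D"
        using cancel_mult_left[OF _ Stc Sitc, of D n] Dc Si(3) by simp
      have "St * A * S = c \<cdot>\<^sub>m (St * (Sit * (D * (Si * S))))"
        unfolding A_def using Stc Sitc Dc Sic Sc
        by (simp add: mult_smult_distrib[of _ n n _ n] mult_smult_assoc_mat[of _ n n _ n] assoc_mult_mat[of _ n n _ n _ n] mult_carrier_mat[of _ n n _ n])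
      then have "St * A * S = c \<cdot>\<^sub>m D" unfolding e1 .
      then have "(1 / c) \<cdot>\<^sub>m (St * A * S) = D" using c Dc by (intro eq_matI) auto
      then have "A0 + (1 / c) \<cdot>\<^sub>m (St * A * S) = B" using A0c Bc by (auto simp: D_def intro!: eq_matI)
      then have "M = R * (1\<^sub>m n + P * A) * S" using img[OF alternate_matsD[OF A]] B(2) by simp
      then show "M \<in> (\<lambda>x. R * (1\<^sub>m n + P * x) * S) ` alternate_mats n" using A by blast
    qed
  qed
  then show ?thesis unfolding equivalent_sets_def using R S by blast
qed

lemma model_space_one:
  "P \<in> carrier_mat n n \<Longrightarrow> model_space n [P] = (\<lambda>A. 1\<^sub>m n + P * A) ` alternate_mats n"
  by (simp add: model_space_eq block_model_Cons block_model_Nil block_join_unit_right image_image)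

section \<open>Isometries as invertible matrices\<close>

lemma isometric_formsI:
  fixes G :: "'a::field mat"
  assumes G: "G \<in> GL n" and q: "\<And>X. X \<in> carrier_vec n \<Longrightarrow> q' (G *\<^sub>v X) = q X"
  shows "isometric_forms n q n q'"
  unfolding isometric_forms_def
proof (intro exI[of _ "\<lambda>X. G *\<^sub>v X"] conjI ballI q)
  note Gc = GL_carrier[OF G]
  obtain Gi where Gi: "Gi \<in> GL n" "G * Gi = 1\<^sub>m n" "Gi * G = 1\<^sub>m n" by (rule GL_inverse[OF G])
  note Gic = GL_carrier[OF Gi(1)]
  interpret vs: vectorspace "class_ring :: 'a ring" "module_vec TYPE('a) n" by (rule vec_vs)
  show "linear_map class_ring (module_vec TYPE('a) n) (module_vec TYPE('a) n) (\<lambda>X. G *\<^sub>v X)"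
    by unfold_locales
      (use Gc in \<open>auto simp: LinearCombinations.module_hom_def module_vec_simps mult_add_distrib_mat_vec[of _ n n] mult_mat_vec\<close>)
  show "bij_betw (\<lambda>X. G *\<^sub>v X) (carrier_vec n) (carrier_vec n)"
    by (rule bij_betw_byWitness[of _ "\<lambda>X. Gi *\<^sub>v X"])
      (use Gc Gic Gi in \<open>auto simp: assoc_mult_mat_vec[symmetric, of _ n n _ n]\<close>)
qed

lemma isometric_formsE:
  fixes q :: "'a::field vec \<Rightarrow> 'a"
  assumes "isometric_forms n q n q'"
  obtains G where "G \<in> GL n" "\<And>X. X \<in> carrier_vec n \<Longrightarrow> q' (G *\<^sub>v X) = q X"
proof -
  obtain f where f: "linear_map class_ring (module_vec TYPE('a) n) (module_vec TYPE('a) n) f"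
    "bij_betw f (carrier_vec n) (carrier_vec n)" "\<forall>X\<in>carrier_vec n. q' (f X) = q X"
    using assms by (auto simp: isometric_forms_def)
  have "f \<in> LinearCombinations.module_hom class_ring (module_vec TYPE('a) n) (module_vec TYPE('a) n)"
    using f(1) unfolding linear_map_def mod_hom_def mod_hom_axioms_def by blast
  then have fc: "\<And>X. X \<in> carrier_vec n \<Longrightarrow> f X \<in> carrier_vec n"
    and fa: "\<And>X Y. X \<in> carrier_vec n \<Longrightarrow> Y \<in> carrier_vec n \<Longrightarrow> f (X + Y) = f X + f Y"
    and fs: "\<And>r X. X \<in> carrier_vec n \<Longrightarrow> f (r \<cdot>\<^sub>v X) = r \<cdot>\<^sub>v f X"
    by (auto simp: LinearCombinations.module_hom_def module_vec_simps Pi_iff)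
  define G where "G = mat n n (\<lambda>(i, j). f (unit_vec n j) $ i)"
  have Gc: "G \<in> carrier_mat n n" by (simp add: G_def)
  have f0: "f (0\<^sub>v n) = 0\<^sub>v n"
  proof -
    have "f (0 \<cdot>\<^sub>v 0\<^sub>v n) = 0 \<cdot>\<^sub>v f (0\<^sub>v n)" by (rule fs) simp
    moreover have "0 \<cdot>\<^sub>v f (0\<^sub>v n) = 0\<^sub>v n" using fc[of "0\<^sub>v n"] by (intro eq_vecI) auto
    moreover have "0 \<cdot>\<^sub>v 0\<^sub>v n = (0\<^sub>v n :: 'a vec)" by (intro eq_vecI) auto
    ultimately show ?thesis by simp
  qed
  have Ge: "G *\<^sub>v unit_vec n j = f (unit_vec n j)" if "j < n" for j
    using that fc[of "unit_vec n j"] by (intro eq_vecI) (auto simp: G_def scalar_prod_right_unit[of _ n])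
  \<comment> \<open>Induction on a bound k for the support of X, splitting off the coordinate of
    index k.\<close>
  have eq: "f X = G *\<^sub>v X" if "X \<in> carrier_vec n" "\<forall>j. k \<le> j \<longrightarrow> j < n \<longrightarrow> X $ j = 0" "k \<le> n" for X k
    using that
  proof (induction k arbitrary: X)
    case 0
    then have "X = 0\<^sub>v n" by (intro eq_vecI) auto
    moreover have "G *\<^sub>v 0\<^sub>v n = 0\<^sub>v n" using Gc by (intro eq_vecI) auto
    ultimately show ?case using f0 by simp
  next
    case (Suc k)
    let ?Y = "X - X $ k \<cdot>\<^sub>v unit_vec n k"
    have Y: "?Y \<in> carrier_vec n" using Suc.prems by simp
    have k: "k < n" using Suc.prems by simp
    have Y0: "?Y $ j = 0" if "k \<le> j" "j < n" for j
      using Suc.prems that by (cases "j = k") auto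
    have IH: "f ?Y = G *\<^sub>v ?Y"
      by (rule Suc.IH[OF Y _ less_imp_le[OF k]]) (intro allI impI, rule Y0)
    have X: "X = ?Y + X $ k \<cdot>\<^sub>v unit_vec n k" using Suc.prems by (intro eq_vecI) auto
    have "f (?Y + X $ k \<cdot>\<^sub>v unit_vec n k) = f ?Y + X $ k \<cdot>\<^sub>v f (unit_vec n k)"
      using fa[OF Y, of "X $ k \<cdot>\<^sub>v unit_vec n k"] fs[of "unit_vec n k" "X $ k"] by simp
    then have "f X = f ?Y + X $ k \<cdot>\<^sub>v f (unit_vec n k)" using X by metis
    also have "\<dots> = G *\<^sub>v ?Y + G *\<^sub>v (X $ k \<cdot>\<^sub>v unit_vec n k)"
      using IH Ge[OF k] mult_mat_vec[OF Gc, of "unit_vec n k"] by simp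
    also have "\<dots> = G *\<^sub>v (?Y + X $ k \<cdot>\<^sub>v unit_vec n k)"
      using Y Gc by (intro mult_add_distrib_mat_vec[symmetric, of _ n n]) auto
    also have "\<dots> = G *\<^sub>v X" using X by simp
    finally show ?case .
  qed
  have fG: "f X = G *\<^sub>v X" if "X \<in> carrier_vec n" for X using eq[OF that, of n] by simp
  have "det G \<noteq> 0"
  proof
    assume "det G = 0"
    then obtain v where v: "v \<in> carrier_vec n" "v \<noteq> 0\<^sub>v n" "G *\<^sub>v v = 0\<^sub>v n"
      using det_0_iff_vec_prod_zero_field[OF Gc] by blast
    then have "f v = f (0\<^sub>v n)" using fG f0 by simp
    then show False using v f(2) unfolding bij_betw_def inj_on_def by auto
  qed
  then show ?thesis using that[of G] Gc f(3) fG by (simp add: GL_iff_det)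
qed

text \<open>Comparing the images of I and I + P A shows that Q1 R P A S is alternate; a congruence
  by the inverse of S turns it into T A. So T is a scalar k, that is,
  \<open>Q1 R = k S^T P1\<close>. Multiplying by S and using R S = I + Q A1 gives
  \<open>Q1 + A1 = k S^T P1 S\<close>, and the alternate A1 is invisible to the quadratic
  form.\<close>

lemma one_block_similar:
  fixes P Q :: "'a::field mat"
  assumes P: "P \<in> GL n" and Q: "Q \<in> GL n" and n: "0 < n" and niso: "non_isotropic n Q"
    and eq: "equivalent_sets n (model_space n [P]) (model_space n [Q])"
  shows "similar_forms n (quad_form P) n (quad_form Q)"
proof -
  obtain R S where R: "R \<in> GL n" and S: "S \<in> GL n"
    and RS: "model_space n [Q] = (\<lambda>M. R * M * S) ` model_space n [P]"
    using eq unfolding equivalent_sets_def by blast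
  obtain P1 where P1: "P1 \<in> GL n" "P * P1 = 1\<^sub>m n" "P1 * P = 1\<^sub>m n" by (rule GL_inverse[OF P])
  obtain Q1 where Q1: "Q1 \<in> GL n" "Q * Q1 = 1\<^sub>m n" "Q1 * Q = 1\<^sub>m n" by (rule GL_inverse[OF Q])
  obtain Si where Si: "Si \<in> GL n" "S * Si = 1\<^sub>m n" "Si * S = 1\<^sub>m n" by (rule GL_inverse[OF S])
  note c = GL_carrier[OF P] GL_carrier[OF Q] GL_carrier[OF R] GL_carrier[OF S]
    GL_carrier[OF P1(1)] GL_carrier[OF Q1(1)] GL_carrier[OF Si(1)]
  define St Sit where "St = transpose_mat S" and "Sit = transpose_mat Si"
  have tc: "St \<in> carrier_mat n n" "Sit \<in> carrier_mat n n" using c by (simp_all add: St_def Sit_def)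
  have SitSt: "Sit * St = 1\<^sub>m n" using transpose_mult[OF c(4,7)] Si(2) by (simp add: St_def Sit_def)
  have StSit: "St * Sit = 1\<^sub>m n" using transpose_mult[OF c(7,4)] Si(3) by (simp add: St_def Sit_def)
  have img: "\<exists>B\<in>alternate_mats n. R * (1\<^sub>m n + P * A) * S = 1\<^sub>m n + Q * B" if "A \<in> alternate_mats n" for A
  proof -
    have "R * (1\<^sub>m n + P * A) * S \<in> model_space n [Q]" unfolding RS model_space_one[OF c(1)] using that by blast
    then show ?thesis unfolding model_space_one[OF c(2)] by blast
  qed
  obtain A1 where A1: "A1 \<in> alternate_mats n" "R * (1\<^sub>m n + P * 0\<^sub>m n n) * S = 1\<^sub>m n + Q * A1"
    using img[OF alternate_mats_closed(1)] by blast
  have A1c: "A1 \<in> carrier_mat n n" by (rule alternate_matsD[OF A1(1)])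
  have RS1: "R * S = 1\<^sub>m n + Q * A1" using A1(2) c by simp
  define T where "T = Sit * (Q1 * (R * P))"
  have Tc: "T \<in> carrier_mat n n" unfolding T_def using tc c by simp
  have Talt: "T * A \<in> alternate_mats n" if A: "A \<in> alternate_mats n" for A
  proof -
    have Ac: "A \<in> carrier_mat n n" by (rule alternate_matsD[OF A])
    obtain B where B: "B \<in> alternate_mats n" "R * (1\<^sub>m n + P * A) * S = 1\<^sub>m n + Q * B" using img[OF A] by blast
    have Bc: "B \<in> carrier_mat n n" by (rule alternate_matsD[OF B(1)])
    have "R * (1\<^sub>m n + P * A) * S = R * S + R * (P * A) * S"
      using mult_add_distrib_both[OF c(3) _ _ c(4), of "1\<^sub>m n" "P * A"] c Ac by simp
    then have e: "1\<^sub>m n + Q * B = 1\<^sub>m n + Q * A1 + R * (P * A) * S" using B(2) RS1 by simp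
    have "R * (P * A) * S = Q * (B - A1)"
    proof -
      have QB: "Q * (B - A1) = Q * B - Q * A1" using c Bc A1c by (intro mult_minus_distrib_mat[of _ n n]) auto
      have d: "X = Y - Z" if "I + Y = I + Z + X" "I \<in> carrier_mat n n" "X \<in> carrier_mat n n" "Y \<in> carrier_mat n n" "Z \<in> carrier_mat n n"
        for I X Y Z :: "'a mat"
      proof (rule eq_matI)
        fix i j assume ij: "i < dim_row (Y - Z)" "j < dim_col (Y - Z)"
        have "(I + Y) $$ (i, j) = (I + Z + X) $$ (i, j)" using that(1) by simp
        then show "X $$ (i, j) = (Y - Z) $$ (i, j)" using ij that(2-5) by simp
      qed (use that in auto)
      show ?thesis unfolding QB by (rule d[OF e]) (use c Ac Bc A1c in auto)
    qed
    then have "Q1 * (R * (P * A) * S) = Q1 * (Q * (B - A1))" by simp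
    also have "\<dots> = B - A1" by (rule cancel_mult_left[OF Q1(3) c(6,2)]) (use Bc A1c in auto)
    finally have "Q1 * (R * (P * A) * S) \<in> alternate_mats n" using alternate_diff[OF B(1) A1(1)] by simp
    from alternate_congruence[OF this c(7), folded Sit_def]
    have "Sit * (Q1 * (R * (P * A) * S)) * Si \<in> alternate_mats n" .
    moreover have "Sit * (Q1 * (R * (P * A) * S)) * Si = T * A * (S * Si)"
      unfolding T_def using c tc Ac by (simp add: assoc_mult_mat[of _ n n _ n _ n] mult_carrier_mat[of _ n n _ n])
    ultimately show ?thesis using Si(2) Tc Ac by simp
  qed
  obtain k where k: "T = k \<cdot>\<^sub>m 1\<^sub>m n" using alternate_multiplier_scalar[OF Tc Talt] by blast
  have "St * T = Q1 * (R * P)" unfolding T_def by (rule cancel_mult_left[OF StSit tc]) (use c in auto)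
  then have "Q1 * (R * P) = k \<cdot>\<^sub>m St" unfolding k using tc by (simp add: mult_smult_distrib[of _ n n _ n])
  then have "Q1 * (R * P) * P1 = k \<cdot>\<^sub>m (St * P1)" using tc c by (simp add: mult_smult_assoc_mat[of _ n n _ n])
  moreover have "Q1 * (R * P) * P1 = Q1 * R" using c P1(2) by (simp add: assoc_mult_mat[of _ n n _ n _ n] mult_carrier_mat[of _ n n _ n])
  ultimately have QiR: "Q1 * R = k \<cdot>\<^sub>m (St * P1)" by simp
  have "Q1 * (R * S) = Q1 + A1"
  proof -
    have "Q1 * (R * S) = Q1 * 1\<^sub>m n + Q1 * (Q * A1)" unfolding RS1 using c A1c by (intro mult_add_distrib_mat[of _ n n]) auto
    then show ?thesis using c cancel_mult_left[OF Q1(3) c(6,2) A1c] by simp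
  qed
  moreover have "Q1 * (R * S) = k \<cdot>\<^sub>m (St * P1 * S)"
  proof -
    have "Q1 * (R * S) = Q1 * R * S" using c by simp
    then show ?thesis unfolding QiR using c tc by (simp add: mult_smult_assoc_mat[of _ n n _ n])
  qed
  ultimately have key: "Q1 + A1 = k \<cdot>\<^sub>m (St * P1 * S)" by simp
  have form: "Y \<bullet> (Q1 *\<^sub>v Y) = k * ((S *\<^sub>v Y) \<bullet> (P1 *\<^sub>v (S *\<^sub>v Y)))" if Y: "Y \<in> carrier_vec n" for Y
  proof -
    have "Y \<bullet> ((Q1 + A1) *\<^sub>v Y) = Y \<bullet> (Q1 *\<^sub>v Y) + Y \<bullet> (A1 *\<^sub>v Y)"
      using Y c A1c by (simp add: add_mult_distrib_mat_vec[of _ n n] scalar_prod_add_distrib[of _ n])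
    also have "Y \<bullet> (A1 *\<^sub>v Y) = 0" using A1(1) Y by (simp add: alternate_mats_def)
    finally have "Y \<bullet> (Q1 *\<^sub>v Y) = Y \<bullet> ((k \<cdot>\<^sub>m (St * P1 * S)) *\<^sub>v Y)" unfolding key by simp
    also have "\<dots> = k * (Y \<bullet> ((St * P1 * S) *\<^sub>v Y))"
      using c tc Y by (intro quad_smult[of _ n]) auto
    finally show ?thesis unfolding St_def quad_transpose_mult[OF c(5,4) Y] .
  qed
  define G where "G = Q1 * (Si * P)"
  have G: "G \<in> GL n" unfolding G_def using Q1 Si P GL_mult by blast
  have q: "quad_form Q (G *\<^sub>v X) = k * quad_form P X" if X: "X \<in> carrier_vec n" for X
  proof -
    let ?Z = "G *\<^sub>v X"
    have Z: "?Z \<in> carrier_vec n" using GL_carrier[OF G] X by simp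
    have QZ: "Q *\<^sub>v ?Z = Si *\<^sub>v (P *\<^sub>v X)"
    proof -
      have "Q *\<^sub>v ?Z = (Q * G) *\<^sub>v X" using c GL_carrier[OF G] X by (simp add: assoc_mult_mat_vec[of _ n n _ n])
      also have "Q * G = Si * P" unfolding G_def by (rule cancel_mult_left[OF Q1(2) c(2,6)]) (use c in auto)
      finally show ?thesis using c X by (simp add: assoc_mult_mat_vec[of _ n n _ n])
    qed
    have SQZ: "S *\<^sub>v (Q *\<^sub>v ?Z) = P *\<^sub>v X"
      unfolding QZ by (rule cancel_mult_vec[OF Si(2) c(4,7)]) (use c X in simp)
    have QZc: "Q *\<^sub>v ?Z \<in> carrier_vec n" using c Z by simp
    have "quad_form Q ?Z = (Q *\<^sub>v ?Z) \<bullet> (Q1 *\<^sub>v (Q *\<^sub>v ?Z))"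
      unfolding quad_form_def quad_inverse[OF c(2,6) Q1(3) Z] ..
    also have "\<dots> = k * ((P *\<^sub>v X) \<bullet> (P1 *\<^sub>v (P *\<^sub>v X)))" unfolding form[OF QZc] SQZ ..
    also have "\<dots> = k * quad_form P X" unfolding quad_inverse[OF c(1,5) P1(3) X] quad_form_def ..
    finally show ?thesis .
  qed
  \<comment> \<open>For k = 0 the form of Q would vanish on the image of G, which is
    everything.\<close>
  have "k \<noteq> 0"
  proof
    assume "k = 0"
    then have z: "quad_form Q (G *\<^sub>v X) = 0" if "X \<in> carrier_vec n" for X using q[OF that] by simp
    obtain Gi where Gi: "Gi \<in> GL n" "G * Gi = 1\<^sub>m n" "Gi * G = 1\<^sub>m n" by (rule GL_inverse[OF G])
    have u: "unit_vec n 0 \<noteq> (0\<^sub>v n :: 'a vec)" using n by (metis index_unit_vec(1) index_zero_vec(1) zero_neq_one)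
    have "G *\<^sub>v (Gi *\<^sub>v unit_vec n 0) = unit_vec n 0"
      by (rule cancel_mult_vec[OF Gi(2) GL_carrier[OF G] GL_carrier[OF Gi(1)]]) simp
    then have "quad_form Q (unit_vec n 0) = 0" using z[of "Gi *\<^sub>v unit_vec n 0"] GL_carrier[OF Gi(1)] by simp
    then show False using niso u unfolding non_isotropic_def quad_form_def by simp
  qed
  then show ?thesis unfolding similar_forms_def using isometric_formsI[OF G, of "quad_form Q" "\<lambda>X. k * quad_form P X"] q by blast
qed

section \<open>Block triangular equivalences\<close>

lemma four_block_mat_inject:
  assumes "four_block_mat A B C D = four_block_mat A' B' C' D'"
    "A \<in> carrier_mat p p" "A' \<in> carrier_mat p p" "D \<in> carrier_mat q q" "D' \<in> carrier_mat q q"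
  shows "A = A'" "D = D'"
proof -
  have e: "four_block_mat A B C D $$ (i, j) = four_block_mat A' B' C' D' $$ (i, j)" for i j using assms(1) by simp
  show "A = A'"
  proof (rule eq_matI)
    fix i j assume "i < dim_row A'" "j < dim_col A'"
    then show "A $$ (i, j) = A' $$ (i, j)" using e[of i j] assms(2-) by simp
  qed (use assms in auto)
  show "D = D'"
  proof (rule eq_matI)
    fix i j assume "i < dim_row D'" "j < dim_col D'"
    then show "D $$ (i, j) = D' $$ (i, j)" using e[of "p + i" "p + j"] assms(2-) by simp
  qed (use assms in auto)
qed

section \<open>Algebra of block triangular matrices and joins\<close>

lemma mult_block_triangular:
  fixes R1 :: "'a::field mat"
  assumes "R1 \<in> carrier_mat p p" "R2 \<in> carrier_mat p q" "R3 \<in> carrier_mat q q"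
    "A \<in> carrier_mat p p" "B \<in> carrier_mat p q" "C \<in> carrier_mat q q"
  shows "four_block_mat R1 R2 (0\<^sub>m q p) R3 * four_block_mat A B (0\<^sub>m q p) C
    = four_block_mat (R1 * A) (R1 * B + R2 * C) (0\<^sub>m q p) (R3 * C)"
proof -
  have z: "R2 * 0\<^sub>m q p = 0\<^sub>m p p" "0\<^sub>m q p * A + R3 * 0\<^sub>m q p = 0\<^sub>m q p" "0\<^sub>m q p * B = 0\<^sub>m q q"
    using assms by auto
  show ?thesis
    unfolding mult_four_block_mat[OF assms(1,2) zero_carrier_mat assms(3) assms(4,5) zero_carrier_mat assms(6)] z
    using assms by (intro cong_four_block_mat) auto
qed

lemma det_block_triangular:
  fixes A :: "'a::field mat"
  assumes "A \<in> carrier_mat p p" "B \<in> carrier_mat p q" "C \<in> carrier_mat q q"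
  shows "det (four_block_mat A B (0\<^sub>m q p) C) = det A * det C"
  by (rule det_four_block_mat_lower_left_zero[OF assms(1,2) _ assms(3)]) simp

lemma GL_block_triangular:
  assumes "A \<in> carrier_mat p p" "B \<in> carrier_mat p q" "C \<in> carrier_mat q q"
  shows "four_block_mat A B (0\<^sub>m q p) C \<in> GL (p + q) \<longleftrightarrow> A \<in> GL p \<and> C \<in> GL q"
  using assms det_block_triangular[OF assms] by (auto simp: GL_iff_det)

lemma block_join_elems:
  assumes "V \<subseteq> carrier_mat p p" "W \<subseteq> carrier_mat q q"
  shows "block_join V W = {four_block_mat A B (0\<^sub>m q p) C | A B C. A \<in> V \<and> B \<in> carrier_mat p q \<and> C \<in> W}"
proof (intro equalityI subsetI)
  fix M assume M: "M \<in> block_join V W"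
  obtain A B C where *: "M = four_block_mat A B (0\<^sub>m (dim_row C) (dim_col A)) C"
    "A \<in> V" "B \<in> carrier_mat (dim_row A) (dim_col C)" "C \<in> W" by (rule block_joinE[OF M])
  moreover have "A \<in> carrier_mat p p" "C \<in> carrier_mat q q" using * assms by auto
  ultimately show "M \<in> {four_block_mat A B (0\<^sub>m q p) C | A B C. A \<in> V \<and> B \<in> carrier_mat p q \<and> C \<in> W}" by auto
next
  fix M assume "M \<in> {four_block_mat A B (0\<^sub>m q p) C | A B C. A \<in> V \<and> B \<in> carrier_mat p q \<and> C \<in> W}"
  then obtain A B C where *: "M = four_block_mat A B (0\<^sub>m q p) C" "A \<in> V" "B \<in> carrier_mat p q" "C \<in> W" by blast
  moreover have "A \<in> carrier_mat p p" "C \<in> carrier_mat q q" using * assms by auto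
  ultimately show "M \<in> block_join V W" using block_joinI by metis
qed

text \<open>Block diagonal R and S apply the given equivalences to the diagonal blocks, and permute
  the upper right blocks by the bijection that sends B to R1 B S2.\<close>

lemma block_join_equivalent:
  fixes V1 :: "'a::field mat set"
  assumes V: "V1 \<subseteq> carrier_mat p p" "V2 \<subseteq> carrier_mat q q"
    and e1: "equivalent_sets p V1 V1'" and e2: "equivalent_sets q V2 V2'"
  shows "equivalent_sets (p + q) (block_join V1 V2) (block_join V1' V2')"
proof -
  obtain R1 S1 where RS1: "R1 \<in> GL p" "S1 \<in> GL p" "V1' = (\<lambda>M. R1 * M * S1) ` V1" using e1 by (auto simp: equivalent_sets_def)
  obtain R2 S2 where RS2: "R2 \<in> GL q" "S2 \<in> GL q" "V2' = (\<lambda>M. R2 * M * S2) ` V2" using e2 by (auto simp: equivalent_sets_def)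
  note c1 = GL_carrier[OF RS1(1)] GL_carrier[OF RS1(2)] and c2 = GL_carrier[OF RS2(1)] GL_carrier[OF RS2(2)]
  have V': "V1' \<subseteq> carrier_mat p p" "V2' \<subseteq> carrier_mat q q"
    unfolding RS1(3) RS2(3) using c1 c2 V by auto
  obtain R1' where R1': "R1' \<in> GL p" "R1 * R1' = 1\<^sub>m p" "R1' * R1 = 1\<^sub>m p" by (rule GL_inverse[OF RS1(1)])
  obtain S2' where S2': "S2' \<in> GL q" "S2 * S2' = 1\<^sub>m q" "S2' * S2 = 1\<^sub>m q" by (rule GL_inverse[OF RS2(2)])
  note c3 = GL_carrier[OF R1'(1)] GL_carrier[OF S2'(1)]
  define R where "R = four_block_mat R1 (0\<^sub>m p q) (0\<^sub>m q p) R2"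
  define S where "S = four_block_mat S1 (0\<^sub>m p q) (0\<^sub>m q p) S2"
  have RSG: "R \<in> GL (p + q)" "S \<in> GL (p + q)"
    unfolding R_def S_def using GL_block_triangular[of R1 p "0\<^sub>m p q" q R2] GL_block_triangular[of S1 p "0\<^sub>m p q" q S2]
      RS1 RS2 c1 c2 by auto
  have img: "R * four_block_mat A B (0\<^sub>m q p) C * S = four_block_mat (R1 * A * S1) (R1 * B * S2) (0\<^sub>m q p) (R2 * C * S2)"
    if A: "A \<in> carrier_mat p p" and B: "B \<in> carrier_mat p q" and C: "C \<in> carrier_mat q q" for A B C
  proof -
    have zB: "R1 * B + 0\<^sub>m p q * C = R1 * B" using c1 A B C by auto
    have zS: "R1 * A * 0\<^sub>m p q + R1 * B * S2 = R1 * B * S2"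
      using c1 c2 A B left_add_zero_mat[of "R1 * B * S2" p q] right_mult_zero_mat[of "R1 * A" p p q] by auto
    have "R * four_block_mat A B (0\<^sub>m q p) C = four_block_mat (R1 * A) (R1 * B) (0\<^sub>m q p) (R2 * C)"
      unfolding R_def using mult_block_triangular[OF c1(1) _ c2(1) A B C, of "0\<^sub>m p q"] zB by simp
    then show ?thesis
      unfolding S_def using mult_block_triangular[of "R1 * A" p "R1 * B" q "R2 * C" S1 "0\<^sub>m p q" S2] zS c1 c2 A B C by simp
  qed
  have "block_join V1' V2' = (\<lambda>M. R * M * S) ` block_join V1 V2"
  proof (intro equalityI subsetI)
    fix M assume "M \<in> block_join V1' V2'"
    then obtain A' B' C' where M: "M = four_block_mat A' B' (0\<^sub>m q p) C'" "A' \<in> V1'" "B' \<in> carrier_mat p q" "C' \<in> V2'"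
      unfolding block_join_elems[OF V'] by blast
    obtain A where A: "A \<in> V1" "A' = R1 * A * S1" using M(2) unfolding RS1(3) by blast
    obtain C where C: "C \<in> V2" "C' = R2 * C * S2" using M(4) unfolding RS2(3) by blast
    have Ac: "A \<in> carrier_mat p p" and Cc: "C \<in> carrier_mat q q" using A C V by auto
    define B where "B = R1' * B' * S2'"
    have Bc: "B \<in> carrier_mat p q" unfolding B_def using c3 M(3) by simp
    have "R1 * B * S2 = B'"
    proof -
      have "R1 * B = B' * S2'"
        unfolding B_def assoc_mult_mat[OF c3(1) M(3) c3(2)]
        by (rule cancel_mult_left[OF R1'(2) c1(1) c3(1) mult_carrier_mat[OF M(3) c3(2)]])
      then have "R1 * B * S2 = B' * (S2' * S2)" using assoc_mult_mat[OF M(3) c3(2) c2(2)] by simp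
      then show ?thesis using S2'(3) M(3) by simp
    qed
    then have "M = R * four_block_mat A B (0\<^sub>m q p) C * S" unfolding img[OF Ac Bc Cc] M(1) A(2) C(2) by simp
    moreover have "four_block_mat A B (0\<^sub>m q p) C \<in> block_join V1 V2" by (rule block_joinI[OF A(1) C(1) Ac Cc Bc])
    ultimately show "M \<in> (\<lambda>M. R * M * S) ` block_join V1 V2" by blast
  next
    fix M assume "M \<in> (\<lambda>M. R * M * S) ` block_join V1 V2"
    then obtain A B C where M: "M = R * four_block_mat A B (0\<^sub>m q p) C * S" "A \<in> V1" "B \<in> carrier_mat p q" "C \<in> V2"
      unfolding block_join_elems[OF V] by blast
    have Ac: "A \<in> carrier_mat p p" and Cc: "C \<in> carrier_mat q q" using M V by auto
    have a1: "R1 * A * S1 \<in> V1'" unfolding RS1(3) using M(2) by (rule imageI)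
    have a2: "R2 * C * S2 \<in> V2'" unfolding RS2(3) using M(4) by (rule imageI)
    show "M \<in> block_join V1' V2'"
      unfolding M(1) img[OF Ac M(3) Cc]
      by (rule block_joinI[OF a1 a2 subsetD[OF V'(1) a1] subsetD[OF V'(2) a2]
          mult_carrier_mat[OF mult_carrier_mat[OF c1(1) M(3)] c2(2)]])
  qed
  then show ?thesis unfolding equivalent_sets_def using RSG by blast
qed

lemma model_space_carrier:
  assumes "\<forall>P\<in>set Ps. P \<in> carrier_mat (dim_row P) (dim_row P)"
  shows "model_space (sum_list (map dim_row Ps)) Ps \<subseteq> carrier_mat (sum_list (map dim_row Ps)) (sum_list (map dim_row Ps))"
  using matrix_subspaceD(1)[OF matrix_subspace_block_model[OF assms]] by (auto simp: model_space_eq)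

lemma model_space_one_carrier:
  assumes "P \<in> carrier_mat p p"
  shows "model_space p [P] \<subseteq> carrier_mat p p"
  unfolding model_space_one[OF assms] using assms by (auto dest!: alternate_matsD)

lemma model_space_Cons:
  assumes P: "P \<in> carrier_mat p p" and Ps: "\<forall>P\<in>set Ps. P \<in> carrier_mat (dim_row P) (dim_row P)"
    and q: "q = sum_list (map dim_row Ps)"
  shows "model_space (p + q) (P # Ps) = block_join (model_space p [P]) (model_space q Ps)"
proof -
  have Wc: "(\<lambda>A. P * A) ` alternate_mats p \<subseteq> carrier_mat p p"
    using matrix_subspaceD(1)[OF matrix_subspace_mult_alternate[OF P]] .
  have Bc: "block_model Ps \<subseteq> carrier_mat q q"
    using matrix_subspaceD(1)[OF matrix_subspace_block_model[OF Ps]] q by simp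
  have m1: "model_space p [P] = (\<lambda>M. 1\<^sub>m p + M) ` (\<lambda>A. P * A) ` alternate_mats p"
    unfolding model_space_one[OF P] image_image ..
  have mc: "model_space p [P] \<subseteq> carrier_mat p p" "model_space q Ps \<subseteq> carrier_mat q q"
    unfolding m1 unfolding model_space_eq using Wc Bc by auto
  have dP: "dim_row P = p" using P by simp
  show ?thesis
    unfolding block_join_elems[OF mc] model_space_eq[of "p + q"] block_model_Cons dP block_join_elems[OF Wc Bc]
  proof (intro equalityI subsetI)
    fix N assume "N \<in> (\<lambda>M. 1\<^sub>m (p + q) + M) ` {four_block_mat A B (0\<^sub>m q p) C |A B C.
        A \<in> (\<lambda>A. P * A) ` alternate_mats p \<and> B \<in> carrier_mat p q \<and> C \<in> block_model Ps}"
    then obtain A B C where *: "N = 1\<^sub>m (p + q) + four_block_mat A B (0\<^sub>m q p) C"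
      "A \<in> (\<lambda>A. P * A) ` alternate_mats p" "B \<in> carrier_mat p q" "C \<in> block_model Ps" by blast
    then have "N = four_block_mat (1\<^sub>m p + A) B (0\<^sub>m q p) (1\<^sub>m q + C)"
      using one_plus_block[of A p B q C] Wc Bc by blast
    moreover have "1\<^sub>m p + A \<in> model_space p [P]" "1\<^sub>m q + C \<in> model_space q Ps"
      using *(2,4) unfolding m1 by (blast, simp add: model_space_eq)
    ultimately show "N \<in> {four_block_mat A B (0\<^sub>m q p) C |A B C.
      A \<in> model_space p [P] \<and> B \<in> carrier_mat p q \<and> C \<in> model_space q Ps}" using *(3) by blast
  next
    fix N assume "N \<in> {four_block_mat A B (0\<^sub>m q p) C |A B C.
      A \<in> model_space p [P] \<and> B \<in> carrier_mat p q \<and> C \<in> model_space q Ps}"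
    then obtain A' B C' where *: "N = four_block_mat A' B (0\<^sub>m q p) C'"
      "A' \<in> model_space p [P]" "B \<in> carrier_mat p q" "C' \<in> model_space q Ps" by blast
    obtain A where A: "A' = 1\<^sub>m p + A" "A \<in> (\<lambda>A. P * A) ` alternate_mats p" using *(2) unfolding m1 by blast
    obtain C where C: "C' = 1\<^sub>m q + C" "C \<in> block_model Ps" using *(4) unfolding model_space_eq by blast
    have "N = 1\<^sub>m (p + q) + four_block_mat A B (0\<^sub>m q p) C"
      unfolding *(1) A(1) C(1) using one_plus_block[of A p B q C] Wc Bc A(2) C(2) *(3) by (metis subsetD)
    then show "N \<in> (\<lambda>M. 1\<^sub>m (p + q) + M) ` {four_block_mat A B (0\<^sub>m q p) C |A B C.
        A \<in> (\<lambda>A. P * A) ` alternate_mats p \<and> B \<in> carrier_mat p q \<and> C \<in> block_model Ps}"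
      using A(2) C(2) *(3) by blast
  qed
qed

lemma similar_lists_equivalent:
  assumes "list_all2 (\<lambda>P Q. dim_row P = dim_row Q \<and> P \<in> GL (dim_row P) \<and> Q \<in> GL (dim_row Q) \<and>
      similar_forms (dim_row Q) (quad_form Q) (dim_row P) (quad_form P)) Ps (Qs :: 'a::field mat list)"
  shows "equivalent_sets (sum_list (map dim_row Ps)) (model_space (sum_list (map dim_row Ps)) Ps)
    (model_space (sum_list (map dim_row Ps)) Qs)"
  using assms
proof (induction Ps Qs rule: list_all2_induct)
  case Nil
  have "1\<^sub>m 0 \<in> (GL 0 :: 'a mat set)" by (simp add: GL_iff_det)
  moreover have "model_space 0 [] = (\<lambda>M. 1\<^sub>m 0 * M * 1\<^sub>m 0) ` (model_space 0 [] :: 'a mat set)"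
    by (auto simp: model_space_eq block_model_Nil)
  ultimately show ?case unfolding equivalent_sets_def by auto
next
  case (Cons P Ps Q Qs)
  let ?p = "dim_row P" and ?q = "sum_list (map dim_row Ps)"
  have PQ: "P \<in> GL ?p" "Q \<in> GL ?p" and pQ: "dim_row Q = ?p" and sim: "similar_forms ?p (quad_form Q) ?p (quad_form P)"
    using Cons.hyps by auto
  have q: "?q = sum_list (map dim_row Qs)" using Cons.hyps(2) by (induction rule: list_all2_induct) auto
  have Psc: "\<forall>P\<in>set Ps. P \<in> carrier_mat (dim_row P) (dim_row P)"
    using Cons.hyps(2) by (induction rule: list_all2_induct) (auto intro: GL_carrier simp del: carrier_matD)
  have Qsc: "\<forall>P\<in>set Qs. P \<in> carrier_mat (dim_row P) (dim_row P)"
    using Cons.hyps(2) by (induction rule: list_all2_induct) (auto intro: GL_carrier simp del: carrier_matD)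
  obtain c where c: "c \<noteq> 0" "isometric_forms ?p (\<lambda>X. c * quad_form Q X) ?p (quad_form P)"
    using sim unfolding similar_forms_def by blast
  obtain G where G: "G \<in> GL ?p" "\<And>X. X \<in> carrier_vec ?p \<Longrightarrow> quad_form P (G *\<^sub>v X) = c * quad_form Q X"
    using isometric_formsE[OF c(2)] by blast
  have e1: "equivalent_sets ?p (model_space ?p [P]) (model_space ?p [Q])"
    by (rule one_block_equivalent[OF PQ G(1) c(1) G(2)])
  have mP: "model_space ?p [P] \<subseteq> carrier_mat ?p ?p"
    by (rule model_space_one_carrier[OF GL_carrier[OF PQ(1)]])
  show ?case
    using block_join_equivalent[OF mP model_space_carrier[OF Psc] e1 Cons.IH]
    unfolding model_space_Cons[OF GL_carrier[OF PQ(1)] Psc refl, symmetric]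
      model_space_Cons[OF GL_carrier[OF PQ(2)] Qsc q, symmetric] by simp
qed

section \<open>The first block is determined by the space\<close>

definition orbit :: "'a::field mat set \<Rightarrow> 'a vec \<Rightarrow> 'a vec set" where
  "orbit W x = (\<lambda>M. M *\<^sub>v x) ` W"

text \<open>Equivalent linear spaces have the same inclusions between orbits, so this singles out
  the first block without reference to coordinates.\<close>

definition minimal_orbit :: "nat \<Rightarrow> 'a::field mat set \<Rightarrow> 'a vec \<Rightarrow> bool" where
  "minimal_orbit n W x \<longleftrightarrow> (\<forall>y\<in>carrier_vec n. y \<noteq> 0\<^sub>v n \<longrightarrow> \<not> orbit W y \<subset> orbit W x)"

lemma zero_mult_vec: "v \<in> carrier_vec m \<Longrightarrow> 0\<^sub>m n m *\<^sub>v v = (0\<^sub>v n :: 'a::field vec)"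
  by (intro eq_vecI) auto

lemma mult_vec_zero: "A \<in> carrier_mat n m \<Longrightarrow> A *\<^sub>v 0\<^sub>v m = (0\<^sub>v n :: 'a::field vec)"
  by (intro eq_vecI) auto

lemma append_vec_inject:
  assumes "a @\<^sub>v d = a' @\<^sub>v d'" "a \<in> carrier_vec p" "a' \<in> carrier_vec p" "d \<in> carrier_vec q" "d' \<in> carrier_vec q"
  shows "a = a'" "d = d'"
proof -
  have e: "(a @\<^sub>v d) $ i = (a' @\<^sub>v d') $ i" for i using assms(1) by simp
  show "a = a'"
  proof (rule eq_vecI)
    fix i assume "i < dim_vec a'" then show "a $ i = a' $ i" using e[of i] assms(2-) by simp
  qed (use assms in auto)
  show "d = d'"
  proof (rule eq_vecI)
    fix i assume "i < dim_vec d'" then show "d $ i = d' $ i" using e[of "p + i"] assms(2-) by simp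
  qed (use assms in auto)
qed

lemma append_zero_vec: "(0\<^sub>v p :: 'a::zero vec) @\<^sub>v 0\<^sub>v q = 0\<^sub>v (p + q)"
  by (intro eq_vecI) auto

locale first_block =
  fixes P :: "'a::field mat" and p :: nat and Ps :: "'a mat list" and q :: nat
  assumes P: "non_isotropic p P" and p: "0 < p"
    and Ps: "\<forall>P\<in>set Ps. P \<in> carrier_mat (dim_row P) (dim_row P)"
    and q: "q = sum_list (map dim_row Ps)"
begin

lemma Pc: "P \<in> carrier_mat p p" using P by (simp add: non_isotropic_def)

lemma tail: "matrix_subspace q (block_model Ps)"
  unfolding q by (rule matrix_subspace_block_model[OF Ps])

lemmas tailD = matrix_subspaceD[OF tail]

lemma model_elems: "block_model (P # Ps) = {four_block_mat (P * A) B (0\<^sub>m q p) C | A B C.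
    A \<in> alternate_mats p \<and> B \<in> carrier_mat p q \<and> C \<in> block_model Ps}"
proof -
  have dP: "dim_row P = p" using Pc by simp
  show ?thesis
    unfolding block_model_Cons dP
      block_join_elems[OF matrix_subspaceD(1)[OF matrix_subspace_mult_alternate[OF Pc]] tailD(1)]
    by blast
qed

lemma model_mult_vec:
  assumes A: "A \<in> alternate_mats p" and B: "B \<in> carrier_mat p q" and C: "C \<in> block_model Ps"
    and a: "a \<in> carrier_vec p" and d: "d \<in> carrier_vec q"
  shows "four_block_mat (P * A) B (0\<^sub>m q p) C *\<^sub>v (a @\<^sub>v d) = (P *\<^sub>v (A *\<^sub>v a) + B *\<^sub>v d) @\<^sub>v (C *\<^sub>v d)"
proof -
  have Ac: "A \<in> carrier_mat p p" by (rule alternate_matsD[OF A])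
  have Cc: "C \<in> carrier_mat q q" using tailD(1) C by blast
  have "four_block_mat (P * A) B (0\<^sub>m q p) C *\<^sub>v (a @\<^sub>v d)
      = ((P * A) *\<^sub>v a + B *\<^sub>v d) @\<^sub>v (0\<^sub>m q p *\<^sub>v a + C *\<^sub>v d)"
    using Pc Ac B Cc a d by (intro four_block_mat_mult_vec) auto
  also have "(P * A) *\<^sub>v a = P *\<^sub>v (A *\<^sub>v a)" using Pc Ac a by (rule assoc_mult_mat_vec)
  also have "0\<^sub>m q p *\<^sub>v a + C *\<^sub>v d = C *\<^sub>v d" unfolding zero_mult_vec[OF a] using Cc d by simp
  finally show ?thesis .
qed

lemma orbit_elems:
  assumes a: "a \<in> carrier_vec p" and d: "d \<in> carrier_vec q"
  shows "orbit (block_model (P # Ps)) (a @\<^sub>v d) = {(P *\<^sub>v (A *\<^sub>v a) + B *\<^sub>v d) @\<^sub>v (C *\<^sub>v d) | A B C.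
    A \<in> alternate_mats p \<and> B \<in> carrier_mat p q \<and> C \<in> block_model Ps}"
proof (intro equalityI subsetI)
  fix z assume "z \<in> orbit (block_model (P # Ps)) (a @\<^sub>v d)"
  then obtain M where M: "M \<in> block_model (P # Ps)" "z = M *\<^sub>v (a @\<^sub>v d)" unfolding orbit_def by blast
  obtain A B C where *: "M = four_block_mat (P * A) B (0\<^sub>m q p) C"
    "A \<in> alternate_mats p" "B \<in> carrier_mat p q" "C \<in> block_model Ps" using M(1) unfolding model_elems by blast
  have "z = (P *\<^sub>v (A *\<^sub>v a) + B *\<^sub>v d) @\<^sub>v (C *\<^sub>v d)" unfolding M(2) *(1) by (rule model_mult_vec[OF *(2-4) a d])
  then show "z \<in> {(P *\<^sub>v (A *\<^sub>v a) + B *\<^sub>v d) @\<^sub>v (C *\<^sub>v d) | A B C.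
    A \<in> alternate_mats p \<and> B \<in> carrier_mat p q \<and> C \<in> block_model Ps}" using *(2-4) by blast
next
  fix z assume "z \<in> {(P *\<^sub>v (A *\<^sub>v a) + B *\<^sub>v d) @\<^sub>v (C *\<^sub>v d) | A B C.
    A \<in> alternate_mats p \<and> B \<in> carrier_mat p q \<and> C \<in> block_model Ps}"
  then obtain A B C where z: "z = (P *\<^sub>v (A *\<^sub>v a) + B *\<^sub>v d) @\<^sub>v (C *\<^sub>v d)"
    and *: "A \<in> alternate_mats p" "B \<in> carrier_mat p q" "C \<in> block_model Ps" by blast
  have "four_block_mat (P * A) B (0\<^sub>m q p) C \<in> block_model (P # Ps)" unfolding model_elems using * by blast
  then show "z \<in> orbit (block_model (P # Ps)) (a @\<^sub>v d)"
    unfolding z model_mult_vec[OF * a d, symmetric] orbit_def by (rule imageI)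
qed

text \<open>The upper right block B is arbitrary, and B d takes every value as soon as d is nonzero;
  the diagonal blocks are taken to be zero.\<close>

lemma orbit_top:
  assumes a: "a \<in> carrier_vec p" and d: "d \<in> carrier_vec q" "d \<noteq> 0\<^sub>v q" and z: "z \<in> carrier_vec p"
  shows "z @\<^sub>v 0\<^sub>v q \<in> orbit (block_model (P # Ps)) (a @\<^sub>v d)"
proof -
  have "\<exists>k<q. d $ k \<noteq> 0"
  proof (rule ccontr)
    assume "\<not> (\<exists>k<q. d $ k \<noteq> 0)"
    then have "d = 0\<^sub>v q" using d(1) by (intro eq_vecI) auto
    then show False using d(2) by contradiction
  qed
  then obtain k where k: "k < q" "d $ k \<noteq> 0" by blast
  define B where "B = mat p q (\<lambda>(i, j). if j = k then z $ i / d $ k else 0)"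
  have Bc: "B \<in> carrier_mat p q" by (simp add: B_def)
  have "B *\<^sub>v d = z"
  proof (rule eq_vecI)
    fix i assume "i < dim_vec z"
    then have i: "i < p" using z by simp
    have "(B *\<^sub>v d) $ i = (\<Sum>j<q. (if j = k then z $ i / d $ k else 0) * d $ j)"
      using i d(1) by (simp add: B_def scalar_prod_def lessThan_atLeast0)
    also have "\<dots> = (\<Sum>j<q. if j = k then z $ i else 0)" using k by (intro sum.cong) auto
    also have "\<dots> = z $ i" using k by simp
    finally show "(B *\<^sub>v d) $ i = z $ i" .
  qed (use z Bc in auto)
  moreover have "P *\<^sub>v (0\<^sub>m p p *\<^sub>v a) = 0\<^sub>v p" unfolding zero_mult_vec[OF a] by (rule mult_vec_zero[OF Pc])
  moreover have "0\<^sub>m q q *\<^sub>v d = 0\<^sub>v q" by (rule zero_mult_vec[OF d(1)])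
  ultimately have "z @\<^sub>v 0\<^sub>v q = (P *\<^sub>v (0\<^sub>m p p *\<^sub>v a) + B *\<^sub>v d) @\<^sub>v (0\<^sub>m q q *\<^sub>v d)" using z by simp
  then show ?thesis unfolding orbit_elems[OF a d(1)] using alternate_mats_closed(1) Bc tailD(2) by blast
qed

lemma orbit_bottom_iff:
  assumes a: "a \<in> carrier_vec p"
  shows "z \<in> orbit (block_model (P # Ps)) (a @\<^sub>v 0\<^sub>v q) \<longleftrightarrow> (\<exists>A\<in>alternate_mats p. z = (P *\<^sub>v (A *\<^sub>v a)) @\<^sub>v 0\<^sub>v q)"
proof -
  have e: "(P *\<^sub>v (A *\<^sub>v a) + B *\<^sub>v 0\<^sub>v q) @\<^sub>v (C *\<^sub>v 0\<^sub>v q) = (P *\<^sub>v (A *\<^sub>v a)) @\<^sub>v 0\<^sub>v q"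
    if "A \<in> alternate_mats p" "B \<in> carrier_mat p q" "C \<in> block_model Ps" for A B C
  proof -
    have Cc: "C \<in> carrier_mat q q" using tailD(1) that by blast
    show ?thesis unfolding mult_vec_zero[OF that(2)] mult_vec_zero[OF Cc]
      using Pc alternate_matsD[OF that(1)] a by simp
  qed
  have orb: "orbit (block_model (P # Ps)) (a @\<^sub>v 0\<^sub>v q) = {(P *\<^sub>v (A *\<^sub>v a) + B *\<^sub>v 0\<^sub>v q) @\<^sub>v (C *\<^sub>v 0\<^sub>v q) | A B C.
    A \<in> alternate_mats p \<and> B \<in> carrier_mat p q \<and> C \<in> block_model Ps}" by (rule orbit_elems[OF a]) simp
  show ?thesis
  proof
    assume "z \<in> orbit (block_model (P # Ps)) (a @\<^sub>v 0\<^sub>v q)"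
    then obtain A B C where *: "z = (P *\<^sub>v (A *\<^sub>v a) + B *\<^sub>v 0\<^sub>v q) @\<^sub>v (C *\<^sub>v 0\<^sub>v q)"
      "A \<in> alternate_mats p" "B \<in> carrier_mat p q" "C \<in> block_model Ps" unfolding orb by blast
    then show "\<exists>A\<in>alternate_mats p. z = (P *\<^sub>v (A *\<^sub>v a)) @\<^sub>v 0\<^sub>v q" using e[OF *(2-4)] by auto
  next
    assume "\<exists>A\<in>alternate_mats p. z = (P *\<^sub>v (A *\<^sub>v a)) @\<^sub>v 0\<^sub>v q"
    then obtain A where A: "A \<in> alternate_mats p" "z = (P *\<^sub>v (A *\<^sub>v a)) @\<^sub>v 0\<^sub>v q" by blast
    show "z \<in> orbit (block_model (P # Ps)) (a @\<^sub>v 0\<^sub>v q)"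
      unfolding orb A(2) e[OF A(1) zero_carrier_mat tailD(2), symmetric]
      using A(1) zero_carrier_mat[of p q] tailD(2) by blast
  qed
qed

text \<open>If a = P A a, then I + P (- A) would be singular.\<close>

lemma not_in_own_orbit:
  assumes a: "a \<in> carrier_vec p" "a \<noteq> 0\<^sub>v p"
  shows "a @\<^sub>v 0\<^sub>v q \<notin> orbit (block_model (P # Ps)) (a @\<^sub>v 0\<^sub>v q)"
proof
  assume "a @\<^sub>v 0\<^sub>v q \<in> orbit (block_model (P # Ps)) (a @\<^sub>v 0\<^sub>v q)"
  then obtain A where A: "A \<in> alternate_mats p" "a @\<^sub>v 0\<^sub>v q = (P *\<^sub>v (A *\<^sub>v a)) @\<^sub>v 0\<^sub>v q"
    unfolding orbit_bottom_iff[OF a(1)] by blast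
  have Ac: "A \<in> carrier_mat p p" by (rule alternate_matsD[OF A(1)])
  have Aa: "P *\<^sub>v (A *\<^sub>v a) = a"
    by (rule append_vec_inject(1)[OF A(2), of p q, symmetric]) (use Pc Ac a in auto)
  let ?D = "1\<^sub>m p + P * ((- 1) \<cdot>\<^sub>m A)"
  have D: "?D \<in> GL p" by (rule one_plus_mult_alternate_GL[OF P alternate_mats_closed(3)[OF A(1)]])
  have "P * ((- 1) \<cdot>\<^sub>m A) = (- 1) \<cdot>\<^sub>m (P * A)" using Pc Ac by (rule mult_smult_distrib)
  then have "?D *\<^sub>v a = a + (- 1) \<cdot>\<^sub>v ((P * A) *\<^sub>v a)"
    using Pc Ac a(1) by (simp add: add_mult_distrib_mat_vec[of _ p p] smult_mat_mult_vec[of _ p p] del: assoc_mult_mat_vec)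
  also have "(P * A) *\<^sub>v a = a" unfolding assoc_mult_mat_vec[OF Pc Ac a(1)] by (rule Aa)
  also have "a + (- 1) \<cdot>\<^sub>v a = 0\<^sub>v p" using a(1) by (intro eq_vecI) auto
  finally have "det ?D = 0" using det_0_iff_vec_prod_zero_field[OF GL_carrier[OF D]] a by blast
  then show False using D by (simp add: GL_iff_det)
qed

text \<open>If d is nonzero, the orbit strictly contains that of (e, 0), which misses (e, 0) itself.
  If d = 0 and the orbit of (a', d') is strictly smaller, then d' = 0, and each A a' is of the form
  A' a with A' alternate, hence orthogonal to a. Taking elementary alternate matrices for A, this
  makes a a multiple of a', so that the orbit of a is contained in that of a' after all.\<close>

lemma minimal_orbit_iff:
  assumes a: "a \<in> carrier_vec p" and d: "d \<in> carrier_vec q" and nz: "a @\<^sub>v d \<noteq> 0\<^sub>v (p + q)"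
  shows "minimal_orbit (p + q) (block_model (P # Ps)) (a @\<^sub>v d) \<longleftrightarrow> d = 0\<^sub>v q"
proof
  let ?W = "block_model (P # Ps)"
  assume min: "minimal_orbit (p + q) ?W (a @\<^sub>v d)"
  show "d = 0\<^sub>v q"
  proof (rule ccontr)
    assume dn: "d \<noteq> 0\<^sub>v q"
    let ?e = "unit_vec p 0 :: 'a vec"
    have e: "?e \<in> carrier_vec p" by simp
    have en: "?e \<noteq> 0\<^sub>v p" using p by (metis index_unit_vec(1) index_zero_vec(1) zero_neq_one)
    have yc: "?e @\<^sub>v 0\<^sub>v q \<in> carrier_vec (p + q)" by simp
    have yn: "?e @\<^sub>v 0\<^sub>v q \<noteq> 0\<^sub>v (p + q)"
      using append_vec_inject(1)[of ?e "0\<^sub>v q" "0\<^sub>v p" "0\<^sub>v q" p q] en by (auto simp: append_zero_vec)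
    have "orbit ?W (?e @\<^sub>v 0\<^sub>v q) \<subseteq> orbit ?W (a @\<^sub>v d)"
    proof
      fix z assume "z \<in> orbit ?W (?e @\<^sub>v 0\<^sub>v q)"
      then obtain A where A: "A \<in> alternate_mats p" "z = (P *\<^sub>v (A *\<^sub>v ?e)) @\<^sub>v 0\<^sub>v q"
        unfolding orbit_bottom_iff[OF e] by blast
      show "z \<in> orbit ?W (a @\<^sub>v d)"
        unfolding A(2) by (rule orbit_top[OF a d dn]) (use Pc alternate_matsD[OF A(1)] in auto)
    qed
    moreover have "?e @\<^sub>v 0\<^sub>v q \<in> orbit ?W (a @\<^sub>v d)" by (rule orbit_top[OF a d dn e])
    moreover have "?e @\<^sub>v 0\<^sub>v q \<notin> orbit ?W (?e @\<^sub>v 0\<^sub>v q)" by (rule not_in_own_orbit[OF e en])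
    ultimately have "orbit ?W (?e @\<^sub>v 0\<^sub>v q) \<subset> orbit ?W (a @\<^sub>v d)" by blast
    then show False using min yc yn unfolding minimal_orbit_def by blast
  qed
next
  let ?W = "block_model (P # Ps)"
  assume d0: "d = 0\<^sub>v q"
  have an: "a \<noteq> 0\<^sub>v p" using nz unfolding d0 by (auto simp: append_zero_vec)
  obtain P1 where P1: "P1 \<in> GL p" "P * P1 = 1\<^sub>m p" "P1 * P = 1\<^sub>m p" by (rule GL_inverse[OF non_isotropic_GL[OF P]])
  show "minimal_orbit (p + q) ?W (a @\<^sub>v d)"
    unfolding minimal_orbit_def d0
  proof (intro ballI impI notI)
    fix y assume y: "y \<in> carrier_vec (p + q)" "y \<noteq> 0\<^sub>v (p + q)" and sub: "orbit ?W y \<subset> orbit ?W (a @\<^sub>v 0\<^sub>v q)"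
    define a' d' where "a' = vec_first y p" and "d' = vec_last y q"
    have y_eq: "y = a' @\<^sub>v d'" unfolding a'_def d'_def using y(1) by simp
    have a': "a' \<in> carrier_vec p" and d': "d' \<in> carrier_vec q" by (simp_all add: a'_def d'_def)
    have d'0: "d' = 0\<^sub>v q"
    proof (rule ccontr)
      assume "d' \<noteq> 0\<^sub>v q"
      then have "a @\<^sub>v 0\<^sub>v q \<in> orbit ?W y" unfolding y_eq by (rule orbit_top[OF a' d' _ a])
      then show False using sub not_in_own_orbit[OF a an] by blast
    qed
    have a'n: "a' \<noteq> 0\<^sub>v p" using y(2) unfolding y_eq d'0 by (auto simp: append_zero_vec)
    have ort: "a \<bullet> (A *\<^sub>v a') = 0" if A: "A \<in> alternate_mats p" for A
    proof -
      have "(P *\<^sub>v (A *\<^sub>v a')) @\<^sub>v 0\<^sub>v q \<in> orbit ?W y" unfolding y_eq d'0 orbit_bottom_iff[OF a'] using A by blast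
      then have "(P *\<^sub>v (A *\<^sub>v a')) @\<^sub>v 0\<^sub>v q \<in> orbit ?W (a @\<^sub>v 0\<^sub>v q)" using sub by blast
      then obtain A' where A': "A' \<in> alternate_mats p" "(P *\<^sub>v (A *\<^sub>v a')) @\<^sub>v 0\<^sub>v q = (P *\<^sub>v (A' *\<^sub>v a)) @\<^sub>v 0\<^sub>v q"
        unfolding orbit_bottom_iff[OF a] by blast
      have Ac: "A *\<^sub>v a' \<in> carrier_vec p" "A' *\<^sub>v a \<in> carrier_vec p"
        using alternate_matsD[OF A] alternate_matsD[OF A'(1)] a a' by auto
      have "P *\<^sub>v (A *\<^sub>v a') = P *\<^sub>v (A' *\<^sub>v a)"
        by (rule append_vec_inject(1)[OF A'(2), of p q]) (use Pc Ac in auto)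
      then have "P1 *\<^sub>v (P *\<^sub>v (A *\<^sub>v a')) = P1 *\<^sub>v (P *\<^sub>v (A' *\<^sub>v a))" by simp
      then have "A *\<^sub>v a' = A' *\<^sub>v a"
        unfolding cancel_mult_vec[OF P1(3) GL_carrier[OF P1(1)] Pc Ac(1)] cancel_mult_vec[OF P1(3) GL_carrier[OF P1(1)] Pc Ac(2)] .
      then show ?thesis using A'(1) a by (simp add: alternate_mats_def)
    qed
    have cross: "a $ i * a' $ j = a $ j * a' $ i" if "i < p" "j < p" for i j
      using ort[OF elem_alternate[OF that]] elem_alternate_mult[OF that a a'] by simp
    have "\<exists>k<p. a' $ k \<noteq> 0"
    proof (rule ccontr)
      assume "\<not> (\<exists>k<p. a' $ k \<noteq> 0)"
      then have "a' = 0\<^sub>v p" using a' by (intro eq_vecI) auto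
      then show False using a'n by contradiction
    qed
    then obtain k where k: "k < p" "a' $ k \<noteq> 0" by blast
    define c where "c = a $ k / a' $ k"
    have a_eq: "a = c \<cdot>\<^sub>v a'"
    proof (rule eq_vecI)
      fix i assume "i < dim_vec (c \<cdot>\<^sub>v a')"
      then have i: "i < p" using a' by simp
      then show "a $ i = (c \<cdot>\<^sub>v a') $ i" using cross[OF i k(1)] k(2) a' by (simp add: c_def field_simps)
    qed (use a a' in auto)
    have "orbit ?W (a @\<^sub>v 0\<^sub>v q) \<subseteq> orbit ?W y"
    proof
      fix z assume "z \<in> orbit ?W (a @\<^sub>v 0\<^sub>v q)"
      then obtain A where A: "A \<in> alternate_mats p" "z = (P *\<^sub>v (A *\<^sub>v a)) @\<^sub>v 0\<^sub>v q"
        unfolding orbit_bottom_iff[OF a] by blast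
      have Ac: "A \<in> carrier_mat p p" by (rule alternate_matsD[OF A(1)])
      have "A *\<^sub>v a = (c \<cdot>\<^sub>m A) *\<^sub>v a'"
        unfolding a_eq smult_mat_mult_vec[OF Ac a'] by (rule mult_mat_vec[OF Ac a'])
      then show "z \<in> orbit ?W y"
        unfolding y_eq d'0 orbit_bottom_iff[OF a'] A(2) using alternate_mats_closed(3)[OF A(1)] by auto
    qed
    then show False using sub by blast
  qed
qed

lemma minimal_orbit_iff':
  assumes x: "x \<in> carrier_vec (p + q)" "x \<noteq> 0\<^sub>v (p + q)"
  shows "minimal_orbit (p + q) (block_model (P # Ps)) x \<longleftrightarrow> (\<forall>i. p \<le> i \<longrightarrow> i < p + q \<longrightarrow> x $ i = 0)"
proof -
  define a d where "a = vec_first x p" and "d = vec_last x q"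
  have x_eq: "x = a @\<^sub>v d" unfolding a_def d_def using x(1) by simp
  have a: "a \<in> carrier_vec p" and d: "d \<in> carrier_vec q" by (simp_all add: a_def d_def)
  have "minimal_orbit (p + q) (block_model (P # Ps)) x \<longleftrightarrow> d = 0\<^sub>v q"
    using minimal_orbit_iff[OF a d] x(2) unfolding x_eq by blast
  also have "\<dots> \<longleftrightarrow> (\<forall>i. p \<le> i \<longrightarrow> i < p + q \<longrightarrow> x $ i = 0)"
  proof
    assume d0: "d = 0\<^sub>v q"
    show "\<forall>i. p \<le> i \<longrightarrow> i < p + q \<longrightarrow> x $ i = 0" unfolding x_eq d0 using a by auto
  next
    assume z: "\<forall>i. p \<le> i \<longrightarrow> i < p + q \<longrightarrow> x $ i = 0"
    show "d = 0\<^sub>v q"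
    proof (rule eq_vecI)
      fix i assume "i < dim_vec (0\<^sub>v q :: 'a vec)"
      then have i: "i < q" by simp
      then have "x $ (p + i) = 0" using z by simp
      moreover have "x $ (p + i) = d $ i" unfolding x_eq using a d i by simp
      ultimately show "d $ i = 0\<^sub>v q $ i" using i by simp
    qed (use d in simp)
  qed
  finally show ?thesis .
qed

end

text \<open>The orbit of z under W' is R applied to the orbit of S z under W, and R is
  injective.\<close>

lemma minimal_orbit_equivalent:
  fixes W :: "'a::field mat set"
  assumes R: "R \<in> GL n" and S: "S \<in> GL n" and W: "W \<subseteq> carrier_mat n n"
    and W': "W' = (\<lambda>M. R * M * S) ` W" and x: "x \<in> carrier_vec n"
    and min: "minimal_orbit n W' x"
  shows "minimal_orbit n W (S *\<^sub>v x)"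
  unfolding minimal_orbit_def
proof (intro ballI impI notI)
  fix y assume y: "y \<in> carrier_vec n" "y \<noteq> 0\<^sub>v n" and sub: "orbit W y \<subset> orbit W (S *\<^sub>v x)"
  note Rc = GL_carrier[OF R] and Sc = GL_carrier[OF S]
  obtain S1 where S1: "S1 \<in> GL n" "S * S1 = 1\<^sub>m n" "S1 * S = 1\<^sub>m n" by (rule GL_inverse[OF S])
  obtain R1 where R1: "R1 \<in> GL n" "R * R1 = 1\<^sub>m n" "R1 * R = 1\<^sub>m n" by (rule GL_inverse[OF R])
  note S1c = GL_carrier[OF S1(1)] and R1c = GL_carrier[OF R1(1)]
  have orb: "orbit W' z = (\<lambda>v. R *\<^sub>v v) ` orbit W (S *\<^sub>v z)" if z: "z \<in> carrier_vec n" for z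
  proof -
    have "(R * M * S) *\<^sub>v z = R *\<^sub>v (M *\<^sub>v (S *\<^sub>v z))" if "M \<in> W" for M
    proof -
      have M: "M \<in> carrier_mat n n" using W that by blast
      show ?thesis using Rc M Sc z by (simp add: assoc_mult_mat_vec[of _ n n _ n] mult_carrier_mat[of _ n n _ n])
    qed
    then show ?thesis unfolding orbit_def W' image_image by (intro image_cong) auto
  qed
  let ?y = "S1 *\<^sub>v y"
  have yc: "?y \<in> carrier_vec n" using S1c y by simp
  have Sy: "S *\<^sub>v ?y = y" by (rule cancel_mult_vec[OF S1(2) Sc S1c y(1)])
  have yn: "?y \<noteq> 0\<^sub>v n" using Sy y(2) mult_vec_zero[OF Sc] by metis
  have oc: "orbit W z \<subseteq> carrier_vec n" if "z \<in> carrier_vec n" for z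
    unfolding orbit_def using W that by auto
  have Sx: "S *\<^sub>v x \<in> carrier_vec n" using Sc x by simp
  have "inj_on (\<lambda>v. R *\<^sub>v v) (carrier_vec n)"
    by (rule inj_on_inverseI[of _ "\<lambda>v. R1 *\<^sub>v v"]) (rule cancel_mult_vec[OF R1(3) R1c Rc])
  then have "inj_on (\<lambda>v. R *\<^sub>v v) (orbit W (S *\<^sub>v x))" using oc[OF Sx] by (rule inj_on_subset)
  then have "(\<lambda>v. R *\<^sub>v v) ` orbit W y \<subset> (\<lambda>v. R *\<^sub>v v) ` orbit W (S *\<^sub>v x)"
    using sub by (rule image_strict_mono)
  then have "orbit W' ?y \<subset> orbit W' x" unfolding orb[OF yc] orb[OF x] Sy .
  then show False using min yc yn unfolding minimal_orbit_def by blast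
qed

text \<open>If a > b, row b of the upper left a by a block, counted from 0, is zero. So this block
  kills some x, and S kills x padded with zeros, since the rows from a on vanish in the first a
  columns.\<close>

lemma GL_zero_block_le:
  fixes S :: "'a::field mat"
  assumes S: "S \<in> GL n" and a: "a \<le> n" and z: "\<And>i j. b \<le> i \<Longrightarrow> i < n \<Longrightarrow> j < a \<Longrightarrow> S $$ (i, j) = 0"
  shows "a \<le> b"
proof (rule ccontr)
  assume ab: "\<not> a \<le> b"
  note Sc = GL_carrier[OF S]
  define T where "T = mat a a (\<lambda>(i, j). S $$ (i, j))"
  have Tc: "T \<in> carrier_mat a a" by (simp add: T_def)
  have "transpose_mat T *\<^sub>v unit_vec a b = 0\<^sub>v a"
  proof (rule eq_vecI)
    fix j assume "j < dim_vec (0\<^sub>v a :: 'a vec)"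
    then have j: "j < a" by simp
    have "(transpose_mat T *\<^sub>v unit_vec a b) $ j = col T j \<bullet> unit_vec a b" using j Tc by simp
    also have "\<dots> = col T j $ b" using Tc ab by (intro scalar_prod_right_unit) auto
    also have "\<dots> = 0" using z[of b j] ab a j by (simp add: T_def)
    finally show "(transpose_mat T *\<^sub>v unit_vec a b) $ j = 0\<^sub>v a $ j" using j by simp
  qed (use Tc in simp)
  moreover have "unit_vec a b \<noteq> (0\<^sub>v a :: 'a vec)" using ab by (metis index_unit_vec(1) index_zero_vec(1) not_le zero_neq_one)
  ultimately have "\<exists>v. v \<in> carrier_vec a \<and> v \<noteq> 0\<^sub>v a \<and> transpose_mat T *\<^sub>v v = 0\<^sub>v a"
    using unit_vec_carrier[of a b] by blast
  then have "det (transpose_mat T) = 0"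
    using det_0_iff_vec_prod_zero_field[of "transpose_mat T" a] Tc by simp
  then have "det T = 0" using det_transpose[OF Tc] by simp
  then obtain x where x: "x \<in> carrier_vec a" "x \<noteq> 0\<^sub>v a" "T *\<^sub>v x = 0\<^sub>v a"
    using det_0_iff_vec_prod_zero_field[OF Tc] by blast
  define y where "y = vec n (\<lambda>i. if i < a then x $ i else 0)"
  have y: "y \<in> carrier_vec n" by (simp add: y_def)
  have "S *\<^sub>v y = 0\<^sub>v n"
  proof (rule eq_vecI)
    fix i assume "i < dim_vec (0\<^sub>v n :: 'a vec)"
    then have i: "i < n" by simp
    have "(S *\<^sub>v y) $ i = (\<Sum>j<n. S $$ (i, j) * (if j < a then x $ j else 0))"
      using i Sc by (simp add: y_def scalar_prod_def lessThan_atLeast0)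
    also have "\<dots> = (\<Sum>j<a. S $$ (i, j) * x $ j)"
      using a by (intro sum.mono_neutral_cong_right) auto
    also have "\<dots> = 0"
    proof (cases "i < a")
      case True
      have "(T *\<^sub>v x) $ i = (\<Sum>j<a. S $$ (i, j) * x $ j)"
        using True x(1) by (simp add: T_def scalar_prod_def lessThan_atLeast0)
      then show ?thesis using x(3) True by simp
    next
      case False
      then show ?thesis using z i ab by (intro sum.neutral) auto
    qed
    finally show "(S *\<^sub>v y) $ i = 0\<^sub>v n $ i" using i by simp
  qed (use Sc in simp)
  moreover have "y \<noteq> 0\<^sub>v n"
  proof
    assume y0: "y = 0\<^sub>v n"
    have "x $ i = 0" if "i < a" for i
      using arg_cong[OF y0, of "\<lambda>v. v $ i"] that a by (simp add: y_def)
    then have "x = 0\<^sub>v a" using x(1) by (intro eq_vecI) auto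
    then show False using x(2) by contradiction
  qed
  ultimately have "det S = 0" using det_0_iff_vec_prod_zero_field[OF Sc] y by blast
  then show False using S by (simp add: GL_iff_det)
qed

lemma block_triangular_form:
  fixes S :: "'a::field mat"
  assumes S: "S \<in> carrier_mat (p + q) (p + q)" and z: "\<And>i j. p \<le> i \<Longrightarrow> i < p + q \<Longrightarrow> j < p \<Longrightarrow> S $$ (i, j) = 0"
  obtains S1 S2 S3 where "S = four_block_mat S1 S2 (0\<^sub>m q p) S3" "S1 \<in> carrier_mat p p" "S2 \<in> carrier_mat p q" "S3 \<in> carrier_mat q q"
proof -
  obtain S1 S2 S4 S3 where sp: "split_block S p p = (S1, S2, S4, S3)" by (metis prod_cases4)
  note sb = split_block[OF sp, of q q]
  have dims: "dim_row S = p + q" "dim_col S = p + q" using S by auto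
  note sb = sb[OF dims]
  have "S4 = 0\<^sub>m q p"
  proof (rule eq_matI)
    fix i j assume "i < dim_row (0\<^sub>m q p :: 'a mat)" "j < dim_col (0\<^sub>m q p :: 'a mat)"
    then have ij: "i < q" "j < p" by auto
    have "S $$ (p + i, j) = S4 $$ (i, j)" unfolding sb(5) using sb(1-4) ij by simp
    then show "S4 $$ (i, j) = 0\<^sub>m q p $$ (i, j)" using z[of "p + i" j] ij by simp
  qed (use sb in auto)
  then show ?thesis using that[of S1 S2 S3] sb by simp
qed

lemma unit_vec_nonzero: "j < n \<Longrightarrow> unit_vec n j \<noteq> (0\<^sub>v n :: 'a::field vec)"
  by (metis index_unit_vec(1) index_zero_vec(1) zero_neq_one)

text \<open>Column j of S is the image of a unit vector of the first block of the second model. It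
  has a minimal orbit in the first model, hence lies in its first block.\<close>

lemma minimal_orbit_zero_entries:
  fixes P P' :: "'a::field mat"
  assumes fb: "first_block P p Ps q" and fb': "first_block P' p' Ps' q'" and n: "p + q = n" "p' + q' = n"
    and R: "R \<in> GL n" and S: "S \<in> GL n"
    and W': "block_model (P' # Ps') = (\<lambda>M. R * M * S) ` block_model (P # Ps)"
    and ij: "p \<le> i" "i < n" "j < p'"
  shows "S $$ (i, j) = 0"
proof -
  interpret F: first_block P p Ps q by fact
  interpret F': first_block P' p' Ps' q' by fact
  note Sc = GL_carrier[OF S]
  have Wc: "block_model (P # Ps) \<subseteq> carrier_mat n n"
    unfolding F.model_elems n(1)[symmetric] using F.Pc F.tailD(1) by (auto dest!: alternate_matsD)
  have jn: "j < n" using ij n by linarith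
  have "minimal_orbit n (block_model (P' # Ps')) (unit_vec n j)"
    using F'.minimal_orbit_iff'[of "unit_vec n j"] unit_vec_nonzero[OF jn] ij(3) unfolding n by simp
  then have m: "minimal_orbit n (block_model (P # Ps)) (S *\<^sub>v unit_vec n j)"
    by (intro minimal_orbit_equivalent[OF R S Wc W']) simp
  have c: "S *\<^sub>v unit_vec n j \<in> carrier_vec n" using Sc by simp
  have nz: "S *\<^sub>v unit_vec n j \<noteq> 0\<^sub>v n"
  proof
    assume "S *\<^sub>v unit_vec n j = 0\<^sub>v n"
    then have "det S = 0"
      using det_0_iff_vec_prod_zero_field[OF Sc] unit_vec_nonzero[OF jn] unit_vec_carrier[of n j] by blast
    then show False using S by (simp add: GL_iff_det)
  qed
  have "(S *\<^sub>v unit_vec n j) $ i = 0" using F.minimal_orbit_iff'[of "S *\<^sub>v unit_vec n j"] m c nz ij unfolding n by blast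
  moreover have "(S *\<^sub>v unit_vec n j) $ i = S $$ (i, j)" using Sc ij jn by (simp add: scalar_prod_right_unit[of _ n])
  ultimately show ?thesis by simp
qed

section \<open>Uniqueness and the classification theorem\<close>

lemma block_join_components:
  fixes V1 :: "'a::field mat set"
  assumes V: "V1 \<subseteq> carrier_mat p p" "V2 \<subseteq> carrier_mat q q" "V1' \<subseteq> carrier_mat p p" "V2' \<subseteq> carrier_mat q q"
    and ne: "V1 \<noteq> {}" "V2 \<noteq> {}" "V1' \<noteq> {}" "V2' \<noteq> {}"
    and R: "R1 \<in> carrier_mat p p" "R2 \<in> carrier_mat p q" "R3 \<in> carrier_mat q q"
    and S: "S1 \<in> carrier_mat p p" "S2 \<in> carrier_mat p q" "S3 \<in> carrier_mat q q"
    and eq: "block_join V1' V2' =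
      (\<lambda>M. four_block_mat R1 R2 (0\<^sub>m q p) R3 * M * four_block_mat S1 S2 (0\<^sub>m q p) S3) ` block_join V1 V2"
  shows "V1' = (\<lambda>M. R1 * M * S1) ` V1" "V2' = (\<lambda>M. R3 * M * S3) ` V2"
proof -
  let ?R = "four_block_mat R1 R2 (0\<^sub>m q p) R3" and ?S = "four_block_mat S1 S2 (0\<^sub>m q p) S3"
  have img: "\<exists>D. ?R * four_block_mat A B (0\<^sub>m q p) C * ?S = four_block_mat (R1 * A * S1) D (0\<^sub>m q p) (R3 * C * S3)"
    if A: "A \<in> carrier_mat p p" and B: "B \<in> carrier_mat p q" and C: "C \<in> carrier_mat q q" for A B C
    unfolding mult_block_triangular[OF R A B C]
    using mult_block_triangular[of "R1 * A" p "R1 * B + R2 * C" q "R3 * C", OF _ _ _ S] R A B C by auto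
  have fwd: "R1 * A * S1 \<in> V1' \<and> R3 * C * S3 \<in> V2'" if A: "A \<in> V1" and C: "C \<in> V2" for A C
  proof -
    have Ac: "A \<in> carrier_mat p p" and Cc: "C \<in> carrier_mat q q" using A C V by auto
    have "four_block_mat A (0\<^sub>m p q) (0\<^sub>m q p) C \<in> block_join V1 V2" by (rule block_joinI[OF A C Ac Cc]) simp
    then have "?R * four_block_mat A (0\<^sub>m p q) (0\<^sub>m q p) C * ?S \<in> block_join V1' V2'" unfolding eq by (rule imageI)
    then obtain A' B' C' where *: "?R * four_block_mat A (0\<^sub>m p q) (0\<^sub>m q p) C * ?S = four_block_mat A' B' (0\<^sub>m q p) C'"
      "A' \<in> V1'" "C' \<in> V2'" unfolding block_join_elems[OF V(3,4)] by blast
    obtain D where D: "?R * four_block_mat A (0\<^sub>m p q) (0\<^sub>m q p) C * ?S = four_block_mat (R1 * A * S1) D (0\<^sub>m q p) (R3 * C * S3)"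
      using img[OF Ac zero_carrier_mat Cc] by blast
    have c: "R1 * A * S1 \<in> carrier_mat p p" "R3 * C * S3 \<in> carrier_mat q q"
      using mult_carrier_mat[OF mult_carrier_mat[OF R(1) Ac] S(1)] mult_carrier_mat[OF mult_carrier_mat[OF R(3) Cc] S(3)] by auto
    have "four_block_mat (R1 * A * S1) D (0\<^sub>m q p) (R3 * C * S3) = four_block_mat A' B' (0\<^sub>m q p) C'"
      using *(1) D by simp
    from four_block_mat_inject[OF this c(1) subsetD[OF V(3) *(2)] c(2) subsetD[OF V(4) *(3)]]
    show ?thesis using *(2,3) by simp
  qed
  have bwd: "\<exists>A\<in>V1. \<exists>C\<in>V2. A' = R1 * A * S1 \<and> C' = R3 * C * S3" if A': "A' \<in> V1'" and C': "C' \<in> V2'" for A' C'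
  proof -
    have Ac': "A' \<in> carrier_mat p p" and Cc': "C' \<in> carrier_mat q q" using A' C' V by auto
    have "four_block_mat A' (0\<^sub>m p q) (0\<^sub>m q p) C' \<in> block_join V1' V2'" by (rule block_joinI[OF A' C' Ac' Cc']) simp
    then obtain M where M: "four_block_mat A' (0\<^sub>m p q) (0\<^sub>m q p) C' = ?R * M * ?S" "M \<in> block_join V1 V2"
      unfolding eq by blast
    obtain A B C where *: "M = four_block_mat A B (0\<^sub>m q p) C" "A \<in> V1" "B \<in> carrier_mat p q" "C \<in> V2"
      using M(2) unfolding block_join_elems[OF V(1,2)] by blast
    have Ac: "A \<in> carrier_mat p p" and Cc: "C \<in> carrier_mat q q" using * V by auto
    obtain D where D: "?R * M * ?S = four_block_mat (R1 * A * S1) D (0\<^sub>m q p) (R3 * C * S3)"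
      using img[OF Ac *(3) Cc] unfolding *(1) by blast
    have c: "R1 * A * S1 \<in> carrier_mat p p" "R3 * C * S3 \<in> carrier_mat q q"
      using mult_carrier_mat[OF mult_carrier_mat[OF R(1) Ac] S(1)] mult_carrier_mat[OF mult_carrier_mat[OF R(3) Cc] S(3)] by auto
    from four_block_mat_inject[OF M(1)[unfolded D] Ac' c(1) Cc' c(2)] show ?thesis using *(2,4) by blast
  qed
  obtain A0 C0 A0' C0' where "A0 \<in> V1" "C0 \<in> V2" "A0' \<in> V1'" "C0' \<in> V2'" using ne by blast
  then show "V1' = (\<lambda>M. R1 * M * S1) ` V1" "V2' = (\<lambda>M. R3 * M * S3) ` V2"
    using fwd bwd by blast+
qed

text \<open>R S is the image of I, so R S = I + M0 with M0 in W', and the translation by M0 is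
  absorbed by W'.\<close>

lemma model_space_linear_part:
  fixes W W' :: "'a::field mat set"
  assumes W: "matrix_subspace n W" and W': "matrix_subspace n W'" and R: "R \<in> carrier_mat n n" and S: "S \<in> carrier_mat n n"
    and eq: "(\<lambda>M. 1\<^sub>m n + M) ` W' = (\<lambda>M. R * M * S) ` (\<lambda>M. 1\<^sub>m n + M) ` W"
  shows "W' = (\<lambda>M. R * M * S) ` W"
proof -
  note WD = matrix_subspaceD[OF W] and WD' = matrix_subspaceD[OF W']
  have dist: "R * (1\<^sub>m n + M) * S = R * S + R * M * S" if "M \<in> carrier_mat n n" for M
    using mult_add_distrib_both[OF R _ that S, of "1\<^sub>m n"] R by simp
  have img: "R * S + R * M * S \<in> (\<lambda>M. 1\<^sub>m n + M) ` W'" if "M \<in> W" for M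
    using that dist[of M] WD(1) unfolding eq image_image by (metis (no_types, lifting) image_eqI subsetD)
  have "R * 0\<^sub>m n n * S = 0\<^sub>m n n" using R S by simp
  then have "R * S \<in> (\<lambda>M. 1\<^sub>m n + M) ` W'" using img[OF WD(2)] R S by simp
  then obtain M0 where M0: "M0 \<in> W'" "R * S = 1\<^sub>m n + M0" by blast
  have M0c: "M0 \<in> carrier_mat n n" using M0(1) WD'(1) by blast
  have cancel: "Y = X - Z" if "1\<^sub>m n + Z + Y = 1\<^sub>m n + X" "X \<in> carrier_mat n n" "Y \<in> carrier_mat n n" "Z \<in> carrier_mat n n"
    for X Y Z :: "'a mat"
  proof (rule eq_matI)
    fix i j assume ij: "i < dim_row (X - Z)" "j < dim_col (X - Z)"
    have "(1\<^sub>m n + Z + Y) $$ (i, j) = (1\<^sub>m n + X) $$ (i, j)" using that(1) by simp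
    then show "Y $$ (i, j) = (X - Z) $$ (i, j)" using ij that(2-4) by (simp add: algebra_simps)
  qed (use that in auto)
  have diff: "X - M0 \<in> W'" if "X \<in> W'" for X
  proof -
    have "X - M0 = X + (- 1) \<cdot>\<^sub>m M0" using WD'(1) that M0c by (intro eq_matI) auto
    then show ?thesis using WD'(3)[OF that WD'(4)[OF M0(1)]] by simp
  qed
  show ?thesis
  proof (intro equalityI subsetI)
    fix M' assume M': "M' \<in> W'"
    have Mc': "M' \<in> carrier_mat n n" using M' WD'(1) by blast
    have "1\<^sub>m n + (M0 + M') \<in> (\<lambda>M. 1\<^sub>m n + M) ` W'" using WD'(3)[OF M0(1) M'] by blast
    then obtain M where M: "M \<in> W" "1\<^sub>m n + (M0 + M') = R * (1\<^sub>m n + M) * S" unfolding eq by blast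
    have Mc: "M \<in> carrier_mat n n" using M(1) WD(1) by blast
    have RMS: "R * M * S \<in> carrier_mat n n" using mult_carrier_mat[OF mult_carrier_mat[OF R Mc] S] .
    have "1\<^sub>m n + M0 + R * M * S = 1\<^sub>m n + (M0 + M')" using M(2) dist[OF Mc] M0(2) by simp
    from cancel[OF this _ RMS M0c] have "R * M * S = M0 + M' - M0" using M0c Mc' by simp
    also have "\<dots> = M'" using M0c Mc' by (intro eq_matI) auto
    finally show "M' \<in> (\<lambda>M. R * M * S) ` W" using M(1) by blast
  next
    fix N assume "N \<in> (\<lambda>M. R * M * S) ` W"
    then obtain M where M: "M \<in> W" "N = R * M * S" by blast
    have Mc: "M \<in> carrier_mat n n" using M(1) WD(1) by blast
    have Nc: "N \<in> carrier_mat n n" unfolding M(2) using mult_carrier_mat[OF mult_carrier_mat[OF R Mc] S] .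
    obtain X where X: "X \<in> W'" "R * S + N = 1\<^sub>m n + X" using img[OF M(1)] unfolding M(2) by blast
    have "N = X - M0" by (rule cancel) (use X M0 M0c Nc WD'(1) in auto)
    then show "N \<in> W'" using diff[OF X(1)] by simp
  qed
qed

text \<open>By minimal orbits, S and its inverse map first blocks into first blocks, so these have
  the same size and S is block triangular. R is then block triangular too, being the product of R S,
  an element of the model space, with the inverse of S. Equivalence can now be read off on the
  diagonal blocks.\<close>

lemma first_block_equivalent:
  fixes P P' :: "'a::field mat"
  assumes fb: "first_block P p Ps q" and fb': "first_block P' p' Ps' q'" and n: "p + q = n" "p' + q' = n"
    and eq: "equivalent_sets n (model_space n (P # Ps)) (model_space n (P' # Ps'))"
  shows "p = p'" "q = q'" "equivalent_sets p (model_space p [P]) (model_space p [P'])"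
    "equivalent_sets q (model_space q Ps) (model_space q Ps')"
proof -
  interpret F: first_block P p Ps q by fact
  interpret F': first_block P' p' Ps' q' by fact
  obtain R S where R: "R \<in> GL n" and S: "S \<in> GL n"
    and RS: "model_space n (P' # Ps') = (\<lambda>M. R * M * S) ` model_space n (P # Ps)"
    using eq unfolding equivalent_sets_def by blast
  note Rc = GL_carrier[OF R] and Sc = GL_carrier[OF S]
  have ms: "matrix_subspace n (block_model (P # Ps))"
  proof -
    have "dim_row P = p" using F.Pc by simp
    then show ?thesis unfolding block_model_Cons n(1)[symmetric]
      using matrix_subspace_block_join[OF matrix_subspace_mult_alternate[OF F.Pc] F.tail] by simp
  qed
  have ms': "matrix_subspace n (block_model (P' # Ps'))"
  proof -
    have "dim_row P' = p'" using F'.Pc by simp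
    then show ?thesis unfolding block_model_Cons n(2)[symmetric]
      using matrix_subspace_block_join[OF matrix_subspace_mult_alternate[OF F'.Pc] F'.tail] by simp
  qed
  have lin: "block_model (P' # Ps') = (\<lambda>M. R * M * S) ` block_model (P # Ps)"
    by (rule model_space_linear_part[OF ms ms' Rc Sc]) (use RS in \<open>simp add: model_space_eq\<close>)
  obtain R' where R': "R' \<in> GL n" "R * R' = 1\<^sub>m n" "R' * R = 1\<^sub>m n" by (rule GL_inverse[OF R])
  obtain S' where S': "S' \<in> GL n" "S * S' = 1\<^sub>m n" "S' * S = 1\<^sub>m n" by (rule GL_inverse[OF S])
  note Rc' = GL_carrier[OF R'(1)] and Sc' = GL_carrier[OF S'(1)]
  have lin': "block_model (P # Ps) = (\<lambda>M. R' * M * S') ` block_model (P' # Ps')"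
  proof -
    have "R' * (R * M * S) * S' = M" if "M \<in> block_model (P # Ps)" for M
    proof -
      have M: "M \<in> carrier_mat n n" using that matrix_subspaceD(1)[OF ms] by blast
      have "R' * (R * M * S) * S' = R' * (R * (M * (S * S')))"
        using Rc Sc Rc' Sc' M by (simp add: assoc_mult_mat[of _ n n _ n _ n] mult_carrier_mat[of _ n n _ n])
      also have "\<dots> = M" using cancel_mult_left[OF R'(3) Rc' Rc M] S'(2) M by simp
      finally show ?thesis .
    qed
    then show ?thesis unfolding lin image_image by simp
  qed
  have zS: "S $$ (i, j) = 0" if "p \<le> i" "i < n" "j < p'" for i j
    by (rule minimal_orbit_zero_entries[OF fb fb' n R S lin that])
  have zS': "S' $$ (i, j) = 0" if "p' \<le> i" "i < n" "j < p" for i j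
    by (rule minimal_orbit_zero_entries[OF fb' fb n(2,1) R'(1) S'(1) lin' that])
  have "p' \<le> p" by (rule GL_zero_block_le[OF S _ zS]) (use n in auto)
  moreover have "p \<le> p'" by (rule GL_zero_block_le[OF S'(1) _ zS']) (use n in auto)
  ultimately show pp: "p = p'" by simp
  then show qq: "q = q'" using n by simp
  note Sc_n = Sc[folded n(1)] and Sc'_n = Sc'[folded n(1)]
  obtain S1 S2 S3 where Sb: "S = four_block_mat S1 S2 (0\<^sub>m q p) S3" "S1 \<in> carrier_mat p p" "S2 \<in> carrier_mat p q" "S3 \<in> carrier_mat q q"
    by (rule block_triangular_form[OF Sc_n]) (use zS pp n in auto)
  obtain T1 T2 T3 where Tb: "S' = four_block_mat T1 T2 (0\<^sub>m q p) T3" "T1 \<in> carrier_mat p p" "T2 \<in> carrier_mat p q" "T3 \<in> carrier_mat q q"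
    by (rule block_triangular_form[OF Sc'_n]) (use zS' pp n in auto)
  have mc1: "model_space p [P] \<subseteq> carrier_mat p p" "model_space p [P'] \<subseteq> carrier_mat p p"
    using model_space_one_carrier[OF F.Pc] model_space_one_carrier[OF F'.Pc] pp by auto
  have mc2: "model_space q Ps \<subseteq> carrier_mat q q" "model_space q Ps' \<subseteq> carrier_mat q q"
    using model_space_carrier[OF F.Ps] model_space_carrier[OF F'.Ps] F.q F'.q qq by auto
  have mj: "model_space n (P # Ps) = block_join (model_space p [P]) (model_space q Ps)"
    using model_space_Cons[OF F.Pc F.Ps F.q] n by simp
  have mj': "model_space n (P' # Ps') = block_join (model_space p [P']) (model_space q Ps')"
    using model_space_Cons[OF F'.Pc F'.Ps F'.q] n pp qq by simp
  have one1: "1\<^sub>m p \<in> model_space p [P]" "1\<^sub>m p \<in> model_space p [P']"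
    unfolding model_space_one[OF F.Pc] model_space_one[OF F'.Pc[folded pp]]
    using alternate_mats_closed(1)[of p] F.Pc F'.Pc[folded pp] by (auto intro!: image_eqI[of _ _ "0\<^sub>m p p"])
  have one2: "1\<^sub>m q \<in> model_space q Ps" "1\<^sub>m q \<in> model_space q Ps'"
    unfolding model_space_eq using F.tailD(2) F'.tailD(2) qq by (auto intro!: image_eqI[of _ _ "0\<^sub>m q q"])
  have "1\<^sub>m n \<in> model_space n (P # Ps)"
    unfolding model_space_eq using matrix_subspaceD(2)[OF ms] by (auto intro!: image_eqI[of _ _ "0\<^sub>m n n"])
  then have "R * 1\<^sub>m n * S \<in> model_space n (P' # Ps')" unfolding RS by (rule imageI)
  then have "R * S \<in> block_join (model_space p [P']) (model_space q Ps')" using Rc mj' by simp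
  then obtain X Y Z where XYZ: "R * S = four_block_mat X Y (0\<^sub>m q p) Z" "X \<in> model_space p [P']" "Y \<in> carrier_mat p q"
    "Z \<in> model_space q Ps'" unfolding block_join_elems[OF mc1(2) mc2(2)] by blast
  have Xc: "X \<in> carrier_mat p p" and Zc: "Z \<in> carrier_mat q q" using XYZ mc1 mc2 by auto
  define R1 R2 R3 where "R1 = X * T1" and "R2 = X * T2 + Y * T3" and "R3 = Z * T3"
  have Rcs: "R1 \<in> carrier_mat p p" "R2 \<in> carrier_mat p q" "R3 \<in> carrier_mat q q"
    unfolding R1_def R2_def R3_def using Xc Zc XYZ(3) Tb by auto
  have "R = R * S * S'" using assoc_mult_mat[OF Rc Sc Sc'] S'(2) Rc by simp
  also have "\<dots> = four_block_mat R1 R2 (0\<^sub>m q p) R3"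
    unfolding XYZ(1) Tb(1) R1_def R2_def R3_def by (rule mult_block_triangular[OF Xc XYZ(3) Zc Tb(2-4)])
  finally have Rb: "R = four_block_mat R1 R2 (0\<^sub>m q p) R3" .
  have G: "R1 \<in> GL p" "R3 \<in> GL q" "S1 \<in> GL p" "S3 \<in> GL q"
    using GL_block_triangular[OF Rcs] GL_block_triangular[OF Sb(2-4)] R S Rb Sb(1) n(1) by auto
  have "block_join (model_space p [P']) (model_space q Ps') =
      (\<lambda>M. four_block_mat R1 R2 (0\<^sub>m q p) R3 * M * four_block_mat S1 S2 (0\<^sub>m q p) S3) ` block_join (model_space p [P]) (model_space q Ps)"
    using RS unfolding mj mj' Rb Sb(1) .
  note comp = block_join_components[OF mc1(1) mc2(1) mc1(2) mc2(2) _ _ _ _ Rcs Sb(2-4) this]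
  have "model_space p [P'] = (\<lambda>M. R1 * M * S1) ` model_space p [P]"
    by (rule comp(1)) (use one1 one2 in auto)
  then show "equivalent_sets p (model_space p [P]) (model_space p [P'])" unfolding equivalent_sets_def using G by blast
  have "model_space q Ps' = (\<lambda>M. R3 * M * S3) ` model_space q Ps"
    by (rule comp(2)) (use one1 one2 in auto)
  then show "equivalent_sets q (model_space q Ps) (model_space q Ps')" unfolding equivalent_sets_def using G by blast
qed

lemma GL_list_dims:
  assumes "list_all2 (\<lambda>m P. P \<in> GL m) ns Ps"
  shows "ns = map dim_row Ps" "\<forall>P\<in>set Ps. P \<in> carrier_mat (dim_row P) (dim_row P)"
proof -
  have "ns = map dim_row Ps \<and> (\<forall>P\<in>set Ps. P \<in> carrier_mat (dim_row P) (dim_row P))"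
    using assms
  proof (induction rule: list_all2_induct)
    case (Cons m ns P Ps)
    have "P \<in> carrier_mat m m" by (rule GL_carrier[OF Cons.hyps(1)])
    moreover from this have "dim_row P = m" by simp
    ultimately show ?case using Cons.IH by simp
  qed simp
  then show "ns = map dim_row Ps" "\<forall>P\<in>set Ps. P \<in> carrier_mat (dim_row P) (dim_row P)" by blast+
qed

text \<open>The number of blocks is part of the induction: positive block sizes prevent one list
  from ending while the other still contributes to n.\<close>

lemma decomposition_unique:
  fixes Ps Ps' :: "'a::field mat list"
  assumes "\<forall>m\<in>set ns. 0 < m" "\<forall>m\<in>set ns'. 0 < m"
    "list_all2 (\<lambda>m P. P \<in> GL m \<and> non_isotropic m P) ns Ps" "list_all2 (\<lambda>m P. P \<in> GL m \<and> non_isotropic m P) ns' Ps'"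
    "n = sum_list ns" "n = sum_list ns'" "equivalent_sets n (model_space n Ps) (model_space n Ps')"
  shows "length Ps = length Ps' \<and>
    (\<forall>k<length Ps. similar_forms (ns ! k) (quad_form (Ps ! k)) (ns' ! k) (quad_form (Ps' ! k)))"
  using assms
proof (induction ns arbitrary: Ps ns' Ps' n)
  case Nil
  then have "ns' = []" by (cases ns') auto
  then show ?case using Nil by simp
next
  case (Cons p ns)
  note pr = Cons.prems
  obtain P Qs where Ps: "Ps = P # Qs" and P: "P \<in> GL p" "non_isotropic p P"
    and Qs: "list_all2 (\<lambda>m P. P \<in> GL m \<and> non_isotropic m P) ns Qs" using pr(3) by (auto simp: list_all2_Cons1)
  have "0 < p" using pr(1) by simp
  then have "ns' \<noteq> []" using pr(5,6) by auto
  then obtain p' ms' where ns': "ns' = p' # ms'" by (cases ns') auto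
  obtain P' Qs' where Ps': "Ps' = P' # Qs'" and P': "P' \<in> GL p'" "non_isotropic p' P'"
    and Qs': "list_all2 (\<lambda>m P. P \<in> GL m \<and> non_isotropic m P) ms' Qs'"
    using pr(4) unfolding ns' by (auto simp: list_all2_Cons1)
  have "0 < p'" using pr(2) ns' by simp
  have d: "ns = map dim_row Qs" "\<forall>P\<in>set Qs. P \<in> carrier_mat (dim_row P) (dim_row P)"
    using GL_list_dims[OF list_all2_mono[OF Qs]] by blast+
  have d': "ms' = map dim_row Qs'" "\<forall>P\<in>set Qs'. P \<in> carrier_mat (dim_row P) (dim_row P)"
    using GL_list_dims[OF list_all2_mono[OF Qs']] by blast+
  have fb: "first_block P p Qs (sum_list ns)" by unfold_locales (use P \<open>0 < p\<close> d in auto)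
  have fb': "first_block P' p' Qs' (sum_list ms')" by unfold_locales (use P' \<open>0 < p'\<close> d' in auto)
  have n: "p + sum_list ns = n" "p' + sum_list ms' = n" using pr(5,6) ns' by auto
  note step = first_block_equivalent[OF fb fb' n pr(7)[unfolded Ps Ps']]
  have sim: "similar_forms p (quad_form P) p (quad_form P')"
    by (rule one_block_similar[OF P(1) _ \<open>0 < p\<close> _ step(3)]) (use P' step(1) in auto)
  have tail: "length Qs = length Qs' \<and>
    (\<forall>k<length Qs. similar_forms (ns ! k) (quad_form (Qs ! k)) (ms' ! k) (quad_form (Qs' ! k)))"
    by (rule Cons.IH[OF _ _ Qs Qs' refl step(2) step(4)]) (use pr(1,2) ns' in auto)
  have "similar_forms ((p # ns) ! k) (quad_form (Ps ! k)) (ns' ! k) (quad_form (Ps' ! k))" if "k < length Ps" for k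
    using that sim tail step(1) unfolding Ps Ps' ns' by (cases k) auto
  then show ?case using tail unfolding Ps Ps' by simp
qed

section \<open>Existence of a decomposition\<close>

lemma dim_fun_of_mat_left_mult:
  fixes W :: "'a::field mat set"
  assumes W: "matrix_subspace n W" and T: "T \<in> GL n"
  shows "vector_space.dim mat_scale (fun_of_mat ` (\<lambda>M. T * M) ` W) = vector_space.dim mat_scale (fun_of_mat ` W)"
proof -
  interpret bilinear_action mat_scale vec_scale "mat_act n :: (nat \<Rightarrow> nat \<Rightarrow> 'a) \<Rightarrow> _" by (rule bilinear_action_mat_act)
  interpret OO: vector_space_pair "mat_scale :: 'a \<Rightarrow> _" "mat_scale :: 'a \<Rightarrow> _" ..
  note WD = matrix_subspaceD[OF W] and Tc = GL_carrier[OF T]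
  note sf = subspace_fun_of_mat[OF WD]
  define f :: "(nat \<Rightarrow> nat \<Rightarrow> 'a) \<Rightarrow> nat \<Rightarrow> nat \<Rightarrow> 'a" where "f m = (\<lambda>i j. \<Sum>k<n. fun_of_mat T i k * m k j)" for m
  have lin: "Vector_Spaces.linear mat_scale mat_scale f"
    using Op.vector_space_axioms
    by (auto simp: Vector_Spaces.linear_iff f_def mat_scale_def fun_eq_iff algebra_simps sum.distrib sum_distrib_left)
  have fT: "f (fun_of_mat M) = fun_of_mat (T * M)" if "M \<in> W" for M
  proof (intro ext)
    fix i j
    have Mc: "M \<in> carrier_mat n n" using WD(1) that by blast
    show "f (fun_of_mat M) i j = fun_of_mat (T * M) i j"
      using Mc Tc by (cases "i < n \<and> j < n") (auto simp: f_def fun_of_mat_def scalar_prod_def lessThan_atLeast0 intro!: sum.cong)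
  qed
  obtain T' where T': "T' \<in> GL n" "T * T' = 1\<^sub>m n" "T' * T = 1\<^sub>m n" by (rule GL_inverse[OF T])
  note Tc' = GL_carrier[OF T'(1)]
  have ker: "{m \<in> fun_of_mat ` W. f m \<in> {0}} = {0}"
  proof (intro equalityI subsetI)
    fix m assume "m \<in> {m \<in> fun_of_mat ` W. f m \<in> {0}}"
    then obtain M where M: "M \<in> W" "m = fun_of_mat M" "fun_of_mat (T * M) = 0" using fT by auto
    have Mc: "M \<in> carrier_mat n n" using WD(1) M(1) by blast
    have "fun_of_mat (T * M) = fun_of_mat (0\<^sub>m n n)" using M(3) fun_of_mat_ops(3)[OF Tc] by simp
    then have "T * M = 0\<^sub>m n n" by (intro fun_of_mat_inj[of _ n]) (use Tc Mc in auto)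
    then have "M = T' * 0\<^sub>m n n" using cancel_mult_left[OF T'(3) Tc' Tc Mc] by simp
    also have "\<dots> = 0\<^sub>m n n" using Tc' by simp
    finally show "m \<in> {0}" using M(2) fun_of_mat_ops(3)[OF Tc] by simp
  next
    fix m assume "m \<in> {0 :: nat \<Rightarrow> nat \<Rightarrow> 'a}"
    then show "m \<in> {m \<in> fun_of_mat ` W. f m \<in> {0}}"
      using Op.subspace_0[OF sf(1)] OO.linear_0[OF lin] by simp
  qed
  have f0: "Op.fin_dim {0}" unfolding Op.fin_dim_def by (intro exI[of _ "{}"]) simp
  have "Op.dim {0} = 0" using Op.dim_span[of "{}"] Op.dim_eq_card_independent[of "{}"] by (simp add: Op.independent_empty)
  moreover have "f ` fun_of_mat ` W \<union> {0} = fun_of_mat ` (\<lambda>M. T * M) ` W"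
  proof -
    have "f ` fun_of_mat ` W = fun_of_mat ` (\<lambda>M. T * M) ` W" unfolding image_image using fT by (intro image_cong) auto
    moreover have "0 \<in> f ` fun_of_mat ` W" using Op.subspace_0[OF sf(1)] OO.linear_0[OF lin] by (metis image_eqI)
    ultimately show ?thesis by auto
  qed
  ultimately show ?thesis
    using OO.dim_preimage_image(1)[OF lin sf Op.subspace_single_0 f0] unfolding ker by simp
qed

text \<open>The base point A belongs to the affine space, hence is invertible. A vector v fixed by
  the product of the inverse of A with M would be killed by A - M, which is again in the affine
  space.\<close>

lemma exists_decomposition:
  fixes \<V> :: "'a::field mat set"
  assumes tau: "\<tau> \<noteq> (0::'a)" "\<tau> \<noteq> 1" and aff: "affine_subspace_of_dim n (n choose 2) \<V>" and GL: "\<V> \<subseteq> GL n"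
  shows "\<exists>ns Ps. non_isotropic_decomposition n \<V> ns Ps"
proof -
  obtain A W0 where Ac: "A \<in> carrier_mat n n" and W0: "linear_subspace_of_dim n (n choose 2) W0"
    and V: "\<V> = (\<lambda>M. A + M) ` W0" using aff unfolding affine_subspace_of_dim_def by blast
  note WD0 = linear_subspace_of_dimD[OF W0]
  have ms0: "matrix_subspace n W0" unfolding matrix_subspace_def using WD0 by blast
  have "A + 0\<^sub>m n n \<in> \<V>" unfolding V using WD0(2) by blast
  then have A: "A \<in> GL n" using GL Ac by auto
  obtain A' where A': "A' \<in> GL n" "A * A' = 1\<^sub>m n" "A' * A = 1\<^sub>m n" by (rule GL_inverse[OF A])
  note Ac' = GL_carrier[OF A'(1)]
  define W where "W = (\<lambda>M. A' * M) ` W0"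
  have ms: "matrix_subspace n W"
    unfolding matrix_subspace_def W_def
  proof (intro conjI ballI allI subsetI)
    show "0\<^sub>m n n \<in> (\<lambda>M. A' * M) ` W0" using WD0(2) Ac' by (auto intro!: image_eqI[of _ _ "0\<^sub>m n n"])
    fix X assume "X \<in> (\<lambda>M. A' * M) ` W0"
    then obtain M where M: "M \<in> W0" "X = A' * M" by blast
    have Mc: "M \<in> carrier_mat n n" using M(1) WD0(1) by blast
    show "X \<in> carrier_mat n n" using M(2) Ac' Mc by simp
    show "c \<cdot>\<^sub>m X \<in> (\<lambda>M. A' * M) ` W0" for c
      unfolding M(2) mult_smult_distrib[OF Ac' Mc, symmetric] using WD0(4)[OF M(1)] by (rule imageI)
    fix Y assume "Y \<in> (\<lambda>M. A' * M) ` W0"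
    then obtain N where N: "N \<in> W0" "Y = A' * N" by blast
    have Nc: "N \<in> carrier_mat n n" using N(1) WD0(1) by blast
    show "X + Y \<in> (\<lambda>M. A' * M) ` W0"
      unfolding M(2) N(2) mult_add_distrib_mat[OF Ac' Mc Nc, symmetric] using WD0(3)[OF M(1) N(1)] by (rule imageI)
  qed
  have dimW: "vector_space.dim mat_scale (fun_of_mat ` W) = n choose 2"
    unfolding W_def dim_fun_of_mat_left_mult[OF ms0 A'(1)] by (rule dim_fun_of_mat[OF W0])
  have nofix: "\<forall>X\<in>W. \<forall>v\<in>carrier_vec n. X *\<^sub>v v = v \<longrightarrow> v = 0\<^sub>v n"
  proof (intro ballI impI)
    fix X v assume X: "X \<in> W" and v: "v \<in> carrier_vec n" and Xv: "X *\<^sub>v v = v"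
    obtain M where M: "M \<in> W0" "X = A' * M" using X unfolding W_def by blast
    have Mc: "M \<in> carrier_mat n n" using M(1) WD0(1) by blast
    have Mv: "M *\<^sub>v v = A *\<^sub>v v"
    proof -
      have "A *\<^sub>v v = A *\<^sub>v (A' *\<^sub>v (M *\<^sub>v v))" using Xv Ac' Mc v unfolding M(2) by (simp add: assoc_mult_mat_vec[of _ n n _ n])
      also have "\<dots> = M *\<^sub>v v" by (rule cancel_mult_vec[OF A'(2) Ac Ac']) (use Mc v in simp)
      finally show ?thesis by simp
    qed
    let ?D = "A + (- 1) \<cdot>\<^sub>m M"
    have "?D \<in> \<V>" unfolding V using WD0(4)[OF M(1)] by blast
    then have D: "?D \<in> GL n" using GL by blast
    have "?D *\<^sub>v v = A *\<^sub>v v + (- 1) \<cdot>\<^sub>v (A *\<^sub>v v)"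
      using Ac Mc v Mv by (simp add: add_mult_distrib_mat_vec[of _ n n] smult_mat_mult_vec[of _ n n])
    also have "\<dots> = 0\<^sub>v n" using Ac v by (intro eq_vecI) auto
    finally show "v = 0\<^sub>v n"
      using det_0_iff_vec_prod_zero_field[OF GL_carrier[OF D]] D v unfolding GL_iff_det by blast
  qed
  obtain Ps G H where Ps: "\<forall>P\<in>set Ps. 0 < dim_row P \<and> non_isotropic (dim_row P) P" and n: "n = sum_list (map dim_row Ps)"
    and G: "G \<in> GL n" and H: "H \<in> GL n" "G * H = 1\<^sub>m n" "H * G = 1\<^sub>m n" and W: "W = (\<lambda>A. G * A * H) ` block_model Ps"
    using trivial_spectrum_classification[OF tau ms dimW nofix] by blast
  note Gc = GL_carrier[OF G] and Hc = GL_carrier[OF H(1)]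
  have "matrix_subspace n (block_model Ps)"
    unfolding n using Ps by (intro matrix_subspace_block_model) (auto simp: non_isotropic_def)
  note BD = matrix_subspaceD[OF this]
  \<comment> \<open>W is G times the block model times H, with H inverse to G. Multiplying by H A'
    on the left and by G on the right thus undoes both the normalization at A and the change of
    basis.\<close>
  have img: "H * A' * (A + M) * G = 1\<^sub>m n + H * (A' * M) * G" if M: "M \<in> carrier_mat n n" for M
  proof -
    have "H * A' * (A + M) = H * (A' * A + A' * M)"
      using assoc_mult_mat[OF Hc Ac' add_carrier_mat[OF M]] mult_add_distrib_mat[OF Ac' Ac M] by simp
    then have "H * A' * (A + M) * G = H * (1\<^sub>m n + A' * M) * G" unfolding A'(3) by simp
    also have "\<dots> = H * 1\<^sub>m n * G + H * (A' * M) * G"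
      by (rule mult_add_distrib_both[OF Hc _ _ Gc]) (use Ac' M in auto)
    finally show ?thesis using Hc H(3) by simp
  qed
  have HGB: "H * (G * B * H) * G = B" if "B \<in> block_model Ps" for B
  proof -
    have Bc: "B \<in> carrier_mat n n" using that BD(1) by blast
    have "H * (G * B * H) * G = H * (G * (B * (H * G)))"
      using Gc Hc Bc by (simp add: assoc_mult_mat[of _ n n _ n _ n] mult_carrier_mat[of _ n n _ n])
    also have "\<dots> = B" using cancel_mult_left[OF H(3) Hc Gc Bc] H(3) Bc by simp
    finally show ?thesis .
  qed
  have "model_space n Ps = (\<lambda>M. H * A' * M * G) ` \<V>"
  proof (intro equalityI subsetI)
    fix N assume "N \<in> model_space n Ps"
    then obtain B where B: "B \<in> block_model Ps" "N = 1\<^sub>m n + B" unfolding model_space_eq by blast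
    have "G * B * H \<in> W" unfolding W using B(1) by blast
    then obtain M where M: "M \<in> W0" "G * B * H = A' * M" unfolding W_def by blast
    have Mc: "M \<in> carrier_mat n n" using M(1) WD0(1) by blast
    have "N = H * A' * (A + M) * G" unfolding img[OF Mc] M(2)[symmetric] HGB[OF B(1)] B(2) ..
    then show "N \<in> (\<lambda>M. H * A' * M * G) ` \<V>" unfolding V using M(1) by blast
  next
    fix N assume "N \<in> (\<lambda>M. H * A' * M * G) ` \<V>"
    then obtain M where M: "M \<in> W0" "N = H * A' * (A + M) * G" unfolding V by blast
    have Mc: "M \<in> carrier_mat n n" using M(1) WD0(1) by blast
    have "A' * M \<in> W" unfolding W_def using M(1) by blast
    then obtain B where B: "B \<in> block_model Ps" "A' * M = G * B * H" unfolding W by blast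
    have "N = 1\<^sub>m n + B" unfolding M(2) img[OF Mc] B(2) HGB[OF B(1)] ..
    then show "N \<in> model_space n Ps" unfolding model_space_eq using B(1) by blast
  qed
  then have eq: "equivalent_sets n \<V> (model_space n Ps)"
    unfolding equivalent_sets_def using GL_mult[OF H(1) A'(1)] G by blast
  have "list_all2 (\<lambda>m P. P \<in> GL m \<and> non_isotropic m P) (map dim_row Ps) Ps"
    using Ps by (auto simp: list_all2_conv_all_nth intro: non_isotropic_GL)
  then have "non_isotropic_decomposition n \<V> (map dim_row Ps) Ps"
    unfolding non_isotropic_decomposition_def using Ps n eq by auto
  then show ?thesis by blast
qed

lemma exists_third_element:
  assumes "infinite (UNIV :: 'a::field set) \<or> 3 \<le> card (UNIV :: 'a::field set)"
  shows "\<exists>\<tau> :: 'a::field. \<tau> \<noteq> 0 \<and> \<tau> \<noteq> 1"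
proof -
  have "\<not> UNIV \<subseteq> {0, 1 :: 'a}"
  proof
    assume sub: "UNIV \<subseteq> {0, 1 :: 'a}"
    have "finite (UNIV :: 'a set)" using finite_subset[OF sub] by simp
    moreover have "card (UNIV :: 'a set) \<le> card {0, 1 :: 'a}" using card_mono[OF _ sub] by simp
    ultimately show False using assms by simp
  qed
  then show ?thesis by blast
qed

theorem theorem7:
  fixes n :: nat and \<V> :: "'a::field mat set"
  assumes "infinite (UNIV :: 'a set) \<or> 3 \<le> card (UNIV :: 'a set)"
    and "affine_subspace_of_dim n (n choose 2) \<V>"
    and "\<V> \<subseteq> GL n"
  shows "(\<exists>ns Ps. non_isotropic_decomposition n \<V> ns Ps) \<and>
    (\<forall>ns Ps ns' Ps'.
        non_isotropic_decomposition n \<V> ns Ps \<and> non_isotropic_decomposition n \<V> ns' Ps' \<longrightarrow>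
        length Ps = length Ps' \<and>
        (\<forall>k < length Ps.
           similar_forms (ns ! k) (quad_form (Ps ! k)) (ns' ! k) (quad_form (Ps' ! k)))) \<and>
    (\<forall>ns Ps Qs.
        non_isotropic_decomposition n \<V> ns Ps \<and>
        list_all2 (\<lambda>m Q. Q \<in> GL m) ns Qs \<and>
        (\<forall>k < length Ps.
           similar_forms (ns ! k) (quad_form (Qs ! k)) (ns ! k) (quad_form (Ps ! k))) \<longrightarrow>
        equivalent_sets n \<V> (model_space n Qs))"
proof (intro conjI allI impI; (elim conjE)?)
  obtain \<tau> :: 'a where tau: "\<tau> \<noteq> 0" "\<tau> \<noteq> 1" using exists_third_element[OF assms(1)] by blast
  show "\<exists>ns Ps. non_isotropic_decomposition n \<V> ns Ps" by (rule exists_decomposition[OF tau assms(2,3)])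
next
  have Vc: "\<V> \<subseteq> carrier_mat n n" using assms(3) by (auto simp: GL_def)
  fix ns Ps ns' Ps'
  assume d: "non_isotropic_decomposition n \<V> ns Ps" and d': "non_isotropic_decomposition n \<V> ns' Ps'"
  note D = d[unfolded non_isotropic_decomposition_def] and D' = d'[unfolded non_isotropic_decomposition_def]
  have gl: "list_all2 (\<lambda>m P. P \<in> GL m) ns Ps" using D by (auto elim: list_all2_mono)
  have mc: "model_space n Ps \<subseteq> carrier_mat n n"
    using model_space_carrier[OF GL_list_dims(2)[OF gl]] D GL_list_dims(1)[OF gl] by simp
  have "equivalent_sets n (model_space n Ps) \<V>" using equivalent_sets_sym[OF Vc] D by blast
  then have eq: "equivalent_sets n (model_space n Ps) (model_space n Ps')"
    using equivalent_sets_trans[OF mc] D' by blast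
  have "length Ps = length Ps' \<and>
    (\<forall>k<length Ps. similar_forms (ns ! k) (quad_form (Ps ! k)) (ns' ! k) (quad_form (Ps' ! k)))"
    by (rule decomposition_unique[OF _ _ _ _ _ _ eq]) (use D D' in auto)
  then show "length Ps = length Ps'"
    and "\<And>k. k < length Ps \<Longrightarrow> similar_forms (ns ! k) (quad_form (Ps ! k)) (ns' ! k) (quad_form (Ps' ! k))" by blast+
next
  have Vc: "\<V> \<subseteq> carrier_mat n n" using assms(3) by (auto simp: GL_def)
  fix ns Ps Qs
  assume d: "non_isotropic_decomposition n \<V> ns Ps" and Qs: "list_all2 (\<lambda>m Q. Q \<in> GL m) ns Qs"
    and sim: "\<forall>k < length Ps. similar_forms (ns ! k) (quad_form (Qs ! k)) (ns ! k) (quad_form (Ps ! k))"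
  note D = d[unfolded non_isotropic_decomposition_def]
  have gl: "list_all2 (\<lambda>m P. P \<in> GL m) ns Ps" using D by (auto elim: list_all2_mono)
  note dP = GL_list_dims(1)[OF gl] and dQ = GL_list_dims(1)[OF Qs]
  have len: "length Ps = length ns" "length Qs = length ns" using gl Qs by (auto dest: list_all2_lengthD)
  have dims: "dim_row (Ps ! k) = ns ! k" "dim_row (Qs ! k) = ns ! k" if "k < length ns" for k
    using arg_cong[OF dP, of "\<lambda>l. l ! k"] arg_cong[OF dQ, of "\<lambda>l. l ! k"] that len by auto
  have "list_all2 (\<lambda>P Q. dim_row P = dim_row Q \<and> P \<in> GL (dim_row P) \<and> Q \<in> GL (dim_row Q) \<and>
      similar_forms (dim_row Q) (quad_form Q) (dim_row P) (quad_form P)) Ps Qs"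
    unfolding list_all2_conv_all_nth
    using len dims sim list_all2_nthD[OF gl] list_all2_nthD[OF Qs] by simp
  from similar_lists_equivalent[OF this] have "equivalent_sets n (model_space n Ps) (model_space n Qs)"
    using D dP by simp
  then show "equivalent_sets n \<V> (model_space n Qs)" using equivalent_sets_trans[OF Vc] D by blast
qed

end
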